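(* For any kernel $f$, denote $\widetilde f(r)=f(r)\log\frac1r$. Let $(B_t)_{0\le t\le1}$ be planar ($2$-dimensional) Brownian motion started at $0$, with trace $B[0,1]=\{B_t:0\le t\le1\}\subset\mathbf R^2$. Then with probability $1$ there exist random constants $C_1,C_2>0$ (depending on the Brownian path but not on $f$) such that $$C_1\,\mathrm{Cap}_{\widetilde f}([0,1]^2)\;\le\;\mathrm{Cap}_f(B[0,1])\;\le\;C_2\,\mathrm{Cap}_{\widetilde f}([0,1]^2)\qquad\text{for all kernels } f.$$
   Context: A kernel is a weakly decreasing function $f:[0,\infty)\to[0,\infty]$ such that $\lim_{r\downarrow0}f(r)=f(0)$ if this limit is finite. For a Borel measure $\nu$ on $\mathbf R^2$ the energy is $\mathcal E_f(\nu)=\int\int f(|x-y|)\,d\nu(x)\,d\nu(y)$, with $|\cdot|$ the Euclidean norm. For a Borel set $\Lambda\subset\mathbf R^2$ the capacity is $\mathrm{Cap}_f(\Lambda)=\left[\inf_\nu\mathcal E_f(\nu)\right]^{-1}$, the infimum being over Borel probability measures $\nu$ with $\nu(\Lambda)=1$ (with $1/\infty=0$, $1/0=\infty$). $\mathcal E_{\widetilde f}$ and $\mathrm{Cap}_{\widetilde f}$ are defined by the same formulas with $\widetilde f$ in place of $f$. Conventions: $\log(1/0)=\infty$, $0\cdot\infty=0$. Since $\widetilde f(r)\le0$ for $r>1$, the integrand in $\mathcal E_{\widetilde f}$ may take negative values on the square; $\mathcal E_{\widetilde f}(\nu)$ is taken to be $+\infty$ whenever the positive part of the integrand has infinite integral.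 Constants are finite. *)

theory Defs
  imports "HOL-Probability.Probability"
begin

text \<open>Functions on $[0,\infty)$ are represented by functions on \<^typ>\<open>real\<close> whose values at
  negative arguments are never used.\<close>

definition energy_kernel :: "(real \<Rightarrow> ennreal) \<Rightarrow> bool" where
  "energy_kernel f \<longleftrightarrow>
     antimono_on {0..} f \<and>
     (\<forall>L. (f \<longlongrightarrow> L) (at_right 0) \<and> L \<noteq> \<infinity> \<longrightarrow> f 0 = L)"

definition log_recip :: "real \<Rightarrow> ereal" where
  "log_recip r = (if r = 0 then \<infinity> else ereal (ln (1 / r)))"

text \<open>In \<^typ>\<open>ereal\<close> one has $0\cdot(\pm\infty) = 0$.\<close>

definition log_kernel :: "(real \<Rightarrow> ennreal) \<Rightarrow> real \<Rightarrow> ereal" where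
  "log_kernel f r = enn2ereal (f r) * log_recip r"

text \<open>The function \<^const>\<open>e2ennreal\<close> sends negative numbers to \<open>0\<close>, so the two integrals below
  are those of the positive and of the negative part of the integrand.\<close>

definition energy :: "(real \<Rightarrow> ereal) \<Rightarrow> (real ^ 2) measure \<Rightarrow> ereal" where
  "energy g \<nu> =
     (let P = (\<integral>\<^sup>+ x. \<integral>\<^sup>+ y. e2ennreal (g (norm (x - y))) \<partial>\<nu> \<partial>\<nu>);
          N = (\<integral>\<^sup>+ x. \<integral>\<^sup>+ y. e2ennreal (- g (norm (x - y))) \<partial>\<nu> \<partial>\<nu>)
      in if P = \<infinity> then \<infinity> else enn2ereal P - enn2ereal N)"

text \<open>In \<^typ>\<open>ereal\<close> one has \<open>inverse 0 = \<infinity>\<close> and \<open>inverse \<infinity> = 0\<close>, and the infimum over the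
  empty set is \<open>\<infinity>\<close>.\<close>

definition capacity :: "(real \<Rightarrow> ereal) \<Rightarrow> (real ^ 2) set \<Rightarrow> ereal" where
  "capacity g \<Lambda> =
     inverse (INF \<nu> \<in> {\<nu>. prob_space \<nu> \<and> sets \<nu> = sets borel \<and> emeasure \<nu> \<Lambda> = 1}. energy g \<nu>)"

text \<open>Planar Brownian motion on the time interval $[0,1]$, started at the origin: the increment
  over $[s,t]$ has the density of the centred Gaussian law with covariance matrix $(t-s)I$, written
  as the product of its two one-dimensional marginal densities.\<close>

locale planar_brownian_motion = prob_space M
  for M :: "'w measure" +
  fixes B :: "real \<Rightarrow> 'w \<Rightarrow> real ^ 2"
  assumes random_variable_B: "\<And>t. t \<in> {0..1} \<Longrightarrow> random_variable borel (B t)"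
    and start_at_0: "AE \<omega> in M. B 0 \<omega> = 0"
    and independent_increments:
      "\<And>(n::nat) t. t ` {..n} \<subseteq> {0..1} \<Longrightarrow> mono_on {..n} t \<Longrightarrow>
         indep_vars (\<lambda>_. borel) (\<lambda>i \<omega>. B (t (Suc i)) \<omega> - B (t i) \<omega>) {..<n}"
    and gaussian_increments:
      "\<And>s t. 0 \<le> s \<Longrightarrow> s < t \<Longrightarrow> t \<le> 1 \<Longrightarrow>
         distributed M lborel (\<lambda>\<omega>. B t \<omega> - B s \<omega>)
           (\<lambda>x. ennreal (\<Prod>i\<in>UNIV. normal_density 0 (sqrt (t - s)) (x $ i)))"
    and continuous_paths: "AE \<omega> in M. continuous_on {0..1} (\<lambda>t. B t \<omega>)"

end

theory Submission
  imports Defs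
begin

text \<open>Layer-cake integration over the superlevel sets of \<open>f\<close> reduces all energies to the masses
  \<open>(\<nu> \<otimes> \<nu>) {|x - y| \<le> \<rho>}\<close>. For every probability measure on the square these are at least a
  multiple of \<open>\<rho>\<^sup>2\<close>, with the reverse inequality for Lebesgue measure, so that the weight \<open>log
  (1/r)\<close> turns the relevant scale into \<open>\<rho>\<^sup>2 log (1/\<rho>)\<close>. It therefore suffices that almost surely,
  for all small \<open>\<rho>\<close>, every probability measure on the trace gives at least a multiple of \<open>\<rho>\<^sup>2 log
  (1/\<rho>)\<close> to the pairs at distance at most \<open>\<rho>\<close>, and the occupation measure at most such a multiple.
  The former is a bound \<open>O(1 / log (1/\<rho>))\<close> on the area of the \<open>\<rho>\<close>-neighbourhood of the path. Both
  are expectation bounds for the walk sampled at dyadic times; since expectations alone do not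
  give almost sure bounds at all scales, the pairs (respectively the path) are split into pieces
  that are independent within each of finitely many levels, and Chebyshev's inequality applies
  with summable errors.\<close>

section \<open>Energies of measures in the plane\<close>

text \<open>Everything random concerns pair masses at the scales \<open>2^-k\<close>, never
  \<open>f\<close>, so one null set serves all kernels. The logarithm has two origins. For pairs,
  \<open>2k\<close> dyadic levels lie between time \<open>1\<close> and time \<open>4^-k\<close>,
  the time needed to travel \<open>2^-k\<close>, and each level has a bound of the same size. For
  the area, it is the reciprocal of an expected number of returns, a harmonic sum. The path is cut
  there into \<open>2^k\<close> blocks of duration \<open>2^-k\<close>, geometrically halfway
  between \<open>4^-k\<close> and \<open>1\<close>: each block still sees about \<open>k\<close>
  doublings of time, and there are enough blocks for summable errors. Pairs do not split that way,
  because distant blocks also meet; independence is available only within a level. At each scale one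
  sufficiently fine grid is enough and the bounds do not depend on the mesh, so only the scales
  enter Borel-Cantelli. A separate obstacle is deterministic: the logarithmic kernel is negative
  beyond distance \<open>1\<close>, and its energy on the square could almost cancel; a strict gap
  between the two parts of the logarithm excludes this.\<close>

definition pair_integral :: "(real ^ 2) measure \<Rightarrow> (real \<Rightarrow> ennreal) \<Rightarrow> ennreal" where
  "pair_integral \<nu> g = (\<integral>\<^sup>+ x. \<integral>\<^sup>+ y. g (norm (x - y)) \<partial>\<nu> \<partial>\<nu>)"

lemma measurable_dist_pair [measurable]:
  assumes [measurable_cong]: "sets \<nu> = sets (borel :: (real^2) measure)"
  shows "(\<lambda>(x, y). norm (x - y)) \<in> borel_measurable (\<nu> \<Otimes>\<^sub>M \<nu>)"
  by measurable

lemma pair_integral_eq_pair_measure: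
  assumes "finite_measure \<nu>" and [measurable_cong]: "sets \<nu> = sets borel"
    and [measurable]: "g \<in> borel_measurable borel"
  shows "pair_integral \<nu> g = (\<integral>\<^sup>+ (x, y). g (norm (x - y)) \<partial>(\<nu> \<Otimes>\<^sub>M \<nu>))"
proof -
  interpret finite_measure \<nu> by fact
  show ?thesis
    unfolding pair_integral_def
    by (subst nn_integral_fst[symmetric]) auto
qed

lemma pair_integral_mono:
  assumes "\<And>r. 0 \<le> r \<Longrightarrow> g r \<le> h r"
  shows "pair_integral \<nu> g \<le> pair_integral \<nu> h"
  unfolding pair_integral_def by (intro nn_integral_mono assms) simp

lemma pair_integral_cong:
  assumes "\<And>r. 0 \<le> r \<Longrightarrow> g r = h r"
  shows "pair_integral \<nu> g = pair_integral \<nu> h"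
  unfolding pair_integral_def by (simp add: assms)

lemma pair_integral_add:
  assumes "finite_measure \<nu>" and [measurable_cong]: "sets \<nu> = sets borel"
    and [measurable]: "g \<in> borel_measurable borel" "h \<in> borel_measurable borel"
  shows "pair_integral \<nu> (\<lambda>r. g r + h r) = pair_integral \<nu> g + pair_integral \<nu> h"
  by (simp add: pair_integral_eq_pair_measure assms nn_integral_add[symmetric] case_prod_unfold)

lemma pair_integral_cmult:
  assumes "finite_measure \<nu>" and [measurable_cong]: "sets \<nu> = sets borel"
    and [measurable]: "g \<in> borel_measurable borel"
  shows "pair_integral \<nu> (\<lambda>r. c * g r) = c * pair_integral \<nu> g"
  by (simp add: pair_integral_eq_pair_measure assms nn_integral_cmult[symmetric] case_prod_unfold)

section \<open>Layer-cake comparison of kernel energies\<close>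

lemma layer_cake:
  fixes c :: ennreal
  shows "c = (\<integral>\<^sup>+ s. indicator {s. 0 \<le> s \<and> ennreal s < c} s \<partial>lborel)"
proof (cases c)
  case (real x)
  then have "{s. 0 \<le> s \<and> ennreal s < c} = {0..<x}"
    by (auto simp: ennreal_less_iff)
  then show ?thesis using real by simp
next
  case top
  then have "{s. 0 \<le> s \<and> ennreal s < c} = {0..}"
    by auto
  moreover have "emeasure lborel {0::real..} = \<infinity>"
  proof (rule ccontr)
    assume "emeasure lborel {0::real..} \<noteq> \<infinity>"
    then obtain x where x: "0 \<le> x" "emeasure lborel {0::real..} = ennreal x"
      by (metis ennreal_cases infinity_ennreal_def)
    have "emeasure lborel {0..x+1} \<le> emeasure lborel {0::real..}"
      by (intro emeasure_mono) auto
    then show False using x by (simp add: ennreal_le_iff)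
  qed
  ultimately show ?thesis using top by simp
qed

text \<open>Only the kernel is sliced. The logarithm is carried along as a weight, so that both
  energies become weighted masses of the same superlevel sets.\<close>

lemma weighted_layer_cake:
  fixes F w :: "'a \<Rightarrow> ennreal"
  assumes "sigma_finite_measure P" and [measurable]: "F \<in> borel_measurable P" "w \<in> borel_measurable P"
  shows "(\<integral>\<^sup>+ x. w x * F x \<partial>P) =
    (\<integral>\<^sup>+ s. (\<integral>\<^sup>+ x. w x * indicator {s. 0 \<le> s \<and> ennreal s < F x} s \<partial>P) \<partial>lborel)"
proof -
  interpret sigma_finite_measure P by fact
  interpret pair_sigma_finite P "lborel :: real measure" ..
  have [measurable]: "(\<lambda>(x, s). indicator {s. 0 \<le> s \<and> ennreal s < F x} s :: ennreal)
      \<in> borel_measurable (P \<Otimes>\<^sub>M lborel)"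
    by (simp add: indicator_def)
  have "(\<integral>\<^sup>+ x. w x * F x \<partial>P) =
      (\<integral>\<^sup>+ x. (\<integral>\<^sup>+ s. w x * indicator {s. 0 \<le> s \<and> ennreal s < F x} s \<partial>lborel) \<partial>P)"
    by (subst nn_integral_cmult) (simp_all add: layer_cake[symmetric])
  also have "\<dots> = (\<integral>\<^sup>+ s. (\<integral>\<^sup>+ x. w x * indicator {s. 0 \<le> s \<and> ennreal s < F x} s \<partial>P) \<partial>lborel)"
    by (rule Fubini'[symmetric]) measurable
  finally show ?thesis .
qed

lemma borel_measurable_antimono_ennreal:
  fixes F :: "real \<Rightarrow> ennreal"
  assumes "antimono F"
  shows "F \<in> borel_measurable borel"
proof (rule borel_measurableI_greater)
  fix s
  have "is_interval {x. s < F x}"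
    unfolding is_interval_1 using antimonoD[OF assms] by (auto intro: less_le_trans)
  then have "{x. s < F x} \<in> sets borel"
    by (rule real_interval_borel_measurable)
  then show "{x \<in> space borel. s < F x} \<in> sets borel"
    by simp
qed

text \<open>A superlevel set of a decreasing function on the half-line is empty, \<open>{0}\<close>,
  an interval with or without its right end point, or everything. The closed cut-off on the left and
  the open one on the right treat both kinds of interval with one hypothesis; \<open>at_0\<close>
  and \<open>all\<close> settle the degenerate levels.\<close>

lemma kernel_compare:
  assumes \<alpha>: "finite_measure \<alpha>" and [measurable_cong]: "sets \<alpha> = sets borel"
    and \<beta>: "finite_measure \<beta>" and [measurable_cong]: "sets \<beta> = sets borel"
    and [measurable]: "w1 \<in> borel_measurable borel" "w2 \<in> borel_measurable borel"
    and le: "\<And>\<rho>. 0 < \<rho> \<Longrightarrow> pair_integral \<alpha> (\<lambda>r. w1 r * indicator {..\<rho>} r)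
               \<le> C * pair_integral \<beta> (\<lambda>r. w2 r * indicator {..<\<rho>} r)"
    and at_0: "pair_integral \<alpha> (\<lambda>r. w1 r * indicator {0} r) = 0"
    and all: "pair_integral \<alpha> w1 \<le> C * pair_integral \<beta> w2"
    and f: "antimono_on {0..} f"
  shows "pair_integral \<alpha> (\<lambda>r. w1 r * f r) \<le> C * pair_integral \<beta> (\<lambda>r. w2 r * f r)"
proof -
  \<comment> \<open>The values of \<open>f\<close> at negative arguments are arbitrary; extension by
    \<open>f 0\<close> gives a monotone, hence Borel, function on the whole line.\<close>
  define F where "F r = f (max 0 r)" for r
  have anti: "antimono F"
    by (rule antimonoI) (auto simp: F_def intro!: monotone_onD[OF f])
  have Fm[measurable]: "F \<in> borel_measurable borel"
    by (rule borel_measurable_antimono_ennreal[OF anti])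
  interpret B: finite_measure \<beta> by fact
  have lc: "pair_integral \<nu> (\<lambda>r. w r * F r) =
      (\<integral>\<^sup>+ s. pair_integral \<nu> (\<lambda>r. w r * indicator {s. 0 \<le> s \<and> ennreal s < F r} s) \<partial>lborel)"
    if \<nu>: "finite_measure \<nu>" and s[measurable_cong]: "sets \<nu> = sets borel"
      and [measurable]: "w \<in> borel_measurable borel" for \<nu> w
  proof -
    interpret N: finite_measure \<nu> by fact
    interpret NN: pair_sigma_finite \<nu> \<nu> ..
    have [measurable]: "(\<lambda>r. indicator {s. 0 \<le> s \<and> ennreal s < F r} s :: ennreal) \<in> borel_measurable
        borel" for s
      by (simp add: indicator_def)
    show ?thesis
      using weighted_layer_cake[of "\<nu> \<Otimes>\<^sub>M \<nu>" "\<lambda>(x,y). F (norm (x - y))" "\<lambda>(x,y). w (norm (x - y))"]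
      by (simp add: pair_integral_eq_pair_measure \<nu> s case_prod_unfold NN.sigma_finite_measure_axioms)
  qed
  have key: "pair_integral \<alpha> (\<lambda>r. w1 r * indicator {s. 0 \<le> s \<and> ennreal s < F r} s)
      \<le> C * pair_integral \<beta> (\<lambda>r. w2 r * indicator {s. 0 \<le> s \<and> ennreal s < F r} s)"
      (is "?L \<le> C * ?R") for s
  proof (cases "0 \<le> s")
    case s: True
    define D where "D = {r. 0 \<le> r \<and> ennreal s < F r}"
    have down: "y \<in> D" if "x \<in> D" "0 \<le> y" "y \<le> x" for x y
      using that antimonoD[OF anti, of y x] by (auto simp: D_def)
    have ind: "indicator {s. 0 \<le> s \<and> ennreal s < F r} s = (indicator D r :: ennreal)" if "0 \<le> r" for r
      using that s by (auto simp: D_def indicator_def)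
    have L: "?L = pair_integral \<alpha> (\<lambda>r. w1 r * indicator D r)"
      and R: "?R = pair_integral \<beta> (\<lambda>r. w2 r * indicator D r)"
      by (auto intro!: pair_integral_cong simp: ind)
    consider "D \<subseteq> {0}" | x where "x \<in> D" "0 < x" "bdd_above D" | "\<not> bdd_above D"
      by (force simp: D_def)
    then show ?thesis
    proof cases
      case 1
      have "?L \<le> pair_integral \<alpha> (\<lambda>r. w1 r * indicator {0} r)"
        unfolding L using 1 by (intro pair_integral_mono mult_left_mono) (auto simp: indicator_def)
      then show ?thesis using at_0 by simp
    next
      case (2 x)
      have pos: "0 < Sup D" using 2 cSup_upper[of x D] by simp
      have up: "D \<subseteq> {..Sup D}" using 2 by (auto intro: cSup_upper)
      have lo: "y \<in> D" if "0 \<le> y" "y < Sup D" for y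
        using that down 2 less_cSupD[of D y] by (metis empty_iff less_imp_le)
      have "?L \<le> pair_integral \<alpha> (\<lambda>r. w1 r * indicator {..Sup D} r)"
        unfolding L using up by (intro pair_integral_mono mult_left_mono) (auto simp: indicator_def)
      also have "\<dots> \<le> C * pair_integral \<beta> (\<lambda>r. w2 r * indicator {..<Sup D} r)"
        by (rule le[OF pos])
      also have "\<dots> \<le> C * ?R"
        unfolding R using lo by (intro pair_integral_mono mult_left_mono) (auto simp: indicator_def)
      finally show ?thesis .
    next
      case 3
      have all_in: "r \<in> D" if "0 \<le> r" for r
      proof -
        obtain x where "x \<in> D" "r \<le> x" using 3 by (meson bdd_above.I linear)
        then show ?thesis using down that by blast
      qed
      have "?L = pair_integral \<alpha> w1" "?R = pair_integral \<beta> w2"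
        unfolding L R using all_in by (auto intro!: pair_integral_cong)
      then show ?thesis using all by simp
    qed
  next
    case False
    then show ?thesis by (simp add: pair_integral_def)
  qed
  have [measurable]: "(\<lambda>s. pair_integral \<beta> (\<lambda>r. w2 r * indicator {s. 0 \<le> s \<and> ennreal s < F r} s))
      \<in> borel_measurable lborel"
    unfolding pair_integral_def indicator_def by measurable
  have "pair_integral \<alpha> (\<lambda>r. w1 r * F r) \<le> C * pair_integral \<beta> (\<lambda>r. w2 r * F r)"
    by (simp add: lc \<alpha> \<beta> assms(2,4) nn_integral_cmult[symmetric] del: indicator_simps)
      (intro nn_integral_mono key)
  then show ?thesis
    by (simp add: F_def pair_integral_def)
qed

text \<open>Cauchy-Schwarz over a partition into \<open>N\<close> pieces: the squared masses sum to
  at least \<open>1 / N\<close>, and two points of one piece are within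
  \<open>\<rho>\<close>.\<close>

lemma pair_integral_ge_inverse_covering_number:
  fixes E :: "nat \<Rightarrow> (real ^ 2) set"
  assumes "prob_space \<nu>" and sets[measurable_cong]: "sets \<nu> = sets borel"
    and E[measurable]: "\<And>i. i < N \<Longrightarrow> E i \<in> sets borel"
    and cover: "emeasure \<nu> (\<Union>i<N. E i) = 1"
    and diam: "\<And>i x y. i < N \<Longrightarrow> x \<in> E i \<Longrightarrow> y \<in> E i \<Longrightarrow> norm (x - y) \<le> \<rho>"
  shows "ennreal (1 / real N) \<le> pair_integral \<nu> (indicator {..\<rho>})"
proof -
  interpret prob_space \<nu> by fact
  define G where "G i = (if i < N then E i else {})" for i
  have Gm: "range G \<subseteq> sets borel"
    using E by (auto simp: G_def)
  \<comment> \<open>Once the pieces are disjoint, so are the products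
    \<open>D i \<times> D i\<close>, and the sum of their indicators is at most one.\<close>
  define D where "D = disjointed G"
  have Dm[measurable]: "D i \<in> sets borel" for i
    using sets.range_disjointed_sets[OF Gm] by (auto simp: D_def)
  have sub: "D i \<subseteq> E i" if "i < N" for i
    using disjointed_subset[of G i] that by (auto simp: D_def G_def)
  have dis: "disjoint_family_on D {..<N}"
    using disjoint_family_disjointed[of G] by (auto simp: D_def disjoint_family_on_def)
  have "(\<Union>i<N. D i) = (\<Union>i<N. E i)"
    using finite_UN_disjointed_eq[of G N] by (simp add: D_def G_def lessThan_atLeast0)
  then have "prob (\<Union>i<N. D i) = 1"
    using cover by (simp add: measure_def)
  then have sum1: "(\<Sum>i<N. prob (D i)) = 1"
    by (subst (asm) finite_measure_finite_Union) (auto simp: dis)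
  have "1 \<le> real N * (\<Sum>i<N. (prob (D i))\<^sup>2)"
    using sum_squared_le_sum_of_squares[of "\<lambda>i. prob (D i)" "{..<N}"]
    unfolding sum1 card_lessThan power_one by (subst mult.commute)
  then have "1 / real N \<le> (\<Sum>i<N. (prob (D i))\<^sup>2)"
    by (cases "N = 0") (auto simp: field_simps)
  then have "ennreal (1 / real N) \<le> ennreal (\<Sum>i<N. (prob (D i))\<^sup>2)"
    by (rule ennreal_leI)
  also have "\<dots> = (\<Sum>i<N. emeasure \<nu> (D i) * emeasure \<nu> (D i))"
    by (subst sum_ennreal[symmetric]) (auto simp: emeasure_eq_measure ennreal_mult power2_eq_square)
  also have "\<dots> = (\<Sum>i<N. \<integral>\<^sup>+x. \<integral>\<^sup>+y. indicator (D i) x * indicator (D i) y \<partial>\<nu> \<partial>\<nu>)"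
    by (simp add: nn_integral_cmult nn_integral_multc)
  also have "\<dots> = (\<integral>\<^sup>+x. \<integral>\<^sup>+y. (\<Sum>i<N. indicator (D i) x * indicator (D i) y) \<partial>\<nu> \<partial>\<nu>)"
    by (subst nn_integral_sum; (subst nn_integral_sum)?; simp)
  also have "\<dots> \<le> (\<integral>\<^sup>+x. \<integral>\<^sup>+y. indicator {..\<rho>} (norm (x - y)) \<partial>\<nu> \<partial>\<nu>)"
  proof (intro nn_integral_mono)
    fix x y :: "real^2"
    show "(\<Sum>i<N. indicator (D i) x * indicator (D i) y) \<le> (indicator {..\<rho>} (norm (x - y)) :: ennreal)"
    proof (cases "\<exists>i<N. x \<in> D i \<and> y \<in> D i")
      case True
      then obtain i where i: "i < N" "x \<in> D i" "y \<in> D i" by auto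
      have "(\<Sum>i<N. indicator (D i) x * indicator (D i) y) = (\<Sum>j<N. if j = i then 1 else (0::ennreal))"
      proof (rule sum.cong)
        fix j assume "j \<in> {..<N}"
        then show "indicator (D j) x * indicator (D j) y = (if j = i then 1 else (0::ennreal))"
          using i dis by (cases "j = i") (auto simp: disjoint_family_on_def indicator_def)
      qed simp
      also have "\<dots> = 1" using i by simp
      also have "1 = indicator {..\<rho>} (norm (x - y))"
        using diam[of i x y] i sub[of i] by (auto simp: indicator_def)
      finally show ?thesis by simp
    next
      case False
      then show ?thesis
        by (subst sum.neutral) (auto simp: indicator_def)
    qed
  qed
  finally show ?thesis
    by (simp add: pair_integral_def)
qed

section \<open>Positive and negative parts of the logarithmic kernel\<close>

definition log_pos :: "real \<Rightarrow> ennreal" where "log_pos r = e2ennreal (log_recip r)"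
definition log_neg :: "real \<Rightarrow> ennreal" where "log_neg r = e2ennreal (- log_recip r)"

lemma log_pos_pos: "0 < r \<Longrightarrow> log_pos r = ennreal (ln (1 / r))"
  by (simp add: log_pos_def log_recip_def)
lemma log_pos_0 [simp]: "log_pos 0 = \<infinity>"
  by (simp add: log_pos_def log_recip_def)
lemma log_neg_pos: "0 < r \<Longrightarrow> log_neg r = ennreal (ln r)"
  by (simp add: log_neg_def log_recip_def ln_div)
lemma log_neg_0 [simp]: "log_neg 0 = 0"
  by (simp add: log_neg_def log_recip_def e2ennreal_neg)

lemma log_recip_measurable [measurable]: "log_recip \<in> borel_measurable borel"
  unfolding log_recip_def by measurable
lemma log_pos_measurable [measurable]: "log_pos \<in> borel_measurable borel"
  unfolding log_pos_def by measurable
lemma log_neg_measurable [measurable]: "log_neg \<in> borel_measurable borel"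
  unfolding log_neg_def by measurable

lemma e2ennreal_mult_left: "e2ennreal (enn2ereal a * b) = a * e2ennreal b"
proof (cases "0 \<le> b")
  case True
  then have "enn2ereal (a * e2ennreal b) = enn2ereal a * b"
    by (simp add: times_ennreal.rep_eq enn2ereal_e2ennreal)
  then show ?thesis by (metis e2ennreal_enn2ereal)
next
  case False
  then have "enn2ereal a * b \<le> 0"
    by (simp add: ereal_mult_le_0_iff)
  then show ?thesis using False by (simp add: e2ennreal_neg)
qed

lemma energy_kernel_eq: "energy (\<lambda>r. enn2ereal (f r)) \<nu> = enn2ereal (pair_integral \<nu> f)"
proof -
  have [simp]: "e2ennreal (- enn2ereal a) = 0" for a
    by (simp add: e2ennreal_neg)
  show ?thesis
    by (simp add: energy_def pair_integral_def Let_def zero_ennreal.rep_eq)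
qed

lemma energy_log_kernel_eq:
  "energy (log_kernel f) \<nu> =
    (let P = pair_integral \<nu> (\<lambda>r. log_pos r * f r); N = pair_integral \<nu> (\<lambda>r. log_neg r * f r)
     in if P = \<infinity> then \<infinity> else enn2ereal P - enn2ereal N)"
proof -
  have "e2ennreal (log_kernel f r) = log_pos r * f r" for r
    using e2ennreal_mult_left[of "f r" "log_recip r"]
    by (simp add: log_kernel_def log_pos_def mult.commute)
  moreover have "e2ennreal (- log_kernel f r) = log_neg r * f r" for r
    using e2ennreal_mult_left[of "f r" "- log_recip r"]
    by (simp add: log_kernel_def log_neg_def mult.commute)
  ultimately show ?thesis
    by (simp add: energy_def pair_integral_def)
qed

lemma energy_log_kernel_le: "energy (log_kernel f) \<nu> \<le> enn2ereal (pair_integral \<nu> (\<lambda>r. log_pos r * f r))"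
  by (auto simp: energy_log_kernel_eq Let_def ereal_minus_le_iff top_ennreal.rep_eq
      intro!: add_increasing2)

text \<open>The left side is twice the variance. As \<open>u x * u x \<le> u x\<close>, the
  integrand is at most \<open>u x + u y - 2 * u x * u y\<close>, whose double integral is
  \<open>2 * m * (1 - m)\<close> with \<open>m\<close> the mean.\<close>

lemma square_two_point_variance:
  assumes "prob_space \<nu>" and [measurable]: "u \<in> borel_measurable \<nu>" and u: "\<And>x. 0 \<le> u x \<and> u x \<le> (1::real)"
  shows "(\<integral>\<^sup>+x. \<integral>\<^sup>+y. ennreal ((u x - u y)\<^sup>2) \<partial>\<nu> \<partial>\<nu>) \<le> ennreal (1/2)"
proof -
  interpret prob_space \<nu> by fact
  define m where "m = expectation u"
  have iu: "integrable \<nu> u"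
    using u by (intro integrable_const_bound[where B=1]) auto
  have nonneg: "0 \<le> a + b - 2 * a * b" if "0 \<le> a" "a \<le> 1" "0 \<le> b" "b \<le> 1" for a b :: real
  proof -
    have "a + b - 2 * a * b = a * (1 - b) + b * (1 - a)" by (simp add: algebra_simps)
    also have "\<dots> \<ge> 0" using that by simp
    finally show ?thesis .
  qed
  have m: "0 \<le> m" "m \<le> 1"
    unfolding m_def using u iu by (auto intro!: integral_nonneg_AE integral_le_const)
  have "(\<integral>\<^sup>+x. \<integral>\<^sup>+y. ennreal ((u x - u y)\<^sup>2) \<partial>\<nu> \<partial>\<nu>)
      \<le> (\<integral>\<^sup>+x. \<integral>\<^sup>+y. ennreal (u x + u y - 2 * u x * u y) \<partial>\<nu> \<partial>\<nu>)"
  proof (intro nn_integral_mono ennreal_leI)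
    fix x y
    have "u x * u x \<le> u x * 1" "u y * u y \<le> u y * 1" by (intro mult_left_mono; use u in blast)+
    then show "(u x - u y)\<^sup>2 \<le> u x + u y - 2 * u x * u y"
      by (simp add: power2_eq_square algebra_simps)
  qed
  also have "\<dots> = (\<integral>\<^sup>+x. ennreal (u x + m - 2 * u x * m) \<partial>\<nu>)"
  proof (intro nn_integral_cong)
    fix x
    have "(\<integral>\<^sup>+y. ennreal (u x + u y - 2 * u x * u y) \<partial>\<nu>) = ennreal (expectation (\<lambda>y. u x + u y - 2 * u x
        * u y))"
      using u iu nonneg by (intro nn_integral_eq_integral) auto
    also have "expectation (\<lambda>y. u x + u y - 2 * u x * u y) = u x + m - 2 * u x * m"
      using iu by (simp add: m_def prob_space)
    finally show "(\<integral>\<^sup>+y. ennreal (u x + u y - 2 * u x * u y) \<partial>\<nu>) = ennreal (u x + m - 2 * u x * m)" .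
  qed
  also have "\<dots> = ennreal (expectation (\<lambda>x. u x + m - 2 * u x * m))"
    using u iu m nonneg by (intro nn_integral_eq_integral) auto
  also have "expectation (\<lambda>x. u x + m - 2 * u x * m) = m + m - 2 * m * m"
    using iu by (simp add: m_def prob_space)
  also have "\<dots> \<le> 1/2"
    using sum_squares_ge_zero[of "m - 1/2" 0] by (simp add: power2_eq_square algebra_simps)
  finally show ?thesis by (simp add: ennreal_leI)
qed

section \<open>The logarithmic kernel on the unit square\<close>

lemma norm_real2_eq: "norm (x :: real^2) = sqrt ((x $ 1)\<^sup>2 + (x $ 2)\<^sup>2)"
  by (simp add: norm_vec_def L2_set_def sum_2)

lemma AE_in_set_of_emeasure_1:
  assumes "prob_space \<nu>" "A \<in> sets \<nu>" "emeasure \<nu> A = 1"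
  shows "AE x in \<nu>. x \<in> A"
proof -
  interpret prob_space \<nu> by fact
  show ?thesis
    using assms by (subst prob_eq_1[symmetric]) (auto simp: measure_def)
qed

lemma pair_integral_mono_AE:
  assumes "AE x in \<nu>. x \<in> A" "\<And>x y. x \<in> A \<Longrightarrow> y \<in> A \<Longrightarrow> g (norm (x - y)) \<le> h (norm (x - y))"
  shows "pair_integral \<nu> g \<le> pair_integral \<nu> h"
  unfolding pair_integral_def
proof (rule nn_integral_mono_AE)
  show "AE x in \<nu>. (\<integral>\<^sup>+ y. g (norm (x - y)) \<partial>\<nu>) \<le> (\<integral>\<^sup>+ y. h (norm (x - y)) \<partial>\<nu>)"
    using assms(1)
  proof eventually_elim
    case (elim x)
    show ?case
      by (rule nn_integral_mono_AE) (use assms elim in \<open>auto elim!: eventually_mono\<close>)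
  qed
qed

lemma pair_integral_const: "prob_space \<nu> \<Longrightarrow> pair_integral \<nu> (\<lambda>_. c) = c"
  by (simp add: pair_integral_def prob_space.emeasure_space_1)

text \<open>Each coordinate contributes half of a two-point variance on the unit interval, hence at
  most \<open>1/4\<close>.\<close>

lemma square_pair_integral_norm_square:
  assumes "prob_space \<nu>" and sets[measurable_cong]: "sets \<nu> = sets borel"
    and sq: "emeasure \<nu> (cbox 0 1) = 1"
  shows "pair_integral \<nu> (\<lambda>r. ennreal (r\<^sup>2 / 2)) \<le> ennreal (1/2)"
proof -
  interpret prob_space \<nu> by fact
  \<comment> \<open>Clamping bounds the coordinates everywhere, not just almost everywhere, and
    changes nothing on the square.\<close>
  define u where "u i x = max 0 (min 1 ((x :: real^2) $ i))" for i x
  have u: "0 \<le> u i x \<and> u i x \<le> 1" for i x by (auto simp: u_def)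
  have um[measurable]: "u i \<in> borel_measurable \<nu>" for i
    unfolding u_def by measurable
  have in_sq: "AE x in \<nu>. x \<in> cbox 0 1"
    by (rule AE_in_set_of_emeasure_1) (use assms in auto)
  have eq: "u i x = x $ i" if "x \<in> cbox 0 1" for i x
    using that by (auto simp: u_def mem_box_cart)
  have le: "ennreal ((norm (x - y))\<^sup>2 / 2) \<le> ennreal (1/2) * ennreal ((u 1 x - u 1 y)\<^sup>2) + ennreal (1/2)
      * ennreal ((u 2 x - u 2 y)\<^sup>2)"
    if "x \<in> cbox 0 1" "y \<in> cbox 0 1" for x y
  proof -
    have half: "ennreal ((a + b) / 2) = ennreal (1/2) * ennreal a + ennreal (1/2) * ennreal b"
      if "0 \<le> a" "0 \<le> b" for a b
    proof -
      have "ennreal ((a + b) / 2) = ennreal (1/2 * a + 1/2 * b)" by (simp add: add_divide_distrib)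
      also have "\<dots> = ennreal (1/2 * a) + ennreal (1/2 * b)" using that by (intro ennreal_plus) auto
      also have "\<dots> = ennreal (1/2) * ennreal a + ennreal (1/2) * ennreal b"
        using that by (intro arg_cong2[of _ _ _ _ "(+)"] ennreal_mult) auto
      finally show ?thesis .
    qed
    show ?thesis
      using that by (simp only: norm_real2_eq eq half[symmetric] zero_le_power2) simp
  qed
  have "pair_integral \<nu> (\<lambda>r. ennreal (r\<^sup>2 / 2)) \<le>
     (\<integral>\<^sup>+x. \<integral>\<^sup>+y. ennreal (1/2) * ennreal ((u 1 x - u 1 y)\<^sup>2) + ennreal (1/2) * ennreal
         ((u 2 x - u 2 y)\<^sup>2) \<partial>\<nu> \<partial>\<nu>)"
    unfolding pair_integral_def
  proof (rule nn_integral_mono_AE)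
    show "AE x in \<nu>. (\<integral>\<^sup>+y. ennreal ((norm (x - y))\<^sup>2 / 2) \<partial>\<nu>) \<le> (\<integral>\<^sup>+y. ennreal (1/2) * ennreal
        ((u 1 x - u 1 y)\<^sup>2) + ennreal (1/2) * ennreal ((u 2 x - u 2 y)\<^sup>2) \<partial>\<nu>)"
      using in_sq
    proof eventually_elim
      case (elim x)
      show ?case
        by (rule nn_integral_mono_AE) (use in_sq le elim in \<open>auto elim!: eventually_mono\<close>)
    qed
  qed
  also have "\<dots> = ennreal (1/2) * (\<integral>\<^sup>+x. \<integral>\<^sup>+y. ennreal ((u 1 x - u 1 y)\<^sup>2) \<partial>\<nu> \<partial>\<nu>)
      + ennreal (1/2) * (\<integral>\<^sup>+x. \<integral>\<^sup>+y. ennreal ((u 2 x - u 2 y)\<^sup>2) \<partial>\<nu> \<partial>\<nu>)"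
    by (simp add: nn_integral_add nn_integral_cmult)
  also have "\<dots> \<le> ennreal (1/2) * ennreal (1/2) + ennreal (1/2) * ennreal (1/2)"
    by (intro add_mono mult_left_mono square_two_point_variance u um prob_space_axioms) auto
  also have "ennreal (1/2) * ennreal (1/2) = ennreal (1/4)"
    by (subst ennreal_mult[symmetric]) auto
  also have "ennreal (1/4) + ennreal (1/4) = ennreal (1/2)"
    by (subst ennreal_plus[symmetric]) auto
  finally show ?thesis .
qed

lemma square_close_pairs:
  assumes "prob_space \<nu>" and sets[measurable_cong]: "sets \<nu> = sets borel"
    and sq: "emeasure \<nu> (cbox 0 1) = 1" and n: "0 < n"
  shows "ennreal (1 / (real n)\<^sup>2) \<le> pair_integral \<nu> (indicator {..sqrt 2 / real n})"
proof -
  interpret prob_space \<nu> by fact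
  define E :: "nat \<Rightarrow> (real^2) set" where
    "E i = cbox (vector [real (i div n) / n, real (i mod n) / n])
                (vector [real (i div n + 1) / n, real (i mod n + 1) / n])" for i
  have cover: "cbox 0 1 \<subseteq> (\<Union>i<n*n. E i)"
  proof
    fix x :: "real^2" assume "x \<in> cbox 0 1"
    then have x: "0 \<le> x $ i" "x $ i \<le> 1" for i by (auto simp: mem_box_cart)
    have "\<exists>a<n. real a / n \<le> t \<and> t \<le> real (a + 1) / n" if t: "0 \<le> t" "t \<le> 1" for t :: real
    proof (cases "t = 1")
      \<comment> \<open>At the right end the floor would be \<open>n\<close>; the last closed cell
        serves instead.\<close>
      case True
      then show ?thesis using n by (intro exI[of _ "n - 1"]) (auto simp: field_simps of_nat_diff)
    next
      case False
      define a where "a = nat \<lfloor>t * n\<rfloor>"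
      have a: "real a \<le> t * n" "t * n < real a + 1"
        using t by (auto simp: a_def)
      have "t * n < 1 * real n" using t False n by (intro mult_strict_right_mono) auto
      then have "a < n" using a by linarith
      then show ?thesis using a n by (intro exI[of _ a]) (auto simp: field_simps)
    qed
    then obtain a b where ab: "a < n" "real a / n \<le> x $ 1" "x $ 1 \<le> real (a + 1) / n"
       "b < n" "real b / n \<le> x $ 2" "x $ 2 \<le> real (b + 1) / n"
      using x by meson
    have "a * n + b < n * n"
    proof -
      have "a * n + b < a * n + n" using ab by simp
      also have "\<dots> = Suc a * n" by simp
      also have "\<dots> \<le> n * n" using ab by (intro mult_right_mono) auto
      finally show ?thesis .
    qed
    moreover have "x \<in> E (a * n + b)"
      using ab by (auto simp: E_def mem_box_cart forall_2)
    ultimately show "x \<in> (\<Union>i<n*n. E i)" by blast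
  qed
  have diam: "norm (x - y) \<le> sqrt 2 / real n" if "x \<in> E i" "y \<in> E i" for i x y
  proof -
    have *: "\<bar>x $ 1 - y $ 1\<bar> \<le> 1 / n" "\<bar>x $ 2 - y $ 2\<bar> \<le> 1 / n"
      using that n by (auto simp: E_def mem_box_cart forall_2 abs_le_iff add_divide_distrib)
    have "(x $ 1 - y $ 1)\<^sup>2 \<le> (1 / n)\<^sup>2" "(x $ 2 - y $ 2)\<^sup>2 \<le> (1 / n)\<^sup>2"
      using * by (auto simp: abs_le_square_iff[symmetric])
    then have "norm (x - y) \<le> sqrt (2 * (1 / n)\<^sup>2)"
      unfolding norm_real2_eq by (intro real_sqrt_le_mono) auto
    also have "\<dots> = sqrt 2 / n" by (simp add: real_sqrt_mult real_sqrt_divide)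
    finally show ?thesis .
  qed
  have "emeasure \<nu> (\<Union>i<n*n. E i) = 1"
  proof (rule antisym)
    show "emeasure \<nu> (\<Union>i<n*n. E i) \<le> 1" by (rule emeasure_le_1)
    have "emeasure \<nu> (cbox 0 1) \<le> emeasure \<nu> (\<Union>i<n*n. E i)"
      by (rule emeasure_mono[OF cover]) (auto simp: sets E_def)
    then show "1 \<le> emeasure \<nu> (\<Union>i<n*n. E i)" using sq by simp
  qed
  then have "ennreal (1 / real (n * n)) \<le> pair_integral \<nu> (indicator {..sqrt 2 / real n})"
    by (intro pair_integral_ge_inverse_covering_number[of _ _ E] prob_space_axioms sets diam)
       (auto simp: E_def)
  then show ?thesis by (simp add: power2_eq_square)
qed

lemma ennreal_add3:
  "0 \<le> a \<Longrightarrow> 0 \<le> b \<Longrightarrow> 0 \<le> c \<Longrightarrow> ennreal a + ennreal b + ennreal c = ennreal (a + b + c)"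
  by (metis add_nonneg_nonneg ennreal_plus)

text \<open>This is \<open>ln (r\<^sup>2) \<le> r\<^sup>2 - 1\<close>, halved. For
  \<open>r \<le> 1/4\<close> the logarithm is at most \<open>-1\<close>, which leaves room for the
  extra half. Terms stand on the side where they are added, since subtraction of extended values
  would be unsafe after integration.\<close>

lemma log_pos_log_neg_bound:
  assumes "0 \<le> r"
  shows "log_neg r + ennreal (1/2) + ennreal (1/2) * indicator {..1/4} r \<le> log_pos r + ennreal (r\<^sup>2 / 2)"
proof (cases "r = 0")
  case False
  then have r: "0 < r" using assms by simp
  have 1: "ln r \<le> (r\<^sup>2 - 1) / 2"
    using ln_le_minus_one[of "r\<^sup>2"] r by (simp add: ln_powr power2_eq_square ln_mult)
  have ln4: "1 \<le> ln (4::real)"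
    using exp_le by (subst ln_ge_iff) auto
  have 2: "ln r \<le> -1" if "r \<le> 1/4"
  proof -
    have "ln r \<le> ln (1/4)" using that r by simp
    also have "\<dots> \<le> -1" using ln4 by (simp add: ln_div)
    finally show ?thesis .
  qed
  have "log_neg r = ennreal (max 0 (ln r))" "log_pos r = ennreal (max 0 (- ln r))"
    using r by (auto simp: log_neg_pos log_pos_pos ln_div max_def ennreal_neg)
  moreover have "ennreal (1/2) * indicator {..1/4} r = ennreal (if r \<le> 1/4 then 1/2 else 0)"
    by auto
  moreover have "max 0 (ln r) + 1/2 + (if r \<le> 1/4 then 1/2 else 0) \<le> max 0 (- ln r) + r\<^sup>2 / 2"
  proof -
    have *: "max 0 l + 1/2 + (if b then 1/2 else 0) \<le> max 0 (- l) + q / 2"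
      if "l \<le> (q - 1) / 2" "b \<Longrightarrow> l \<le> -1" "0 \<le> q" for l q :: real and b
      using that by (cases b; cases "l \<le> 0") simp_all
    show ?thesis by (rule *) (use 1 2 in auto)
  qed
  moreover have "ennreal (max 0 (- ln r)) + ennreal (r\<^sup>2 / 2) = ennreal (max 0 (- ln r) + r\<^sup>2 / 2)"
    by (rule ennreal_plus[symmetric]) auto
  ultimately show ?thesis
    by (simp only: ennreal_add3[of "max 0 (ln r)" "1/2" "if r \<le> 1/4 then 1/2 else 0"] ennreal_leI)
       (subst ennreal_add3; auto intro: ennreal_leI simp del: ennreal_plus)
qed simp

text \<open>Jensen's inequality and the variance bound only give that the logarithmic energy is
  nonnegative; the mass of the pairs at distance at most \<open>1/4\<close> makes it strictly positive.\<close>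

lemma square_log_neg_le:
  assumes "prob_space \<nu>" and sets[measurable_cong]: "sets \<nu> = sets borel"
    and sq: "emeasure \<nu> (cbox 0 1) = 1"
  shows "pair_integral \<nu> log_neg \<le> ennreal (72/73) * pair_integral \<nu> log_pos"
proof -
  interpret prob_space \<nu> by fact
  note fin = finite_measure_axioms
  let ?a = "pair_integral \<nu> log_pos" and ?b = "pair_integral \<nu> log_neg"
  have b1: "?b \<le> 1"
  proof -
    have "?b \<le> pair_integral \<nu> (\<lambda>_. 1)"
    proof (rule pair_integral_mono_AE[where A = "cbox 0 1"])
      show "AE x in \<nu>. x \<in> cbox 0 1"
        by (rule AE_in_set_of_emeasure_1) (use assms in auto)
      fix x y :: "real^2" assume xy: "x \<in> cbox 0 1" "y \<in> cbox 0 1"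
      then have *: "\<bar>x $ 1 - y $ 1\<bar> \<le> 1" "\<bar>x $ 2 - y $ 2\<bar> \<le> 1"
        by (auto simp: mem_box_cart forall_2 abs_le_iff)
      have "(x $ 1 - y $ 1)\<^sup>2 \<le> 1\<^sup>2" "(x $ 2 - y $ 2)\<^sup>2 \<le> 1\<^sup>2"
        using * by (auto simp: abs_square_le_1)
      then have "norm (x - y) \<le> sqrt 4"
        unfolding norm_real2_eq by (intro real_sqrt_le_mono) auto
      then have "norm (x - y) \<le> 2" by simp
      then show "log_neg (norm (x - y)) \<le> 1"
        using ln_le_minus_one[of "norm (x - y)"]
        by (cases "x = y") (auto simp: log_neg_pos)
    qed
    then show ?thesis by (simp add: pair_integral_const prob_space_axioms)
  qed
  \<comment> \<open>Six cells per side is the coarsest grid whose cells have diameter at most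
    \<open>1/4\<close>.\<close>
  have "ennreal (1/36) \<le> pair_integral \<nu> (indicator {..sqrt 2 / 6})"
    using square_close_pairs[OF prob_space_axioms sets sq, of 6] by simp
  also have "\<dots> \<le> pair_integral \<nu> (indicator {..1/4})"
  proof (intro pair_integral_mono)
    have "sqrt 2 \<le> sqrt ((3/2)\<^sup>2)" by (intro real_sqrt_le_mono) (simp add: power2_eq_square)
    then have "sqrt 2 \<le> 3/2" by simp
    then show "indicator {..sqrt 2 / 6} r \<le> (indicator {..1/4} r :: ennreal)" for r
      by (auto simp: indicator_def)
  qed
  finally have i: "ennreal (1/36) \<le> pair_integral \<nu> (indicator {..1/4})" .
  have "?b + ennreal (1/2) + ennreal (1/2) * ennreal (1/36) \<le>
     pair_integral \<nu> (\<lambda>r. log_neg r + ennreal (1/2) + ennreal (1/2) * indicator {..1/4} r)"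
    using i by (auto simp: pair_integral_add pair_integral_cmult fin sets pair_integral_const
        prob_space_axioms
       intro!: add_left_mono mult_left_mono)
  also have "\<dots> \<le> pair_integral \<nu> (\<lambda>r. log_pos r + ennreal (r\<^sup>2 / 2))"
    by (intro pair_integral_mono log_pos_log_neg_bound)
  also have "\<dots> = ?a + pair_integral \<nu> (\<lambda>r. ennreal (r\<^sup>2 / 2))"
    by (simp add: pair_integral_add fin sets)
  also have "\<dots> \<le> ?a + ennreal (1/2)"
    by (intro add_left_mono square_pair_integral_norm_square assms)
  finally have main: "?b + ennreal (1/2) + ennreal (1/2) * ennreal (1/36) \<le> ?a + ennreal (1/2)" .
  obtain b where b: "0 \<le> b" "?b = ennreal b"
    using b1 by (metis ennreal_cases ennreal_one_less_top less_le_not_le)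
  have b_le: "b \<le> 1" using b1 b by simp
  show ?thesis
  proof (cases ?a)
    case (real a)
    have "ennreal (1/2) * ennreal (1/36) = ennreal (1/72)"
      by (subst ennreal_mult[symmetric]) auto
    then have "ennreal (b + 1/2 + 1/72) \<le> ennreal (a + 1/2)"
      using main real b by (simp only: ennreal_add3[symmetric] ennreal_plus)
    then have "b + 1/2 + 1/72 \<le> a + 1/2"
      using real(1) by (subst (asm) ennreal_le_iff) auto
    \<comment> \<open>From \<open>a \<ge> b + 1/72\<close> and \<open>b \<le> 1\<close> follows
      \<open>a \<ge> 73/72 * b\<close>.\<close>
    then have "b \<le> 72/73 * a" using b_le by simp
    then show ?thesis using real b by (simp add: ennreal_mult[symmetric])
  next
    case top
    then show ?thesis by (simp add: ennreal_mult_top)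
  qed
qed

text \<open>By monotonicity \<open>f\<close> is at most \<open>f 1\<close> where the logarithm is
  negative and at least \<open>f 1\<close> where it is positive. So both parts compare with the pure
  logarithm times \<open>f 1\<close>, the negative part is at most \<open>72/73\<close> of the
  positive one, and \<open>1/73\<close> remains.\<close>

lemma energy_log_kernel_ge:
  assumes "prob_space \<nu>" and sets[measurable_cong]: "sets \<nu> = sets borel"
    and sq: "emeasure \<nu> (cbox 0 1) = 1" and f: "antimono_on {0..} f"
  shows "enn2ereal (ennreal (1/73) * pair_integral \<nu> (\<lambda>r. log_pos r * f r)) \<le> energy (log_kernel f) \<nu>"
proof -
  interpret prob_space \<nu> by fact
  note fin = finite_measure_axioms
  let ?P = "pair_integral \<nu> (\<lambda>r. log_pos r * f r)" and ?N = "pair_integral \<nu> (\<lambda>r. log_neg r * f r)"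
  have "?N \<le> pair_integral \<nu> (\<lambda>r. f 1 * log_neg r)"
  proof (rule pair_integral_mono)
    fix r :: real assume r: "0 \<le> r"
    show "log_neg r * f r \<le> f 1 * log_neg r"
    proof (cases "r \<le> 1")
      case True
      then have "log_neg r = 0" using r by (cases "r = 0") (auto simp: log_neg_pos ennreal_neg)
      then show ?thesis by simp
    next
      case False
      then have "f r \<le> f 1" using monotone_onD[OF f, of 1 r] by auto
      then show ?thesis by (simp add: mult.commute mult_left_mono)
    qed
  qed
  also have "\<dots> = f 1 * pair_integral \<nu> log_neg"
    by (simp add: pair_integral_cmult fin sets)
  also have "\<dots> \<le> f 1 * (ennreal (72/73) * pair_integral \<nu> log_pos)"
    by (intro mult_left_mono square_log_neg_le assms) auto
  also have "\<dots> = ennreal (72/73) * pair_integral \<nu> (\<lambda>r. f 1 * log_pos r)"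
    using pair_integral_cmult[OF fin sets, of log_pos "f 1"] by (simp add: mult_ac)
  also have "\<dots> \<le> ennreal (72/73) * ?P"
  proof (intro mult_left_mono pair_integral_mono)
    fix r :: real assume r: "0 \<le> r"
    show "f 1 * log_pos r \<le> log_pos r * f r"
    proof (cases "r \<ge> 1")
      case True
      then have "log_pos r = 0" by (auto simp: log_pos_pos ennreal_neg ln_div)
      then show ?thesis by simp
    next
      case False
      then have "f 1 \<le> f r" using monotone_onD[OF f, of r 1] r by auto
      then show ?thesis by (simp add: mult.commute mult_left_mono)
    qed
  qed auto
  finally have NP: "?N \<le> ennreal (72/73) * ?P" .
  show ?thesis
  proof (cases ?P)
    case (real p)
    obtain n where n: "0 \<le> n" "?N = ennreal n"
      using NP real by (cases ?N) (auto simp: ennreal_mult[symmetric] top_unique)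
    have "n \<le> 72/73 * p" using NP real n by (simp add: ennreal_mult[symmetric])
    then show ?thesis
      using real n by (auto simp: energy_log_kernel_eq ennreal_mult[symmetric] enn2ereal_ennreal)
  next
    case top
    then show ?thesis by (simp add: energy_log_kernel_eq)
  qed
qed

lemma rho_square_log_le: "0 < \<rho> \<Longrightarrow> \<rho>\<^sup>2 * ln (1 / \<rho>) \<le> (\<rho> :: real)"
  using ln_le_minus_one[of "1 / \<rho>"] mult_left_mono[of "ln (1/\<rho>)" "1/\<rho>" "\<rho>\<^sup>2"]
  by (simp add: power2_eq_square)

lemma square_log_pos_ge:
  assumes "prob_space \<nu>" and sets[measurable_cong]: "sets \<nu> = sets borel"
    and sq: "emeasure \<nu> (cbox 0 1) = 1" and \<rho>: "0 < \<rho>" "\<rho> \<le> 1"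
  shows "ennreal (\<rho>\<^sup>2 * ln (1 / \<rho>) / 16) \<le> pair_integral \<nu> (\<lambda>r. log_pos r * indicator {..<\<rho>} r)"
proof -
  interpret prob_space \<nu> by fact
  note fin = finite_measure_axioms
  \<comment> \<open>Rounding \<open>2 / \<rho>\<close> up makes the cell diameter strictly less than
    \<open>\<rho>\<close>, as the open cut-off demands; \<open>n \<le> 4 / \<rho>\<close> then costs
    the factor \<open>16\<close>.\<close>
  define n where "n = nat \<lceil>2 / \<rho>\<rceil>"
  have n: "2 / \<rho> \<le> real n" "real n < 2 / \<rho> + 1"
    using \<rho> unfolding n_def by (auto simp: of_nat_nat ceiling_less_iff) linarith+
  have "0 < 2 / \<rho>" using \<rho> by simp
  then have npos: "0 < real n" using n by linarith
  have "2 / \<rho> + 1 \<le> 4 / \<rho>" using \<rho> by (simp add: field_simps)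
  then have n4: "real n \<le> 4 / \<rho>" using n by linarith
  have small: "sqrt 2 / real n < \<rho>"
  proof -
    have "sqrt 2 < 2" by (simp add: real_sqrt_less_iff[of 2 4, simplified])
    also have "2 \<le> \<rho> * real n" using n \<rho> by (simp add: field_simps)
    finally show ?thesis using npos by (simp add: field_simps)
  qed
  have "(real n)\<^sup>2 \<le> (4 / \<rho>)\<^sup>2" using n4 by (intro power_mono) auto
  then have "\<rho>\<^sup>2 / 16 \<le> 1 / (real n)\<^sup>2"
    using \<rho> npos by (simp add: field_simps power_divide)
  then have "ennreal (\<rho>\<^sup>2 / 16) \<le> ennreal (1 / (real n)\<^sup>2)" by (rule ennreal_leI)
  also have "\<dots> \<le> pair_integral \<nu> (indicator {..sqrt 2 / real n})"
    using npos by (intro square_close_pairs prob_space_axioms sets sq) auto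
  also have "\<dots> \<le> pair_integral \<nu> (indicator {..<\<rho>})"
    using small by (intro pair_integral_mono) (auto simp: indicator_def)
  finally have "ennreal (ln (1 / \<rho>)) * ennreal (\<rho>\<^sup>2 / 16) \<le> ennreal (ln (1 / \<rho>)) * pair_integral \<nu>
      (indicator {..<\<rho>})"
    by (intro mult_left_mono) auto
  also have "\<dots> = pair_integral \<nu> (\<lambda>r. ennreal (ln (1 / \<rho>)) * indicator {..<\<rho>} r)"
    by (simp add: pair_integral_cmult fin sets)
  also have "\<dots> \<le> pair_integral \<nu> (\<lambda>r. log_pos r * indicator {..<\<rho>} r)"
  proof (intro pair_integral_mono )
    fix r :: real assume "0 \<le> r"
    show "ennreal (ln (1 / \<rho>)) * indicator {..<\<rho>} r \<le> log_pos r * indicator {..<\<rho>} r"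
      using \<open>0 \<le> r\<close> \<rho> by (cases "r = 0") (auto simp: indicator_def log_pos_pos frac_le intro!: ennreal_leI)
  qed
  finally show ?thesis
    using \<rho> by (subst (asm) ennreal_mult[symmetric]) (auto simp: mult_ac)
qed

section \<open>The uniform measure on the square\<close>

definition square_measure :: "(real ^ 2) measure" where
  "square_measure = uniform_measure lborel (cbox 0 1)"

lemma emeasure_unit_square: "emeasure lborel (cbox 0 (1 :: real^2)) = 1"
proof -
  have "(0::real^2) \<bullet> b \<le> 1 \<bullet> b" if "b \<in> Basis" for b
    using that by (auto simp: Basis_vec_def inner_axis)
  moreover have "(\<Prod>b\<in>Basis. (1 :: real^2) \<bullet> b) = 1"
    by (rule prod.neutral) (auto simp: Basis_vec_def inner_axis)
  ultimately show ?thesis by (simp add: emeasure_lborel_cbox)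
qed

lemma square_measure:
  "prob_space square_measure" "sets square_measure = sets borel" "emeasure square_measure (cbox 0 1) = 1"
  by (auto simp: square_measure_def emeasure_unit_square intro!: prob_space_uniform_measure)

lemma emeasure_cball_real2: "0 \<le> r \<Longrightarrow> emeasure lborel (cball (x :: real^2) r) = ennreal (pi * r\<^sup>2)"
  by (simp add: emeasure_cball unit_ball_vol_2)

lemma square_measure_close:
  assumes "0 \<le> \<rho>"
  shows "pair_integral square_measure (indicator {..\<rho>}) \<le> ennreal (pi * \<rho>\<^sup>2)"
proof -
  interpret prob_space square_measure by (rule square_measure)
  have "(\<integral>\<^sup>+y. indicator {..\<rho>} (norm (x - y)) \<partial>square_measure) \<le> ennreal (pi * \<rho>\<^sup>2)" for x
  proof -
    have "(\<integral>\<^sup>+y. indicator {..\<rho>} (norm (x - y)) \<partial>square_measure) = emeasure square_measure (cball x \<rho>)"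
    proof -
      have "(\<integral>\<^sup>+y. indicator {..\<rho>} (norm (x - y)) \<partial>square_measure)
          = (\<integral>\<^sup>+y. indicator (cball x \<rho>) y \<partial>square_measure)"
        by (intro nn_integral_cong) (simp add: indicator_def dist_norm)
      then show ?thesis by (simp add: square_measure)
    qed
    also have "\<dots> \<le> emeasure lborel (cball x \<rho>)"
    proof -
      have "emeasure square_measure (cball x \<rho>) = emeasure lborel (cbox 0 1 \<inter> cball x \<rho>)"
        by (simp add: square_measure_def emeasure_unit_square divide_ennreal_def)
      also have "\<dots> \<le> emeasure lborel (cball x \<rho>)" by (intro emeasure_mono) auto
      finally show ?thesis .
    qed
    also have "\<dots> = ennreal (pi * \<rho>\<^sup>2)" using assms by (rule emeasure_cball_real2)
    finally show ?thesis .
  qed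
  then have "pair_integral square_measure (indicator {..\<rho>}) \<le> (\<integral>\<^sup>+x. ennreal (pi * \<rho>\<^sup>2) \<partial>square_measure)"
    unfolding pair_integral_def by (intro nn_integral_mono) auto
  then show ?thesis by (simp add: emeasure_space_1)
qed

text \<open>Split \<open>ln (1 / r)\<close> into \<open>ln (1 / \<rho>)\<close> and
  \<open>ln (\<rho> / r)\<close>; the latter is at most \<open>ln 2\<close> times the number of
  radii \<open>\<rho> / 2^i\<close> that are not below \<open>r\<close>. The singular weight becomes
  a series of indicators, to which the area of discs applies.\<close>

lemma log_pos_le_dyadic_sum:
  assumes "0 \<le> r" "0 < \<rho>" "\<rho> \<le> 1"
  shows "log_pos r * indicator {..\<rho>} r \<le>
    ennreal (ln (1 / \<rho>)) * indicator {..\<rho>} r + (\<Sum>i. ennreal (ln 2) * indicator {..\<rho> * (1/2) ^ i} r)"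
proof (cases "r \<le> \<rho>")
  case r: True
  show ?thesis
  proof (cases "r = 0")
    case True
    \<comment> \<open>At \<open>r = 0\<close> every radius counts, so the series diverges as the
      left side does.\<close>
    have "(\<Sum>i. ennreal (ln 2)) = \<infinity>"
      by (subst nn_integral_count_space_nat[symmetric]) (simp add: ennreal_mult_top)
    moreover have "indicator {..\<rho> * (1/2) ^ i} r = (1::ennreal)" for i
      using True assms by simp
    ultimately show ?thesis by (simp only: mult_1_right) simp
  next
    case False
    then have rpos: "0 < r" using assms by simp
    define N where "N = nat \<lceil>ln (\<rho> / r) / ln 2\<rceil>"
    have q: "0 \<le> ln (\<rho> / r)" using r rpos by simp
    have N: "ln (\<rho> / r) / ln 2 \<le> real N" by (auto simp: N_def real_nat_ceiling_ge)
    have "ennreal (ln (\<rho> / r)) \<le> (\<Sum>i<N. ennreal (ln 2) * indicator {..\<rho> * (1/2) ^ i} r)"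
    proof -
      have "indicator {..\<rho> * (1/2) ^ i} r = (1 :: ennreal)" if "i < N" for i
      proof -
        have "real i < ln (\<rho> / r) / ln 2" using that unfolding N_def by linarith
        then have "real i * ln 2 < ln (\<rho> / r)" by (simp add: field_simps)
        then have "exp (real i * ln 2) \<le> exp (ln (\<rho> / r))" by simp
        then have "2 ^ i \<le> \<rho> / r" using rpos assms by (simp add: exp_of_nat_mult)
        then have "r \<le> \<rho> * (1/2) ^ i" using rpos by (simp add: field_simps)
        then show ?thesis by simp
      qed
      then have "(\<Sum>i<N. ennreal (ln 2) * indicator {..\<rho> * (1/2) ^ i} r) = ennreal (real N * ln 2)"
        by (simp add: ennreal_mult ennreal_of_nat_eq_real_of_nat)
      moreover have "ln (\<rho> / r) \<le> real N * ln 2" using N by (simp add: field_simps)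
      ultimately show ?thesis by (simp add: ennreal_leI)
    qed
    also have "\<dots> \<le> (\<Sum>i. ennreal (ln 2) * indicator {..\<rho> * (1/2) ^ i} r)"
      by (rule sum_le_suminf) auto
    finally have *: "ennreal (ln (\<rho> / r)) \<le> (\<Sum>i. ennreal (ln 2) * indicator {..\<rho> * (1/2) ^ i} r)" .
    have "log_pos r = ennreal (ln (1 / \<rho>) + ln (\<rho> / r))"
      using rpos assms by (simp add: log_pos_pos ln_div)
    also have "\<dots> = ennreal (ln (1 / \<rho>)) + ennreal (ln (\<rho> / r))"
      using q assms by (intro ennreal_plus) auto
    also have "\<dots> \<le> ennreal (ln (1 / \<rho>)) + (\<Sum>i. ennreal (ln 2) * indicator {..\<rho> * (1/2) ^ i} r)"
      by (intro add_left_mono *)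
    finally show ?thesis using r by simp
  qed
qed simp

text \<open>In the dyadic series the disc areas fall by a factor four, so the singularity adds only
  \<open>ln 2 * (4/3)\<close>, less than \<open>2\<close>, times
  \<open>pi * \<rho>\<^sup>2\<close>.\<close>

lemma square_measure_log_pos_le:
  assumes \<rho>: "0 < \<rho>" "\<rho> \<le> 1"
  shows "pair_integral square_measure (\<lambda>r. log_pos r * indicator {..\<rho>} r)
    \<le> ennreal (pi * \<rho>\<^sup>2 * (ln (1 / \<rho>) + 2))"
proof -
  interpret prob_space square_measure by (rule square_measure)
  note fin = finite_measure_axioms
  note sets = square_measure(2)
  note [measurable_cong] = sets
  have "pair_integral square_measure (\<lambda>r. log_pos r * indicator {..\<rho>} r) \<le>
    pair_integral square_measure (\<lambda>r. ennreal (ln (1 / \<rho>)) * indicator {..\<rho>} r + (\<Sum>i. ennreal (ln 2)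
        * indicator {..\<rho> * (1/2) ^ i} r))"
    by (intro pair_integral_mono log_pos_le_dyadic_sum \<rho>)
  also have "\<dots> = ennreal (ln (1 / \<rho>)) * pair_integral square_measure (indicator {..\<rho>}) +
      pair_integral square_measure (\<lambda>r. (\<Sum>i. ennreal (ln 2) * indicator {..\<rho> * (1/2) ^ i} r))"
    by (simp add: pair_integral_add pair_integral_cmult fin sets)
  also have "pair_integral square_measure (\<lambda>r. (\<Sum>i. ennreal (ln 2) * indicator {..\<rho> * (1/2) ^ i} r))
     = (\<Sum>i. pair_integral square_measure (\<lambda>r. ennreal (ln 2) * indicator {..\<rho> * (1/2) ^ i} r))"
    unfolding pair_integral_def by (subst nn_integral_suminf[symmetric];
        (subst nn_integral_suminf[symmetric])?; simp)
  also have "\<dots> = (\<Sum>i. ennreal (ln 2) * pair_integral square_measure (indicator {..\<rho> * (1/2) ^ i}))"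
    by (simp add: pair_integral_cmult fin sets)
  also have "ennreal (ln (1 / \<rho>)) * pair_integral square_measure (indicator {..\<rho>}) + \<dots>
     \<le> ennreal (ln (1 / \<rho>)) * ennreal (pi * \<rho>\<^sup>2) + (\<Sum>i. ennreal (ln 2) * ennreal (pi * (\<rho> * (1/2) ^ i)\<^sup>2))"
    using \<rho> by (intro add_mono mult_left_mono suminf_le square_measure_close) auto
  also have "(\<Sum>i. ennreal (ln 2) * ennreal (pi * (\<rho> * (1/2) ^ i)\<^sup>2)) \<le> ennreal (pi * \<rho>\<^sup>2 * 2)"
  proof -
    have "(\<lambda>i. (1/4::real) ^ i) sums (1 / (1 - 1/4))" by (rule geometric_sums) simp
    then have s: "(\<lambda>i. (ln 2 * pi * \<rho>\<^sup>2) * (1/4) ^ i) sums ((ln 2 * pi * \<rho>\<^sup>2) * (4/3))"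
      by (intro sums_mult) simp
    have eq: "ennreal (ln 2) * ennreal (pi * (\<rho> * (1/2) ^ i)\<^sup>2) = ennreal ((ln 2 * pi * \<rho>\<^sup>2) *
        (1/4) ^ i)" for i
    proof -
      have "((1/2) ^ i)\<^sup>2 = (1/4::real) ^ i" by (simp add: power2_eq_square power_mult_distrib[symmetric])
      then show ?thesis by (subst ennreal_mult[symmetric]) (auto simp: power_mult_distrib mult_ac)
    qed
    have "(\<Sum>i. ennreal (ln 2) * ennreal (pi * (\<rho> * (1/2) ^ i)\<^sup>2)) = ennreal ((ln 2 * pi * \<rho>\<^sup>2) * (4/3))"
      unfolding eq using s by (intro suminf_ennreal_eq) auto
    also have "\<dots> \<le> ennreal (pi * \<rho>\<^sup>2 * 2)"
    proof (intro ennreal_leI)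
      have "ln 2 \<le> (1::real)" using ln_le_minus_one[of "2::real"] by simp
      then have "ln 2 * (pi * \<rho>\<^sup>2) \<le> 1 * (pi * \<rho>\<^sup>2)" by (intro mult_right_mono) auto
      moreover have "0 \<le> pi * \<rho>\<^sup>2" by simp
      ultimately have "ln 2 * (pi * \<rho>\<^sup>2) * (4/3) \<le> pi * \<rho>\<^sup>2 * 2" by linarith
      then show "ln 2 * pi * \<rho>\<^sup>2 * (4/3) \<le> pi * \<rho>\<^sup>2 * 2" by (simp only: mult.assoc)
    qed
    finally show ?thesis .
  qed
  also have "ennreal (ln (1 / \<rho>)) * ennreal (pi * \<rho>\<^sup>2) + ennreal (pi * \<rho>\<^sup>2 * 2)
      = ennreal (pi * \<rho>\<^sup>2 * (ln (1 / \<rho>) + 2))"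
    using \<rho> by (subst ennreal_mult[symmetric]; (subst ennreal_plus[symmetric])?; auto simp: algebra_simps)
  finally show ?thesis by (simp add: add_left_mono)
qed

section \<open>Comparison of capacities\<close>

text \<open>Control at small scales suffices. The first summand of the constant serves
  \<open>\<rho> \<le> \<rho>0\<close>; beyond \<open>\<rho>0\<close> the total mass \<open>D\<close>
  is compared with the mass that \<open>\<beta>\<close> already has below \<open>\<rho>0\<close>.
  The diagonal carries no mass because \<open>\<rho>\<^sup>2 * ln (1 / \<rho>) \<le> \<rho>\<close>
  tends to zero.\<close>

lemma kernel_compare_near_0:
  assumes "finite_measure \<alpha>" "sets \<alpha> = sets borel" "finite_measure \<beta>" "sets \<beta> = sets borel"
    and [measurable]: "w1 \<in> borel_measurable borel" "w2 \<in> borel_measurable borel"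
    and \<rho>0: "0 < \<rho>0" "\<rho>0 < 1" and c: "0 < c" and C: "0 \<le> C" and D: "0 \<le> D"
    and lower: "\<And>\<rho>. 0 < \<rho> \<Longrightarrow> \<rho> \<le> \<rho>0 \<Longrightarrow>
        ennreal (c * (\<rho>\<^sup>2 * ln (1 / \<rho>))) \<le> pair_integral \<beta> (\<lambda>r. w2 r * indicator {..<\<rho>} r)"
    and upper: "\<And>\<rho>. 0 < \<rho> \<Longrightarrow> \<rho> \<le> \<rho>0 \<Longrightarrow>
        pair_integral \<alpha> (\<lambda>r. w1 r * indicator {..\<rho>} r) \<le> ennreal (C * (\<rho>\<^sup>2 * ln (1 / \<rho>)))"
    and total: "pair_integral \<alpha> w1 \<le> ennreal D"
    and f: "antimono_on {0..} f"
  shows "pair_integral \<alpha> (\<lambda>r. w1 r * f r) \<le>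
    ennreal (C / c + D / (c * (\<rho>0\<^sup>2 * ln (1 / \<rho>0)))) * pair_integral \<beta> (\<lambda>r. w2 r * f r)"
proof (rule kernel_compare[OF assms(1-6) _ _ _ f])
  let ?h = "\<lambda>\<rho>::real. \<rho>\<^sup>2 * ln (1 / \<rho>)"
  let ?K = "C / c + D / (c * ?h \<rho>0)"
  have h0: "0 < ?h \<rho>0" using \<rho>0 by simp
  have K1: "0 \<le> C / c" and K2: "0 \<le> D / (c * ?h \<rho>0)" using c C D h0 by auto
  have large: "pair_integral \<alpha> w1 \<le> ennreal ?K * pair_integral \<beta> (\<lambda>r. w2 r * indicator {..<\<rho>0} r)"
  proof -
    have nz: "c * ?h \<rho>0 \<noteq> 0" using mult_pos_pos[OF c h0] by (rule less_imp_neq[symmetric])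
    have "D = D / (c * ?h \<rho>0) * (c * ?h \<rho>0)" by (rule nonzero_divide_eq_eq[OF nz, THEN iffD1, OF refl])
    also have "\<dots> \<le> ?K * (c * ?h \<rho>0)" using c h0 K1 by (intro mult_right_mono) auto
    finally have "ennreal D \<le> ennreal (?K * (c * ?h \<rho>0))" by (rule ennreal_leI)
    also have "\<dots> = ennreal ?K * ennreal (c * ?h \<rho>0)"
      using K1 K2 c h0 by (intro ennreal_mult) auto
    also have "\<dots> \<le> ennreal ?K * pair_integral \<beta> (\<lambda>r. w2 r * indicator {..<\<rho>0} r)"
      using \<rho>0 by (intro mult_left_mono lower) auto
    finally show ?thesis using total by simp
  qed
  show all: "pair_integral \<alpha> w1 \<le> ennreal ?K * pair_integral \<beta> w2"
    by (rule order_trans[OF large]) (intro mult_left_mono pair_integral_mono, auto simp: indicator_def)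
  show "pair_integral \<alpha> (\<lambda>r. w1 r * indicator {..\<rho>} r)
      \<le> ennreal ?K * pair_integral \<beta> (\<lambda>r. w2 r * indicator {..<\<rho>} r)" if \<rho>: "0 < \<rho>" for \<rho>
  proof (cases "\<rho> \<le> \<rho>0")
    case True
    have h: "0 \<le> ?h \<rho>" using \<rho> True \<rho>0 by simp
    have "C * ?h \<rho> = C / c * (c * ?h \<rho>)" using c by simp
    also have "\<dots> \<le> ?K * (c * ?h \<rho>)" using c h K2 by (intro mult_right_mono) auto
    finally have "ennreal (C * ?h \<rho>) \<le> ennreal (?K * (c * ?h \<rho>))" by (rule ennreal_leI)
    also have "\<dots> = ennreal ?K * ennreal (c * ?h \<rho>)"
      using K1 K2 c h by (intro ennreal_mult) auto
    also have "\<dots> \<le> ennreal ?K * pair_integral \<beta> (\<lambda>r. w2 r * indicator {..<\<rho>} r)"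
      using \<rho> True by (intro mult_left_mono lower) auto
    finally show ?thesis using upper[OF \<rho> True] by simp
  next
    case False
    have "pair_integral \<alpha> (\<lambda>r. w1 r * indicator {..\<rho>} r) \<le> pair_integral \<alpha> w1"
      by (intro pair_integral_mono) (auto simp: indicator_def)
    also note large
    also have "ennreal ?K * pair_integral \<beta> (\<lambda>r. w2 r * indicator {..<\<rho>0} r)
        \<le> ennreal ?K * pair_integral \<beta> (\<lambda>r. w2 r * indicator {..<\<rho>} r)"
      using False by (intro mult_left_mono pair_integral_mono) (auto simp: indicator_def)
    finally show ?thesis .
  qed
  show "pair_integral \<alpha> (\<lambda>r. w1 r * indicator {0} r) = 0"
  proof -
    have eps: "pair_integral \<alpha> (\<lambda>r. w1 r * indicator {0} r) \<le> ennreal e" if e: "0 < e" for e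
    proof -
      define \<rho> where "\<rho> = min \<rho>0 (e / (C + 1))"
      have \<rho>: "0 < \<rho>" "\<rho> \<le> \<rho>0" using e C \<rho>0 by (auto simp: \<rho>_def)
      have "\<rho> \<le> e / (C + 1)" by (simp add: \<rho>_def)
      then have e': "\<rho> * (C + 1) \<le> e" using C by (simp add: field_simps)
      have "pair_integral \<alpha> (\<lambda>r. w1 r * indicator {0} r) \<le> pair_integral \<alpha> (\<lambda>r. w1 r * indicator {..\<rho>} r)"
        using \<rho> by (intro pair_integral_mono) (auto simp: indicator_def)
      also have "\<dots> \<le> ennreal (C * ?h \<rho>)" by (rule upper[OF \<rho>])
      also have "C * ?h \<rho> \<le> C * \<rho>" using C \<rho> by (intro mult_left_mono rho_square_log_le) auto
      also have "C * \<rho> \<le> e" using e' \<rho> by (simp add: algebra_simps)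
      finally show ?thesis by (simp add: ennreal_leI)
    qed
    have "pair_integral \<alpha> (\<lambda>r. w1 r * indicator {0} r) \<le> 0"
    proof (rule ennreal_le_epsilon)
      show "pair_integral \<alpha> (\<lambda>r. w1 r * indicator {0} r) \<le> 0 + ennreal e" if "0 < e" for e
        using eps[OF that] by simp
    qed
    then show ?thesis by simp
  qed
qed

lemma ereal_inverse_le_mult_inverse:
  fixes x y :: ereal
  assumes "0 \<le> x" "x \<le> ereal c * y" "0 < c" "0 \<le> y"
  shows "inverse y \<le> ereal c * inverse x"
proof (cases x)
  case (real a)
  show ?thesis
  proof (cases y)
    fix b assume b: "y = ereal b"
    show ?thesis
    proof (cases "a = 0 \<or> b = 0")
      case True
      then show ?thesis using assms real b by auto
    next
      case False
      then show ?thesis using assms real b by (auto simp: field_simps)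
    qed
  qed (use assms real in auto)
qed (use assms in \<open>auto simp: ereal_mult_eq_PInfty\<close>)

text \<open>One test measure on each side: \<open>\<mu>\<close>, played against every measure on the
  square, bounds the capacity of \<open>A\<close> from below; Lebesgue measure on the square, played
  against every measure on \<open>A\<close>, bounds it from above.\<close>

lemma capacity_comparison:
  assumes \<rho>0: "0 < \<rho>0" "\<rho>0 < 1" and c: "0 < c" and C: "0 < C"
    and lower: "\<And>\<nu> \<rho>. prob_space \<nu> \<Longrightarrow> sets \<nu> = sets borel \<Longrightarrow> emeasure \<nu> A = 1 \<Longrightarrow>
        0 < \<rho> \<Longrightarrow> \<rho> \<le> \<rho>0 \<Longrightarrow> ennreal (c * (\<rho>\<^sup>2 * ln (1 / \<rho>))) \<le> pair_integral \<nu> (indicator {..<\<rho>})"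
    and \<mu>: "prob_space \<mu>" "sets \<mu> = sets borel" "emeasure \<mu> A = 1"
    and upper: "\<And>\<rho>. 0 < \<rho> \<Longrightarrow> \<rho> \<le> \<rho>0 \<Longrightarrow>
        pair_integral \<mu> (indicator {..\<rho>}) \<le> ennreal (C * (\<rho>\<^sup>2 * ln (1 / \<rho>)))"
  shows "\<exists>C1 C2 :: real. 0 < C1 \<and> 0 < C2 \<and>
    (\<forall>f. energy_kernel f \<longrightarrow>
      ereal C1 * capacity (log_kernel f) (cbox 0 1) \<le> capacity (\<lambda>r. enn2ereal (f r)) A \<and>
      capacity (\<lambda>r. enn2ereal (f r)) A \<le> ereal C2 * capacity (log_kernel f) (cbox 0 1))"
proof -
  interpret \<mu>: prob_space \<mu> by (rule \<mu>)
  interpret sq: prob_space square_measure by (rule square_measure)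
  let ?h = "\<rho>0\<^sup>2 * ln (1 / \<rho>0)"
  have h: "0 < ?h" using \<rho>0 by simp
  \<comment> \<open>Here \<open>1/16\<close> is the constant of \<open>square_log_pos_ge\<close>,
    and the numerator \<open>1\<close> is the total mass of
    \<open>\<mu> \<Otimes>\<^sub>M \<mu>\<close>.\<close>
  define K where "K = C / (1/16) + 1 / ((1/16) * ?h)"
  \<comment> \<open>\<open>C'\<close> absorbs the additive \<open>2\<close> of
    \<open>square_measure_log_pos_le\<close>, using
    \<open>ln (1 / \<rho>) \<ge> ln (1 / \<rho>0)\<close>. The term \<open>pi * 2\<close> in
    \<open>K'\<close> is that bound at radius \<open>1\<close>, beyond which \<open>log_pos\<close>
    vanishes.\<close>
  define C' where "C' = pi * (1 + 2 / ln (1 / \<rho>0))"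
  define K' where "K' = C' / c + (pi * 2) / (c * ?h)"
  have l0: "0 < ln (1 / \<rho>0)" using \<rho>0 by simp
  have C'pos: "0 < C'" unfolding C'_def using l0 by (intro mult_pos_pos add_pos_pos) auto
  have K: "0 < K" unfolding K_def using C h by (intro add_pos_pos) auto
  have K': "0 < K'" unfolding K'_def using C'pos c h by (intro add_pos_pos) auto
  define S where "S = {\<nu> :: (real^2) measure. prob_space \<nu> \<and> sets \<nu> = sets borel \<and> emeasure \<nu> (cbox 0 1)
      = 1}"
  define T where "T = {\<nu> :: (real^2) measure. prob_space \<nu> \<and> sets \<nu> = sets borel \<and> emeasure \<nu> A = 1}"
  have main: "ereal (1 / (73 * K)) * capacity (log_kernel f) (cbox 0 1) \<le> capacity (\<lambda>r. enn2ereal (f r)) A \<and>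
      capacity (\<lambda>r. enn2ereal (f r)) A \<le> ereal K' * capacity (log_kernel f) (cbox 0 1)"
    if "energy_kernel f" for f
  proof -
    have f: "antimono_on {0..} f" using that by (simp add: energy_kernel_def)
    have 1: "pair_integral \<mu> f \<le> ennreal K * pair_integral \<nu> (\<lambda>r. log_pos r * f r)" if "\<nu> \<in> S" for \<nu>
    proof -
      interpret \<nu>: prob_space \<nu> using that by (simp add: S_def)
      have "pair_integral \<mu> (\<lambda>r. (\<lambda>_. 1) r * f r) \<le> ennreal K * pair_integral \<nu> (\<lambda>r. log_pos r * f r)"
        unfolding K_def
      proof (rule kernel_compare_near_0)
        show "ennreal (1/16 * (\<rho>\<^sup>2 * ln (1 / \<rho>))) \<le> pair_integral \<nu> (\<lambda>r. log_pos r * indicator {..<\<rho>} r)"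
          if "0 < \<rho>" "\<rho> \<le> \<rho>0" for \<rho>
          using square_log_pos_ge[of \<nu> \<rho>] \<open>\<nu> \<in> S\<close> that \<rho>0 by (simp add: S_def)
        show "pair_integral \<mu> (\<lambda>_. 1) \<le> ennreal 1"
          by (simp add: pair_integral_const \<mu>)
      qed (use upper \<open>\<nu> \<in> S\<close> C f \<rho>0 in \<open>auto simp: \<mu> S_def \<mu>.finite_measure_axioms \<nu>.finite_measure_axioms\<close>)
      then show ?thesis by simp
    qed
    have 2: "pair_integral square_measure (\<lambda>r. log_pos r * f r) \<le> ennreal K' * pair_integral \<nu> f" if "\<nu>
        \<in> T" for \<nu>
    proof -
      interpret \<nu>: prob_space \<nu> using that by (simp add: T_def)
      have "pair_integral square_measure (\<lambda>r. log_pos r * f r) \<le> ennreal K' * pair_integral \<nu> (\<lambda>r.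
          (\<lambda>_. 1) r * f r)"
        unfolding K'_def
      proof (rule kernel_compare_near_0)
        show "pair_integral square_measure (\<lambda>r. log_pos r * indicator {..\<rho>} r) \<le> ennreal (C' * (\<rho>\<^sup>2 * ln
            (1 / \<rho>)))"
          if \<rho>: "0 < \<rho>" "\<rho> \<le> \<rho>0" for \<rho>
        proof -
          have "ln (1 / \<rho>0) \<le> ln (1 / \<rho>)" using \<rho> \<rho>0 by (simp add: frac_le)
          then have "1 \<le> ln (1 / \<rho>) / ln (1 / \<rho>0)" using l0 by simp
          then have "ln (1 / \<rho>) + 2 \<le> (1 + 2 / ln (1 / \<rho>0)) * ln (1 / \<rho>)"
            by (simp add: algebra_simps)
          then have "pi * \<rho>\<^sup>2 * (ln (1 / \<rho>) + 2) \<le> pi * \<rho>\<^sup>2 * ((1 + 2 / ln (1 / \<rho>0)) * ln (1 / \<rho>))"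
            by (intro mult_left_mono) auto
          also have "\<dots> = C' * (\<rho>\<^sup>2 * ln (1 / \<rho>))" by (simp add: C'_def)
          finally have "ennreal (pi * \<rho>\<^sup>2 * (ln (1 / \<rho>) + 2)) \<le> ennreal (C' * (\<rho>\<^sup>2 * ln (1 / \<rho>)))"
            by (rule ennreal_leI)
          moreover have "\<rho> \<le> 1" using \<rho> \<rho>0 by simp
          ultimately show ?thesis
            using square_measure_log_pos_le[of \<rho>] \<rho> by (meson order_trans)
        qed
        have "log_pos r = log_pos r * indicator {..1} r" if "0 \<le> r" for r
          using that by (cases "r \<le> 1") (auto simp: log_pos_pos ennreal_neg ln_div)
        then have "pair_integral square_measure log_pos = pair_integral square_measure (\<lambda>r. log_pos r
            * indicator {..1} r)"
          by (rule pair_integral_cong)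
        then show "pair_integral square_measure log_pos \<le> ennreal (pi * 2)"
          using square_measure_log_pos_le[of 1] by simp
      qed (use lower \<open>\<nu> \<in> T\<close> C'pos c f \<rho>0 in \<open>auto simp: square_measure T_def sq.finite_measure_axioms
          \<nu>.finite_measure_axioms\<close>)
      then show ?thesis by simp
    qed
    define IS where "IS = (INF \<nu>\<in>S. energy (log_kernel f) \<nu>)"
    define IT where "IT = (INF \<nu>\<in>T. energy (\<lambda>r. enn2ereal (f r)) \<nu>)"
    have capS: "capacity (log_kernel f) (cbox 0 1) = inverse IS"
      and capT: "capacity (\<lambda>r. enn2ereal (f r)) A = inverse IT"
      by (simp_all add: capacity_def IS_def IT_def S_def T_def)
    have ge: "enn2ereal (ennreal (1/73) * pair_integral \<nu> (\<lambda>r. log_pos r * f r))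
        \<le> energy (log_kernel f) \<nu>" if "\<nu> \<in> S" for \<nu>
      using that f by (intro energy_log_kernel_ge) (auto simp: S_def)
    have IS0: "0 \<le> IS"
      unfolding IS_def by (intro INF_greatest order_trans[OF _ ge]) auto
    have IT0: "0 \<le> IT"
      unfolding IT_def by (intro INF_greatest) (auto simp: energy_kernel_eq)
    have "ereal (1 / (73 * K)) * IT \<le> IS"
      unfolding IS_def
    proof (rule INF_greatest)
      fix \<nu> assume \<nu>: "\<nu> \<in> S"
      have "IT \<le> enn2ereal (pair_integral \<mu> f)"
        unfolding IT_def using \<mu> by (intro INF_lower2[of \<mu>]) (auto simp: T_def energy_kernel_eq)
      also have "\<dots> \<le> enn2ereal (ennreal K * pair_integral \<nu> (\<lambda>r. log_pos r * f r))"
        using 1[OF \<nu>] by (simp add: less_eq_ennreal.rep_eq)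
      finally have "ereal (1 / (73 * K)) * IT \<le> ereal (1 / (73 * K)) * enn2ereal (ennreal K
          * pair_integral \<nu> (\<lambda>r. log_pos r * f r))"
        using K by (intro ereal_mult_left_mono) auto
      also have "\<dots> = enn2ereal (ennreal (1 / (73 * K)) * (ennreal K * pair_integral \<nu> (\<lambda>r. log_pos r
          * f r)))"
        using K by (simp add: times_ennreal.rep_eq enn2ereal_ennreal)
      also have "ennreal (1 / (73 * K)) * (ennreal K * pair_integral \<nu> (\<lambda>r. log_pos r * f r))
         = ennreal (1 / 73) * pair_integral \<nu> (\<lambda>r. log_pos r * f r)"
        using K by (simp add: mult.assoc[symmetric] ennreal_mult[symmetric])
      also have "enn2ereal \<dots> \<le> energy (log_kernel f) \<nu>" by (rule ge[OF \<nu>])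
      finally show "ereal (1 / (73 * K)) * IT \<le> energy (log_kernel f) \<nu>" .
    qed
    then have a: "IT \<le> ereal (73 * K) * IS"
      using K IT0 by (cases IT; cases IS) (auto simp: field_simps)
    have b: "IS \<le> ereal K' * IT"
    proof -
      have "IS \<le> ereal K' * energy (\<lambda>r. enn2ereal (f r)) \<nu>" if \<nu>: "\<nu> \<in> T" for \<nu>
      proof -
        have "IS \<le> energy (log_kernel f) square_measure"
          unfolding IS_def by (intro INF_lower) (auto simp: S_def square_measure)
        also have "\<dots> \<le> enn2ereal (pair_integral square_measure (\<lambda>r. log_pos r * f r))"
          by (rule energy_log_kernel_le)
        also have "\<dots> \<le> enn2ereal (ennreal K' * pair_integral \<nu> f)"
          using 2[OF \<nu>] by (simp add: less_eq_ennreal.rep_eq)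
        also have "\<dots> = ereal K' * energy (\<lambda>r. enn2ereal (f r)) \<nu>"
          using K' by (simp add: times_ennreal.rep_eq enn2ereal_ennreal energy_kernel_eq)
        finally show ?thesis .
      qed
      then have "ereal (1 / K') * IS \<le> energy (\<lambda>r. enn2ereal (f r)) \<nu>" if "\<nu> \<in> T" for \<nu>
        using K' that IS0 by (cases IS; cases "energy (\<lambda>r. enn2ereal (f r)) \<nu>") (force simp: field_simps)+
      then have "ereal (1 / K') * IS \<le> IT" unfolding IT_def by (intro INF_greatest)
      then show ?thesis using K' IS0 by (cases IT; cases IS) (auto simp: field_simps)
    qed
    have "inverse IS \<le> ereal (73 * K) * inverse IT"
      by (rule ereal_inverse_le_mult_inverse[OF IT0 a _ IS0]) (use K in auto)
    then have "ereal (1 / (73 * K)) * inverse IS \<le> inverse IT"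
      using K IS0 IT0 by (cases "inverse IS"; cases "inverse IT") (auto simp: field_simps)
    moreover have "inverse IT \<le> ereal K' * inverse IS"
      by (rule ereal_inverse_le_mult_inverse[OF IS0 b _ IT0]) (use K' in auto)
    ultimately show ?thesis by (simp add: capS capT)
  qed
  show ?thesis
    by (intro exI[of _ "1 / (73 * K)"] exI[of _ K'] conjI allI impI) (use main K K' in auto)
qed

section \<open>Independence and tail bounds\<close>

context prob_space begin

text \<open>Fubini for the joint law. The second variable is frozen, so that the inner integral can
  be bounded uniformly in it.\<close>

lemma indep_var_nn_integral:
  assumes ind: "indep_var S X T Y" and [measurable]: "f \<in> borel_measurable (S \<Otimes>\<^sub>M T)"
  shows "(\<integral>\<^sup>+w. f (X w, Y w) \<partial>M) = (\<integral>\<^sup>+w. (\<integral>\<^sup>+w'. f (X w', Y w) \<partial>M) \<partial>M)"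
proof -
  have [measurable]: "X \<in> measurable M S" "Y \<in> measurable M T"
    and eq: "distr M S X \<Otimes>\<^sub>M distr M T Y = distr M (S \<Otimes>\<^sub>M T) (\<lambda>x. (X x, Y x))"
    using ind by (auto simp: indep_var_distribution_eq)
  interpret X: prob_space "distr M S X" by (rule prob_space_distr) simp
  interpret Y: prob_space "distr M T Y" by (rule prob_space_distr) simp
  interpret XY: pair_sigma_finite "distr M S X" "distr M T Y" ..
  have "(\<integral>\<^sup>+w. f (X w, Y w) \<partial>M) = (\<integral>\<^sup>+z. f z \<partial>(distr M S X \<Otimes>\<^sub>M distr M T Y))"
    by (subst eq) (simp add: nn_integral_distr)
  also have "\<dots> = (\<integral>\<^sup>+y. \<integral>\<^sup>+x. f (x, y) \<partial>distr M S X \<partial>distr M T Y)"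
    by (rule XY.nn_integral_snd[symmetric]) measurable
  also have "\<dots> = (\<integral>\<^sup>+y. \<integral>\<^sup>+w'. f (X w', y) \<partial>M \<partial>distr M T Y)"
    by (intro nn_integral_cong) (simp add: nn_integral_distr)
  also have "\<dots> = (\<integral>\<^sup>+w. (\<integral>\<^sup>+w'. f (X w', Y w) \<partial>M) \<partial>M)"
    by (rule nn_integral_distr) measurable
  finally show ?thesis .
qed

lemma indep_var_nn_integral_mult:
  assumes ind: "indep_var S X T Y" and [measurable]: "f \<in> borel_measurable S" "g \<in> borel_measurable T"
  shows "(\<integral>\<^sup>+w. f (X w) * g (Y w) \<partial>M) = (\<integral>\<^sup>+w. f (X w) \<partial>M) * (\<integral>\<^sup>+w. g (Y w) \<partial>M)"
proof -
  have [measurable]: "X \<in> measurable M S" "Y \<in> measurable M T"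
    using ind by (auto simp: indep_var_distribution_eq)
  show ?thesis
    using indep_var_nn_integral[OF ind, of "\<lambda>(x, y). f x * g y"]
    by (simp add: nn_integral_multc nn_integral_cmult)
qed

lemma indep_var_of_disjoint_indices:
  assumes "indep_vars M' X I" "A \<inter> B = {}" "A \<subseteq> I" "B \<subseteq> I"
    and "f \<in> measurable (PiM A M') S" "g \<in> measurable (PiM B M') T"
  shows "indep_var S (\<lambda>w. f (\<lambda>i\<in>A. X i w)) T (\<lambda>w. g (\<lambda>i\<in>B. X i w))"
  using indep_var_compose[OF indep_var_restrict[OF assms(1-4)] assms(5,6)] by (simp add: comp_def)

lemma expectation_le_of_second_moment:
  fixes Z :: "'a \<Rightarrow> real"
  assumes "integrable M Z" "integrable M (\<lambda>w. (Z w)\<^sup>2)" "expectation (\<lambda>w. (Z w)\<^sup>2) \<le> K\<^sup>2" "0 \<le> K"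
  shows "expectation Z \<le> K"
proof -
  have "(expectation Z)\<^sup>2 \<le> K\<^sup>2"
    using variance_positive[of Z] variance_eq[of Z] assms by simp
  then show ?thesis using assms(4) by (rule power2_le_imp_le)
qed

text \<open>Chebyshev's inequality. Second moments about zero are enough: they dominate the
  variances, and they bound the means by \<open>K\<close>, which is the origin of
  \<open>real n * K\<close>.\<close>

lemma indep_sum_tail:
  fixes Z :: "nat \<Rightarrow> 'a \<Rightarrow> real"
  assumes ind: "indep_vars (\<lambda>_. borel) Z {..<n}"
    and bounded: "\<And>i w. i < n \<Longrightarrow> w \<in> space M \<Longrightarrow> \<bar>Z i w\<bar> \<le> D"
    and second: "\<And>i. i < n \<Longrightarrow> expectation (\<lambda>w. (Z i w)\<^sup>2) \<le> K\<^sup>2"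
    and K: "0 \<le> K" and l: "0 < l"
  shows "prob {w \<in> space M. real n * K + l \<le> (\<Sum>i<n. Z i w)} \<le> real n * K\<^sup>2 / l\<^sup>2"
proof -
  have rv[measurable]: "random_variable borel (Z i)" if "i < n" for i
    using ind that by (auto simp: indep_vars_def)
  have int: "integrable M (Z i)" if "i < n" for i
    using bounded that by (intro integrable_const_bound[where B = D]) auto
  have int2: "integrable M (\<lambda>w. Z i w * Z j w)" if "i < n" "j < n" for i j
  proof (rule integrable_const_bound[where B = "D * D"])
    have "\<bar>Z i w\<bar> * \<bar>Z j w\<bar> \<le> D * D" if "w \<in> space M" for w
      using bounded[OF \<open>i < n\<close> that] bounded[OF \<open>j < n\<close> that] by (intro mult_mono) auto
    then show "AE w in M. norm (Z i w * Z j w) \<le> D * D"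
      by (intro AE_I2) (simp add: abs_mult)
  qed (use that in measurable)
  have mean: "expectation (Z i) \<le> K" if "i < n" for i
    by (rule expectation_le_of_second_moment[OF int[OF that] _ second[OF that] K])
       (use int2[OF that that] in \<open>simp add: power2_eq_square\<close>)
  define Y where "Y i w = Z i w - expectation (Z i)" for i w
  have Ym[measurable]: "random_variable borel (Y i)" if "i < n" for i
    using that unfolding Y_def by measurable
  have [measurable]: "random_variable borel (\<lambda>w. \<Sum>i<n. Y i w)"
    by (intro borel_measurable_sum Ym) auto
  have intY: "integrable M (Y i)" if "i < n" for i
    unfolding Y_def using int that by auto
  have intYY: "integrable M (\<lambda>w. Y i w * Y j w)" if "i < n" "j < n" for i j
    unfolding Y_def using int int2 that by (auto simp: algebra_simps)
  have EY: "expectation (Y i) = 0" if "i < n" for i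
    unfolding Y_def using int that by (simp add: prob_space)
  have off: "expectation (\<lambda>w. Y i w * Y j w) = 0" if "i < n" "j < n" "i \<noteq> j" for i j
  proof -
    have "indep_var borel (Y i) borel (Y j)"
      using indep_var_of_disjoint_indices[OF ind, of "{i}" "{j}" "\<lambda>x. x i - expectation (Z i)" borel
          "\<lambda>x. x j - expectation (Z j)" borel] that
      by (simp add: Y_def[abs_def])
    from indep_var_lebesgue_integral[OF this intY intY] that show ?thesis by (simp add: EY)
  qed
  have diag: "expectation (\<lambda>w. Y i w * Y i w) \<le> K\<^sup>2" if "i < n" for i
  proof -
    have "expectation (\<lambda>w. Y i w * Y i w) = variance (Z i)" by (simp add: Y_def power2_eq_square)
    also have "\<dots> = expectation (\<lambda>w. (Z i w)\<^sup>2) - (expectation (Z i))\<^sup>2"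
      by (rule variance_eq[OF int[OF that]]) (use int2[OF that that] in \<open>simp add: power2_eq_square\<close>)
    finally show ?thesis using second[OF that] zero_le_power2[of "expectation (Z i)"] by linarith
  qed
  have sq: "(\<Sum>i<n. Y i w)\<^sup>2 = (\<Sum>i<n. \<Sum>j<n. Y i w * Y j w)" for w
    by (simp add: power2_eq_square sum_product)
  have isq: "integrable M (\<lambda>w. (\<Sum>i<n. Y i w)\<^sup>2)"
    unfolding sq by (intro Bochner_Integration.integrable_sum intYY) auto
  have "expectation (\<lambda>w. (\<Sum>i<n. Y i w)\<^sup>2) = (\<Sum>i<n. \<Sum>j<n. expectation (\<lambda>w. Y i w * Y j w))"
  proof -
    have "expectation (\<lambda>w. \<Sum>i<n. \<Sum>j<n. Y i w * Y j w) = (\<Sum>i<n. expectation (\<lambda>w. \<Sum>j<n. Y i w * Y j w))"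
      by (rule Bochner_Integration.integral_sum) (use intYY in \<open>auto intro!:
          Bochner_Integration.integrable_sum\<close>)
    also have "\<dots> = (\<Sum>i<n. \<Sum>j<n. expectation (\<lambda>w. Y i w * Y j w))"
      by (intro sum.cong refl Bochner_Integration.integral_sum) (use intYY in auto)
    finally show ?thesis unfolding sq .
  qed
  also have "\<dots> = (\<Sum>i<n. expectation (\<lambda>w. Y i w * Y i w))"
  proof (intro sum.cong refl)
    fix i assume "i \<in> {..<n}"
    then have "(\<Sum>j<n. expectation (\<lambda>w. Y i w * Y j w)) = (\<Sum>j<n. if j = i then expectation (\<lambda>w. Y i w
        * Y i w) else 0)"
      using off by (intro sum.cong) auto
    then show "(\<Sum>j<n. expectation (\<lambda>w. Y i w * Y j w)) = expectation (\<lambda>w. Y i w * Y i w)"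
      using \<open>i \<in> {..<n}\<close> by simp
  qed
  also have "\<dots> \<le> (\<Sum>i<n. K\<^sup>2)" using diag by (intro sum_mono) auto
  finally have var: "expectation (\<lambda>w. (\<Sum>i<n. Y i w)\<^sup>2) \<le> real n * K\<^sup>2" by simp
  have "prob {w \<in> space M. real n * K + l \<le> (\<Sum>i<n. Z i w)} \<le> prob {w \<in> space M. l \<le> \<bar>\<Sum>i<n. Y i w\<bar>}"
  proof (rule finite_measure_mono)
    have "(\<Sum>i<n. Z i w) \<le> (\<Sum>i<n. Y i w) + real n * K" for w
    proof -
      have "(\<Sum>i<n. expectation (Z i)) \<le> (\<Sum>i<n. K)" using mean by (intro sum_mono) auto
      then show ?thesis by (simp add: Y_def sum_subtractf)
    qed
    then show "{w \<in> space M. real n * K + l \<le> (\<Sum>i<n. Z i w)} \<subseteq> {w \<in> space M. l \<le> \<bar>\<Sum>i<n. Y i w\<bar>}"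
      by (auto intro: order_trans[rotated]) (smt (verit, best))
  qed measurable
  also have "\<dots> \<le> expectation (\<lambda>w. (\<Sum>i<n. Y i w)\<^sup>2) / l\<^sup>2"
    using isq l by (intro second_moment_method) auto
  also have "\<dots> \<le> real n * K\<^sup>2 / l\<^sup>2" using var l by (intro divide_right_mono) auto
  finally show ?thesis .
qed

text \<open>To be bad for all large \<open>m\<close> is an increasing union of intersections, each
  contained in a single \<open>E k m\<close>; so its probability is at most \<open>p k\<close>, with
  no union bound over \<open>m\<close>. Borel-Cantelli then runs over \<open>k\<close>
  alone.\<close>

lemma frequently_good_of_summable_bad:
  assumes meas: "\<And>k m. E k m \<in> events" and bound: "\<And>k m. m \<ge> start k \<Longrightarrow> k \<ge> kmin \<Longrightarrow> prob (E k m) \<le> p k"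
    and p: "summable p"
  shows "AE w in M. eventually (\<lambda>k. \<exists>\<^sub>F m in sequentially. w \<notin> E k m) sequentially"
proof -
  define F where "F k m = (\<Inter>j\<in>{m..}. E (k + kmin) j)" for k m
  have Fm[measurable]: "F k m \<in> events" for k m
    unfolding F_def using meas by (intro sets.countable_INT') auto
  define G where "G k = (\<Union>m. F k m)" for k
  have Gm[measurable]: "G k \<in> events" for k unfolding G_def by auto
  have le: "prob (G k) \<le> p (k + kmin)" for k
  proof (rule LIMSEQ_le_const2)
    have "incseq (F k)" by (rule incseq_SucI) (auto simp: F_def)
    then show "(\<lambda>m. prob (F k m)) \<longlonglongrightarrow> prob (G k)"
      unfolding G_def by (intro finite_Lim_measure_incseq) auto
    show "\<exists>N. \<forall>m\<ge>N. prob (F k m) \<le> p (k + kmin)"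
    proof (intro exI allI impI)
      fix m assume "start (k + kmin) \<le> m"
      have "prob (F k m) \<le> prob (E (k + kmin) m)" using meas by (intro finite_measure_mono)
          (auto simp: F_def)
      also have "\<dots> \<le> p (k + kmin)" using \<open>start (k + kmin) \<le> m\<close> by (intro bound) auto
      finally show "prob (F k m) \<le> p (k + kmin)" .
    qed
  qed
  have "summable (\<lambda>k. p (k + kmin))" using p by (simp add: summable_iff_shift)
  then have "summable (\<lambda>k. prob (G k))"
    by (rule summable_comparison_test'[of _ 0]) (simp add: le)
  then have "AE w in M. eventually (\<lambda>k. w \<in> space M - G k) sequentially"
    by (intro borel_cantelli_AE1) (auto simp: emeasure_eq_measure)
  then show ?thesis
  proof eventually_elim
    case (elim w)
    then have "eventually (\<lambda>k. \<exists>\<^sub>F m in sequentially. w \<notin> E (k + kmin) m) sequentially"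
    proof eventually_elim
      case (elim k)
      then show ?case by (auto simp: G_def F_def frequently_sequentially)
    qed
    then show ?case by (rule eventually_sequentially_seg[THEN iffD1])
  qed
qed

end

section \<open>Close pairs of a planar Gaussian random walk\<close>

text \<open>The Gaussian law enters only through two small-ball bounds. The upper one allows any
  centre \<open>x\<close>, since it is applied conditionally on other increments. The lower one is
  restricted to radii at which the density is still comparable with its maximum.\<close>

locale gaussian_walk = prob_space M for M :: "'w measure" +
  fixes X :: "nat \<Rightarrow> 'w \<Rightarrow> real ^ 2" and N :: nat and \<delta> :: real
  assumes indep: "indep_vars (\<lambda>_. borel) X {..<N}"
    and X_rv [measurable]: "\<And>l. random_variable borel (X l)"
    and step_pos: "0 < \<delta>"
    and small_ball_le: "\<And>i j \<rho> x. i < j \<Longrightarrow> j \<le> N \<Longrightarrow> 0 \<le> \<rho> \<Longrightarrow>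
      prob {w \<in> space M. norm ((\<Sum>l\<in>{i..<j}. X l w) + x) \<le> \<rho>} \<le> \<rho>\<^sup>2 / (2 * \<delta> * real (j - i))"
    and small_ball_ge: "\<And>i j \<rho>. i < j \<Longrightarrow> j \<le> N \<Longrightarrow> 0 \<le> \<rho> \<Longrightarrow> \<rho>\<^sup>2 \<le> \<delta> * real (j - i) \<Longrightarrow>
      \<rho>\<^sup>2 / (4 * \<delta> * real (j - i)) \<le> prob {w \<in> space M. norm (\<Sum>l\<in>{i..<j}. X l w) \<le> \<rho>}"
begin

definition inc :: "nat \<Rightarrow> nat \<Rightarrow> 'w \<Rightarrow> real ^ 2" where
  "inc i j w = (\<Sum>l\<in>{i..<j}. X l w)"

lemma inc_rv [measurable]: "random_variable borel (inc i j)"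
  unfolding inc_def by measurable

lemma inc_add: "i \<le> j \<Longrightarrow> j \<le> k \<Longrightarrow> inc i j w + inc j k w = inc i k w"
  unfolding inc_def by (rule sum.atLeastLessThan_concat)

lemma inc_restrict: "{i..<j} \<subseteq> B \<Longrightarrow> (\<Sum>l\<in>{i..<j}. (\<lambda>l\<in>B. X l w) l) = inc i j w"
  unfolding inc_def by (intro sum.cong) auto

lemma partial_sum_measurable:
  "{i..<j} \<subseteq> B \<Longrightarrow> (\<lambda>x. \<Sum>l\<in>{i..<j}. x l) \<in> measurable (PiM B (\<lambda>_. borel)) (borel :: (real^2) measure)"
  by (intro borel_measurable_sum measurable_component_singleton) auto

text \<open>When the coordinates in \<open>B\<close> are frozen, \<open>g\<close> is a fixed centre,
  and the upper bound is uniform in it; the event \<open>Q\<close> about those coordinates is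
  carried along as a factor.\<close>

lemma small_ball_indep:
  fixes g :: "(nat \<Rightarrow> real^2) \<Rightarrow> real^2"
  assumes ij: "i < j" "j \<le> N" and B: "B \<subseteq> {..<N}" "B \<inter> {i..<j} = {}" and \<rho>: "0 \<le> \<rho>"
    and g[measurable]: "g \<in> borel_measurable (PiM B (\<lambda>_. borel))"
    and Q[measurable]: "Measurable.pred (PiM B (\<lambda>_. borel)) Q"
  shows "prob {w \<in> space M. norm (inc i j w + g (\<lambda>l\<in>B. X l w)) \<le> \<rho> \<and> Q (\<lambda>l\<in>B. X l w)}
    \<le> \<rho>\<^sup>2 / (2 * \<delta> * real (j - i)) * prob {w \<in> space M. Q (\<lambda>l\<in>B. X l w)}"
proof -
  let ?K = "\<rho>\<^sup>2 / (2 * \<delta> * real (j - i))"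
  let ?S = "PiM {i..<j} (\<lambda>_. borel) :: (nat \<Rightarrow> real^2) measure" and ?T
      = "PiM B (\<lambda>_. borel) :: (nat \<Rightarrow> real^2) measure"
  let ?Y = "\<lambda>w. \<lambda>l\<in>B. X l w" and ?U = "\<lambda>w. \<lambda>l\<in>{i..<j}. X l w"
  have K: "0 \<le> ?K" using step_pos by simp
  have ind: "indep_var ?S ?U ?T ?Y"
    using ij B by (intro indep_var_restrict[OF indep]) auto
  have Ym[measurable]: "?Y \<in> measurable M ?T" using ind by (auto simp: indep_var_distribution_eq)
  have [measurable]: "(\<lambda>x. \<Sum>l\<in>{i..<j}. x l) \<in> measurable ?S borel"
    by (rule partial_sum_measurable) simp
  define f where "f = (\<lambda>(x :: nat \<Rightarrow> real^2, y).
     indicator {..\<rho>} (norm ((\<Sum>l\<in>{i..<j}. x l) + g y)) * (indicator {y. Q y} y :: ennreal))"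
  have fm: "f \<in> borel_measurable (?S \<Otimes>\<^sub>M ?T)"
    unfolding f_def indicator_def by measurable
  have "emeasure M {w \<in> space M. norm (inc i j w + g (?Y w)) \<le> \<rho> \<and> Q (?Y w)}
     = (\<integral>\<^sup>+w. f (?U w, ?Y w) \<partial>M)"
  proof -
    let ?A = "{w \<in> space M. norm (inc i j w + g (?Y w)) \<le> \<rho> \<and> Q (?Y w)}"
    have gY: "random_variable borel (\<lambda>w. g (?Y w))" by (rule measurable_compose[OF Ym g])
    have QY: "Measurable.pred M (\<lambda>w. Q (?Y w))" by (rule measurable_compose[OF Ym Q])
    have "?A \<in> events"
      using gY QY by measurable
    then have "emeasure M ?A = (\<integral>\<^sup>+w. indicator ?A w \<partial>M)" by simp
    also have "\<dots> = (\<integral>\<^sup>+w. f (?U w, ?Y w) \<partial>M)"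
      by (intro nn_integral_cong) (auto simp: f_def inc_def indicator_def)
    finally show ?thesis .
  qed
  also have "\<dots> = (\<integral>\<^sup>+w. (\<integral>\<^sup>+w'. f (?U w', ?Y w) \<partial>M) \<partial>M)"
    by (rule indep_var_nn_integral[OF ind fm])
  also have "\<dots> \<le> (\<integral>\<^sup>+w. ennreal ?K * indicator {w\<in>space M. Q (?Y w)} w \<partial>M)"
  proof (rule nn_integral_mono)
    fix w assume w: "w \<in> space M"
    have "(\<integral>\<^sup>+w'. f (?U w', ?Y w) \<partial>M) =
       (\<integral>\<^sup>+w'. indicator {w'\<in>space M. norm (inc i j w' + g (?Y w)) \<le> \<rho>} w' * indicator {w\<in>space M. Q
           (?Y w)} w \<partial>M)"
      using w by (intro nn_integral_cong) (auto simp: f_def inc_def indicator_def)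
    also have "\<dots> = emeasure M {w'\<in>space M. norm (inc i j w' + g (?Y w)) \<le> \<rho>} * indicator {w\<in>space M. Q
        (?Y w)} w"
      by (subst nn_integral_multc) auto
    also have "\<dots> \<le> ennreal ?K * indicator {w\<in>space M. Q (?Y w)} w"
      using small_ball_le[OF ij \<rho>, of "g (?Y w)"]
      by (intro mult_right_mono) (auto simp: emeasure_eq_measure inc_def intro!: ennreal_leI)
    finally show "(\<integral>\<^sup>+w'. f (?U w', ?Y w) \<partial>M) \<le> ennreal ?K * indicator {w\<in>space M. Q (?Y w)} w" .
  qed
  also have "\<dots> = ennreal ?K * emeasure M {w\<in>space M. Q (?Y w)}"
    by (rule nn_integral_cmult_indicator) measurable
  also have "\<dots> = ennreal (?K * prob {w\<in>space M. Q (?Y w)})"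
    by (simp only: emeasure_eq_measure ennreal_mult[OF K measure_nonneg])
  finally show ?thesis
    by (simp only: emeasure_eq_measure ennreal_le_iff[OF mult_nonneg_nonneg[OF K measure_nonneg]])
qed

text \<open>Four times give three independent increments. If two pairs of them are close, then the
  middle increment is close to a function of the outer ones, whose sum or difference is small; the
  two events are treated separately, which avoids any covariance computation.\<close>

lemma outer_bound:
  assumes p: "p0 \<le> p1" "p1 < p2" "p2 \<le> p3" "p3 \<le> N" and e: "e = 1 \<or> e = (-1 :: real)"
    and r: "0 \<le> r" "\<delta> \<le> r\<^sup>2"
  shows "prob {w \<in> space M. norm (inc p0 p1 w + e *\<^sub>R inc p2 p3 w) \<le> 2 * r}
      \<le> 2 * (r\<^sup>2 / \<delta>) / (sqrt (max 1 (p1 - p0)) * sqrt (max 1 (p3 - p2)))"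
proof -
  let ?P = "prob {w \<in> space M. norm (inc p0 p1 w + e *\<^sub>R inc p2 p3 w) \<le> 2 * r}"
  let ?q = "r\<^sup>2 / \<delta>"
  have q: "1 \<le> ?q" using r step_pos by simp
  \<comment> \<open>An empty increment has no small-ball bound, but the trivial bound
    \<open>1\<close> is enough because \<open>\<delta> \<le> r\<^sup>2\<close>. This is the origin
    of \<open>max 1\<close>.\<close>
  have a: "?P \<le> 2 * ?q / max 1 (p1 - p0)"
  proof (cases "p0 = p1")
    case True
    have "1 \<le> 2 * ?q" using q by linarith
    then have "?P \<le> 2 * ?q" using prob_le_1 by (rule order_trans[rotated])
    then show ?thesis using True by simp
  next
    case False
    have "?P = prob {w \<in> space M. norm (inc p0 p1 w + (\<lambda>x. e *\<^sub>R (\<Sum>l\<in>{p2..<p3}. x l)) (\<lambda>l\<in>{p2..<p3}. X l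
        w)) \<le> 2 * r \<and> True}"
      by (simp add: inc_restrict del: restrict_apply)
    also have "\<dots> \<le> (2 * r)\<^sup>2 / (2 * \<delta> * real (p1 - p0)) * prob {w \<in> space M. True}"
      using False p r by (intro small_ball_indep borel_measurable_scaleR borel_measurable_const
          partial_sum_measurable) auto
    also have "\<dots> = 2 * ?q / max 1 (p1 - p0)"
      using False p by (simp add: prob_space power2_eq_square max_def)
    finally show ?thesis .
  qed
  have b: "?P \<le> 2 * ?q / max 1 (p3 - p2)"
  proof (cases "p2 = p3")
    case True
    have "1 \<le> 2 * ?q" using q by linarith
    then have "?P \<le> 2 * ?q" using prob_le_1 by (rule order_trans[rotated])
    then show ?thesis using True by simp
  next
    case False
    have "norm (inc p0 p1 w + e *\<^sub>R inc p2 p3 w) = norm (inc p2 p3 w + e *\<^sub>R inc p0 p1 w)" for w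
      using e by (auto simp: add.commute norm_minus_commute)
    then have "?P = prob {w \<in> space M. norm (inc p2 p3 w + (\<lambda>x. e *\<^sub>R (\<Sum>l\<in>{p0..<p1}. x l))
        (\<lambda>l\<in>{p0..<p1}. X l w)) \<le> 2 * r \<and> True}"
      by (simp add: inc_restrict del: restrict_apply)
    also have "\<dots> \<le> (2 * r)\<^sup>2 / (2 * \<delta> * real (p3 - p2)) * prob {w \<in> space M. True}"
      using False p r by (intro small_ball_indep borel_measurable_scaleR borel_measurable_const
          partial_sum_measurable) auto
    also have "\<dots> = 2 * ?q / max 1 (p3 - p2)"
      using False p by (simp add: prob_space power2_eq_square max_def)
    finally show ?thesis .
  qed
  let ?a = "real (max 1 (p1 - p0))" and ?b = "real (max 1 (p3 - p2))"
  have ab: "0 < ?a" "0 < ?b" by auto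
  \<comment> \<open>Both bounds hold, hence also their geometric mean. It has one factor for each
    outer increment, so that later sums factorise.\<close>
  have "?P\<^sup>2 = ?P * ?P" by (rule power2_eq_square)
  also have "\<dots> \<le> (2 * ?q / ?a) * (2 * ?q / ?b)"
    by (rule mult_mono[OF a b]) (use step_pos in auto)
  also have "\<dots> = (2 * ?q / (sqrt ?a * sqrt ?b))\<^sup>2"
    using ab by (simp add: power_mult_distrib power_divide) (simp add: power2_eq_square)
  finally show ?thesis
    by (rule power2_le_imp_le) (use step_pos in \<open>auto intro!: divide_nonneg_nonneg\<close>)
qed

text \<open>The parameters cover both arrangements of two pairs: \<open>e = -1\<close>,
  \<open>c = 1\<close> when they cross, \<open>e = 1\<close>, \<open>c = 0\<close> when they are
  nested. The second event involves only the outer increments, so its probability is multiplied by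
  the small-ball factor of the middle one.\<close>

lemma middle_bound:
  assumes p: "p0 \<le> p1" "p1 < p2" "p2 \<le> p3" "p3 \<le> N" and e: "e = 1 \<or> e = (-1 :: real)"
    and r: "0 \<le> r" "\<delta> \<le> r\<^sup>2"
  shows "prob {w \<in> space M. norm (inc p1 p2 w + c *\<^sub>R inc p0 p1 w) \<le> r \<and>
        norm (inc p0 p1 w + e *\<^sub>R inc p2 p3 w) \<le> 2 * r}
      \<le> (r\<^sup>2 / \<delta>)\<^sup>2 / (real (p2 - p1) * (sqrt (max 1 (p1 - p0)) * sqrt (max 1 (p3 - p2))))"
proof -
  let ?B = "{p0..<p1} \<union> {p2..<p3}"
  let ?Y = "\<lambda>w. \<lambda>l\<in>?B. X l w"
  let ?g = "\<lambda>x. c *\<^sub>R (\<Sum>l\<in>{p0..<p1}. x l) :: real^2"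
  let ?Q = "\<lambda>x. norm ((\<Sum>l\<in>{p0..<p1}. x l) + e *\<^sub>R (\<Sum>l\<in>{p2..<p3}. x l) :: real^2) \<le> 2 * r"
  let ?q = "r\<^sup>2 / \<delta>" and ?d = "sqrt (max 1 (p1 - p0)) * sqrt (max 1 (p3 - p2))"
  have [measurable]: "(\<lambda>x. \<Sum>l\<in>{p0..<p1}. x l) \<in> measurable (PiM ?B (\<lambda>_. borel)) (borel :: (real^2) measure)"
     "(\<lambda>x. \<Sum>l\<in>{p2..<p3}. x l) \<in> measurable (PiM ?B (\<lambda>_. borel)) (borel :: (real^2) measure)"
    by (auto intro!: partial_sum_measurable)
  have eq: "(\<Sum>l\<in>{p0..<p1}. ?Y w l) = inc p0 p1 w" "(\<Sum>l\<in>{p2..<p3}. ?Y w l) = inc p2 p3 w" for w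
    by (auto simp: inc_def)
  have "prob {w \<in> space M. norm (inc p1 p2 w + ?g (?Y w)) \<le> r \<and> ?Q (?Y w)}
      \<le> r\<^sup>2 / (2 * \<delta> * real (p2 - p1)) * prob {w \<in> space M. ?Q (?Y w)}"
    using p r by (intro small_ball_indep) auto
  also have "\<dots> \<le> r\<^sup>2 / (2 * \<delta> * real (p2 - p1)) * (2 * ?q / ?d)"
    unfolding eq using step_pos by (intro mult_left_mono outer_bound p e r) auto
  also have "\<dots> = ?q\<^sup>2 / (real (p2 - p1) * ?d)"
    using step_pos p by (simp add: field_simps power2_eq_square)
  finally show ?thesis unfolding eq .
qed

text \<open>The difference of the two increments cancels their common middle part and leaves the
  difference of the outer ones.\<close>

lemma crossing_bound:
  assumes p: "p0 \<le> p1" "p1 < p2" "p2 \<le> p3" "p3 \<le> N" and r: "0 \<le> r" "\<delta> \<le> r\<^sup>2"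
  shows "prob {w \<in> space M. norm (inc p0 p2 w) \<le> r \<and> norm (inc p1 p3 w) \<le> r}
      \<le> (r\<^sup>2 / \<delta>)\<^sup>2 / (real (p2 - p1) * (sqrt (max 1 (p1 - p0)) * sqrt (max 1 (p3 - p2))))"
proof (rule order_trans[OF _ middle_bound[of p0 p1 p2 p3 "-1" r 1]])
  have 1: "inc p0 p2 w = inc p0 p1 w + inc p1 p2 w" "inc p1 p3 w = inc p1 p2 w + inc p2 p3 w" for w
    using p by (auto simp: inc_add)
  have 2: "norm (inc p0 p1 w - inc p2 p3 w) \<le> norm (inc p0 p2 w) + norm (inc p1 p3 w)" for w
    using norm_triangle_ineq4[of "inc p0 p2 w" "inc p1 p3 w"] by (simp add: 1)
  have 3: "norm (inc p0 p1 w - inc p2 p3 w) \<le> 2 * r" if "norm (inc p0 p2 w) \<le> r" "norm (inc p1 p3 w)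
      \<le> r" for w
    using 2[of w] that by linarith
  show "prob {w \<in> space M. norm (inc p0 p2 w) \<le> r \<and> norm (inc p1 p3 w) \<le> r} \<le>
    prob {w \<in> space M. norm (inc p1 p2 w + 1 *\<^sub>R inc p0 p1 w) \<le> r \<and>
        norm (inc p0 p1 w + (-1) *\<^sub>R inc p2 p3 w) \<le> 2 * r}"
  proof (rule finite_measure_mono)
    show "{w \<in> space M. norm (inc p0 p2 w) \<le> r \<and> norm (inc p1 p3 w) \<le> r} \<subseteq>
      {w \<in> space M. norm (inc p1 p2 w + 1 *\<^sub>R inc p0 p1 w) \<le> r \<and>
        norm (inc p0 p1 w + (-1) *\<^sub>R inc p2 p3 w) \<le> 2 * r}"
      using 3 by (auto simp: 1(1) add.commute)
  qed measurable
qed (use p r in auto)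

text \<open>Subtracting the inner increment from the outer one leaves the sum of the two end
  pieces.\<close>

lemma nested_bound:
  assumes p: "p0 \<le> p1" "p1 < p2" "p2 \<le> p3" "p3 \<le> N" and r: "0 \<le> r" "\<delta> \<le> r\<^sup>2"
  shows "prob {w \<in> space M. norm (inc p0 p3 w) \<le> r \<and> norm (inc p1 p2 w) \<le> r}
      \<le> (r\<^sup>2 / \<delta>)\<^sup>2 / (real (p2 - p1) * (sqrt (max 1 (p1 - p0)) * sqrt (max 1 (p3 - p2))))"
proof (rule order_trans[OF _ middle_bound[of p0 p1 p2 p3 1 r 0]])
  have 1: "inc p0 p3 w = inc p0 p1 w + inc p1 p2 w + inc p2 p3 w" for w
    using p by (simp add: inc_add)
  have 2: "norm (inc p0 p1 w + inc p2 p3 w) \<le> norm (inc p0 p3 w) + norm (inc p1 p2 w)" for w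
    using norm_triangle_ineq4[of "inc p0 p3 w" "inc p1 p2 w"] by (simp add: 1)
  have 3: "norm (inc p0 p1 w + inc p2 p3 w) \<le> 2 * r" if "norm (inc p0 p3 w) \<le> r" "norm (inc p1 p2 w)
      \<le> r" for w
    using 2[of w] that by linarith
  show "prob {w \<in> space M. norm (inc p0 p3 w) \<le> r \<and> norm (inc p1 p2 w) \<le> r} \<le>
    prob {w \<in> space M. norm (inc p1 p2 w + 0 *\<^sub>R inc p0 p1 w) \<le> r \<and>
        norm (inc p0 p1 w + 1 *\<^sub>R inc p2 p3 w) \<le> 2 * r}"
  proof (rule finite_measure_mono)
    show "{w \<in> space M. norm (inc p0 p3 w) \<le> r \<and> norm (inc p1 p2 w) \<le> r} \<subseteq>
      {w \<in> space M. norm (inc p1 p2 w + 0 *\<^sub>R inc p0 p1 w) \<le> r \<and>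
        norm (inc p0 p1 w + 1 *\<^sub>R inc p2 p3 w) \<le> 2 * r}"
      using 3 by auto
  qed measurable
qed (use p r in auto)

end

section \<open>Sums of inverse square roots\<close>

lemma sum_inverse_sqrt_le: "(\<Sum>x<n. 1 / sqrt (real (x + 1))) \<le> 2 * sqrt (real n)"
proof (induction n)
  case (Suc n)
  let ?a = "sqrt (real n)" and ?b = "sqrt (real (n + 1))"
  \<comment> \<open>Each summand is at most an increment of \<open>2 * sqrt n\<close>, so the sum
    telescopes.\<close>
  have "?b - ?a \<ge> 1 / (2 * ?b)"
  proof -
    have "(?b - ?a) * (?b + ?a) = 1" by (simp add: algebra_simps real_sqrt_mult_self)
    then have "1 \<le> (?b - ?a) * (2 * ?b)"
      using mult_left_mono[of "?b + ?a" "2 * ?b" "?b - ?a"] by simp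
    then show ?thesis by (simp add: field_simps)
  qed
  then have "1 / ?b \<le> 2 * ?b - 2 * ?a" by (simp add: field_simps)
  then show ?case using Suc by simp
qed simp

lemma sum_inverse_sqrt_max_le:
  assumes "0 < L"
  shows "(\<Sum>d<L. 1 / sqrt (real (max 1 d))) \<le> 3 * sqrt (real L)"
proof -
  obtain K where K: "L = Suc K" using assms by (cases L) auto
  have "(\<Sum>d<L. 1 / sqrt (real (max 1 d))) = 1 + (\<Sum>d<K. 1 / sqrt (real (d + 1)))"
    unfolding K sum.lessThan_Suc_shift by (simp add: max_def add.commute cong: sum.cong_simp)
  also have "\<dots> \<le> 1 + 2 * sqrt (real K)" using sum_inverse_sqrt_le[of K] by simp
  also have "\<dots> \<le> sqrt (real L) + 2 * sqrt (real L)" unfolding K by (intro add_mono) auto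
  finally show ?thesis by simp
qed

text \<open>The part of the two-pair bound that belongs to one side of the midpoint: the first root
  is half of the overlap factor, the second comes from the outer increment between the two times on
  that side.\<close>

definition sqrt_weight :: "nat \<Rightarrow> nat \<Rightarrow> real" where
  "sqrt_weight x y = 1 / (sqrt (real (min x y + 1)) * sqrt (real (max 1 (max x y - min x y))))"

lemma sqrt_weight_commute: "sqrt_weight x y = sqrt_weight y x"
  by (simp add: sqrt_weight_def min.commute max.commute)

lemma sqrt_weight_nonneg: "0 \<le> sqrt_weight x y"
  by (simp add: sqrt_weight_def)

text \<open>Linear in \<open>L\<close>, with no logarithm, since each inverse square root sums to a
  multiple of \<open>sqrt L\<close>. The bound \<open>6 * L\<close> for ordered arguments is doubled
  for the other order.\<close>

lemma sum_sqrt_weight_le: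
  assumes "0 < L"
  shows "(\<Sum>x<L. \<Sum>y<L. sqrt_weight x y) \<le> 12 * real L"
proof -
  let ?h = "\<lambda>x y. if x \<le> y then 1 / (sqrt (real (x + 1)) * sqrt (real (max 1 (y - x)))) else 0"
  have h: "sqrt_weight x y \<le> ?h x y + ?h y x" for x y
    by (cases "x \<le> y") (auto simp: sqrt_weight_def max_def min_def)
  have inner: "(\<Sum>y<L. ?h x y) \<le> 1 / sqrt (real (x + 1)) * (3 * sqrt (real L))" if "x < L" for x
  proof -
    have "(\<Sum>y<L. ?h x y) = (\<Sum>y\<in>{x..<L}. 1 / (sqrt (real (x + 1)) * sqrt (real (max 1 (y - x)))))"
      by (rule sum.mono_neutral_cong_right) auto
    also have "\<dots> = (\<Sum>d<L - x. 1 / (sqrt (real (x + 1)) * sqrt (real (max 1 d))))"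
      by (rule sum.reindex_bij_witness[where i = "\<lambda>d. d + x" and j = "\<lambda>y. y - x"]) auto
    also have "\<dots> \<le> (\<Sum>d<L. 1 / (sqrt (real (x + 1)) * sqrt (real (max 1 d))))"
      by (rule sum_mono2) auto
    also have "\<dots> = 1 / sqrt (real (x + 1)) * (\<Sum>d<L. 1 / sqrt (real (max 1 d)))"
      by (simp add: sum_distrib_left)
    also have "\<dots> \<le> 1 / sqrt (real (x + 1)) * (3 * sqrt (real L))"
      using assms by (intro mult_left_mono sum_inverse_sqrt_max_le) auto
    finally show ?thesis .
  qed
  have "(\<Sum>x<L. \<Sum>y<L. ?h x y) \<le> (\<Sum>x<L. 1 / sqrt (real (x + 1)) * (3 * sqrt (real L)))"
    using inner by (intro sum_mono) auto
  also have "\<dots> = (\<Sum>x<L. 1 / sqrt (real (x + 1))) * (3 * sqrt (real L))"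
    by (simp add: sum_distrib_right)
  also have "\<dots> \<le> 2 * sqrt (real L) * (3 * sqrt (real L))"
    by (intro mult_right_mono sum_inverse_sqrt_le) auto
  also have "\<dots> = 6 * real L" by simp
  finally have A: "(\<Sum>x<L. \<Sum>y<L. ?h x y) \<le> 6 * real L" .
  have "(\<Sum>x<L. \<Sum>y<L. sqrt_weight x y) \<le> (\<Sum>x<L. \<Sum>y<L. ?h x y + ?h y x)"
    by (intro sum_mono h)
  also have "\<dots> = (\<Sum>x<L. \<Sum>y<L. ?h x y) + (\<Sum>x<L. \<Sum>y<L. ?h y x)"
    by (simp add: sum.distrib)
  also have "(\<Sum>x<L. \<Sum>y<L. ?h y x) = (\<Sum>x<L. \<Sum>y<L. ?h x y)"
    by (rule sum.swap)
  finally show ?thesis using A by linarith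
qed

context gaussian_walk begin

text \<open>Pairs of times on either side of \<open>A + L\<close>, indexed by their distance to it.\<close>

definition straddling :: "real \<Rightarrow> nat \<Rightarrow> nat \<Rightarrow> 'w \<Rightarrow> real" where
  "straddling r A L w = (\<Sum>x<L. \<Sum>y<L. of_bool (norm (inc (A + L - 1 - x) (A + L + y) w) \<le> r))"

lemma straddling_measurable [measurable]: "random_variable borel (straddling r A L)"
  unfolding straddling_def of_bool_def by measurable

lemma straddling_bounds: "0 \<le> straddling r A L w" "straddling r A L w \<le> (real L)\<^sup>2"
proof -
  show "0 \<le> straddling r A L w" unfolding straddling_def by (intro sum_nonneg) auto
  have "straddling r A L w \<le> (\<Sum>x<L. \<Sum>y<L. 1)" unfolding straddling_def by (intro sum_mono) auto
  then show "straddling r A L w \<le> (real L)\<^sup>2" by (simp add: power2_eq_square)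
qed

text \<open>Two time intervals around one midpoint always overlap, in a stretch of length
  \<open>min x x' + min y y' + 1\<close>; they either cross or are nested. The order of
  \<open>x\<close> and \<open>x'\<close> is free by symmetry.\<close>

lemma two_pairs_bound:
  assumes AL: "A + 2 * L \<le> N" and r: "0 \<le> r" "\<delta> \<le> r\<^sup>2"
    and x: "x < L" "x' < L" and y: "y < L" "y' < L"
  shows "prob {w \<in> space M. norm (inc (A + L - 1 - x) (A + L + y) w) \<le> r \<and> norm (inc (A + L - 1 - x') (A
      + L + y') w) \<le> r}
    \<le> (r\<^sup>2 / \<delta>)\<^sup>2 * (sqrt_weight x x' * sqrt_weight y y')"
proof -
  have main: "prob {w \<in> space M. norm (inc (A + L - 1 - x) (A + L + y) w)
      \<le> r \<and> norm (inc (A + L - 1 - x') (A + L + y') w) \<le> r}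
    \<le> (r\<^sup>2 / \<delta>)\<^sup>2 * (sqrt_weight x x' * sqrt_weight y y')"
    if x: "x < L" "x' \<le> x" and y: "y < L" "y' < L" for x x' y y'
  proof -
    let ?d = "sqrt (real (max 1 (x - x'))) * sqrt (real (max 1 (max y y' - min y y')))"
    let ?b = "real (x' + min y y' + 1)"
    let ?s = "A + L - 1 - x" and ?u = "A + L - 1 - x'"
    let ?P = "prob {w \<in> space M. norm (inc ?s (A + L + y) w) \<le> r \<and> norm (inc ?u (A + L + y') w) \<le> r}"
    have "?P \<le> (r\<^sup>2 / \<delta>)\<^sup>2 / (?b * ?d)"
    proof (cases "y \<le> y'")
      case True
      have "?P \<le> (r\<^sup>2 / \<delta>)\<^sup>2 / (real (A + L + y - ?u) * (sqrt (max 1 (?u - ?s)) * sqrt (max 1 (A + L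
          + y' - (A + L + y)))))"
        using x y True AL r by (intro crossing_bound) auto
      moreover have "A + L + y - ?u = x' + min y y' + 1" "?u - ?s = x - x'" "A + L + y' - (A + L + y)
          = max y y' - min y y'"
        using x y True by (auto simp: min_def max_def)
      ultimately show ?thesis by (simp only:)
    next
      case False
      have "?P \<le> (r\<^sup>2 / \<delta>)\<^sup>2 / (real (A + L + y' - ?u) * (sqrt (max 1 (?u - ?s)) * sqrt (max 1 (A + L
          + y - (A + L + y')))))"
        using x y False AL r by (intro nested_bound) auto
      moreover have "A + L + y' - ?u = x' + min y y' + 1" "?u - ?s = x - x'" "A + L + y - (A + L + y')
          = max y y' - min y y'"
        using x y False by (auto simp: min_def max_def)
      ultimately show ?thesis by (simp only:)
    qed
    \<comment> \<open>The inequality \<open>(a + 1) * (b + 1) \<le> (a + b + 1)\<^sup>2\<close>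
      splits the overlap length into a left and a right factor.\<close>
    also have "\<dots> \<le> (r\<^sup>2 / \<delta>)\<^sup>2 / (sqrt (real (x' + 1)) * sqrt (real (min y y' + 1)) * ?d)"
    proof (intro divide_left_mono mult_right_mono)
      let ?m = "min y y'"
      have "real (x' + 1) * real (?m + 1) \<le> (real (x' + ?m + 1))\<^sup>2"
        by (simp add: power2_eq_square algebra_simps)
      then have "sqrt (real (x' + 1) * real (?m + 1)) \<le> ?b"
        by (intro real_le_lsqrt) auto
      then show "sqrt (real (x' + 1)) * sqrt (real (?m + 1)) \<le> ?b" by (simp only: real_sqrt_mult)
    qed auto
    also have "\<dots> = (r\<^sup>2 / \<delta>)\<^sup>2 * (sqrt_weight x x' * sqrt_weight y y')"
      using x by (simp add: sqrt_weight_def min_absorb2 max_absorb1 divide_inverse mult_ac)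
    finally show ?thesis .
  qed
  show ?thesis
  proof (cases "x' \<le> x")
    case True
    then show ?thesis using main[of x x' y y'] x y by simp
  next
    case False
    then show ?thesis using main[of x' x y' y] x y by (simp add: sqrt_weight_commute conj_commute)
  qed
qed

text \<open>The fourfold sum factorises into one sum of weights for each side of the midpoint, which
  keeps the whole bound quadratic in \<open>L\<close>.\<close>

lemma straddling_second_moment:
  assumes AL: "A + 2 * L \<le> N" and L: "0 < L" and r: "0 \<le> r" "\<delta> \<le> r\<^sup>2"
  shows "expectation (\<lambda>w. (straddling r A L w)\<^sup>2) \<le> (12 * (r\<^sup>2 / \<delta>) * real L)\<^sup>2"
proof -
  let ?c = "\<lambda>x y w. norm (inc (A + L - 1 - x) (A + L + y) w) \<le> r"
  let ?E = "\<lambda>x y x' y'. {w \<in> space M. ?c x y w \<and> ?c x' y' w}"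
  have Em: "?E x y x' y' \<in> events" for x y x' y' by measurable
  have sq: "(straddling r A L w)\<^sup>2 = (\<Sum>x<L. \<Sum>x'<L. \<Sum>y<L. \<Sum>y'<L. indicator (?E x y x' y') w)"
    if "w \<in> space M" for w
  proof -
    have "(straddling r A L w)\<^sup>2 = (\<Sum>x<L. \<Sum>x'<L. (\<Sum>y<L. of_bool (?c x y w)) * (\<Sum>y'<L. of_bool
        (?c x' y' w)))"
      unfolding straddling_def power2_eq_square by (rule sum_product)
    also have "\<dots> = (\<Sum>x<L. \<Sum>x'<L. \<Sum>y<L. \<Sum>y'<L. of_bool (?c x y w) * of_bool (?c x' y' w))"
      by (simp only: sum_product)
    also have "\<dots> = (\<Sum>x<L. \<Sum>x'<L. \<Sum>y<L. \<Sum>y'<L. indicator (?E x y x' y') w)"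
      using that by (intro sum.cong refl) (auto simp: indicator_def)
    finally show ?thesis .
  qed
  have int: "integrable M (indicator (?E x y x' y') :: 'w \<Rightarrow> real)" for x y x' y'
    using Em by (intro integrable_real_indicator) (auto simp: emeasure_eq_measure)
  have "expectation (\<lambda>w. (straddling r A L w)\<^sup>2) = expectation (\<lambda>w. \<Sum>x<L. \<Sum>x'<L. \<Sum>y<L. \<Sum>y'<L. indicator
      (?E x y x' y') w)"
    by (intro Bochner_Integration.integral_cong refl sq)
  also have "\<dots> = (\<Sum>x<L. expectation (\<lambda>w. \<Sum>x'<L. \<Sum>y<L. \<Sum>y'<L. indicator (?E x y x' y') w))"
    by (intro Bochner_Integration.integral_sum Bochner_Integration.integrable_sum int)
  also have "\<dots> = (\<Sum>x<L. \<Sum>x'<L. expectation (\<lambda>w. \<Sum>y<L. \<Sum>y'<L. indicator (?E x y x' y') w))"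
    by (intro sum.cong refl Bochner_Integration.integral_sum Bochner_Integration.integrable_sum int)
  also have "\<dots> = (\<Sum>x<L. \<Sum>x'<L. \<Sum>y<L. expectation (\<lambda>w. \<Sum>y'<L. indicator (?E x y x' y') w))"
    by (intro sum.cong refl Bochner_Integration.integral_sum Bochner_Integration.integrable_sum int)
  also have "\<dots> = (\<Sum>x<L. \<Sum>x'<L. \<Sum>y<L. \<Sum>y'<L. expectation (indicator (?E x y x' y')))"
    by (intro sum.cong refl Bochner_Integration.integral_sum Bochner_Integration.integrable_sum int)
  also have "\<dots> = (\<Sum>x<L. \<Sum>x'<L. \<Sum>y<L. \<Sum>y'<L. prob (?E x y x' y'))"
    by (intro sum.cong refl) (auto simp: Int_absorb1)
  also have "\<dots> \<le> (\<Sum>x<L. \<Sum>x'<L. \<Sum>y<L. \<Sum>y'<L. (r\<^sup>2 / \<delta>)\<^sup>2 * (sqrt_weight x x' * sqrt_weight y y'))"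
    by (intro sum_mono two_pairs_bound AL r) auto
  also have "\<dots> = (r\<^sup>2 / \<delta>)\<^sup>2 * ((\<Sum>x<L. \<Sum>x'<L. sqrt_weight x x') * (\<Sum>y<L. \<Sum>y'<L. sqrt_weight y y'))"
  proof -
    have 1: "(\<Sum>y<L. \<Sum>y'<L. c * (a * sqrt_weight y y')) = c * (a * (\<Sum>y<L. \<Sum>y'<L. sqrt_weight y y'))" for a c
      by (simp only: sum_distrib_left)
    have 2: "(\<Sum>x<L. \<Sum>x'<L. c * (sqrt_weight x x' * S)) = c * ((\<Sum>x<L. \<Sum>x'<L. sqrt_weight x x') * S)" for c S
      by (simp only: sum_distrib_left sum_distrib_right)
    show ?thesis by (simp only: 1 2)
  qed
  also have "\<dots> \<le> (r\<^sup>2 / \<delta>)\<^sup>2 * ((12 * real L) * (12 * real L))"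
    by (intro mult_left_mono mult_mono sum_sqrt_weight_le L sum_nonneg sqrt_weight_nonneg) auto
  also have "\<dots> = (12 * (r\<^sup>2 / \<delta>) * real L)\<^sup>2" by (simp add: power2_eq_square)
  finally show ?thesis .
qed

lemma block_le:
  fixes b n c T :: nat
  assumes "b < n" "n * c \<le> T"
  shows "b * c + c \<le> T"
proof -
  have "Suc b * c \<le> n * c" using assms by (intro mult_right_mono) auto
  then show ?thesis using assms by simp
qed

lemma disjoint_blocks: "disjoint_family_on (\<lambda>b::nat. {b * c..<b * c + c}) S"
proof (unfold disjoint_family_on_def, intro ballI impI)
  fix a b :: nat assume ab: "a \<noteq> b"
  have "Suc a * c \<le> b * c" if "a < b" for a b using that by (intro mult_right_mono) auto
  then show "{a * c..<a * c + c} \<inter> {b * c..<b * c + c} = {}"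
    using ab by (cases a b rule: linorder_cases) (auto, force+)
qed

lemma indep_vars_of_blocks:
  assumes K: "\<And>b. b < n \<Longrightarrow> K b \<subseteq> {..<N}" "disjoint_family_on K {..<n}"
    and f: "\<And>b. b < n \<Longrightarrow> f b \<in> borel_measurable (PiM (K b) (\<lambda>_. borel))"
    and Z: "\<And>b w. b < n \<Longrightarrow> Z b w = f b (\<lambda>l\<in>K b. X l w)"
  shows "indep_vars (\<lambda>_. borel) Z {..<n}"
proof -
  have "indep_vars (\<lambda>_. borel) (\<lambda>b w. f b (\<lambda>l\<in>K b. X l w)) {..<n}"
    by (rule indep_vars_compose2[OF indep_vars_restrict[OF indep]]) (use K f in auto)
  then show ?thesis
    by (subst indep_vars_cong[where Y = "\<lambda>b w. f b (\<lambda>l\<in>K b. X l w)"]) (auto simp: Z fun_eq_iff)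
qed

text \<open>Counts around different midpoints of one level use disjoint sets of steps and are
  therefore independent, although counts of different levels are not.\<close>

lemma straddling_level_tail:
  assumes N: "n * (2 * L) \<le> N" and L: "0 < L" and r: "0 \<le> r" "\<delta> \<le> r\<^sup>2" and l: "0 < l"
  shows "prob {w \<in> space M. real n * (12 * (r\<^sup>2 / \<delta>) * real L) + l \<le> (\<Sum>b<n. straddling r (b * (2 * L)) L w)}
    \<le> real n * (12 * (r\<^sup>2 / \<delta>) * real L)\<^sup>2 / l\<^sup>2"
proof (rule indep_sum_tail)
  note bN = block_le[OF _ N]
  show "indep_vars (\<lambda>_. borel) (\<lambda>b. straddling r (b * (2 * L)) L) {..<n}"
  proof (rule indep_vars_of_blocks)
    let ?K = "\<lambda>b. {b * (2 * L)..<b * (2 * L) + 2 * L}"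
    let ?f = "\<lambda>b x. \<Sum>i<L. \<Sum>j<L. of_bool (norm (\<Sum>l\<in>{b * (2 * L) + L - 1 - i..<b * (2 * L) + L
        + j}. x l :: real^2) \<le> r) :: real"
    show "?K b \<subseteq> {..<N}" if "b < n" for b using bN[OF that] by auto
    show "disjoint_family_on ?K {..<n}" by (rule disjoint_blocks)
    show "?f b \<in> borel_measurable (PiM (?K b) (\<lambda>_. borel))" if "b < n" for b
    proof (intro borel_measurable_sum)
      fix i j assume "i \<in> {..<L}" "j \<in> {..<L}"
      then have [measurable]: "(\<lambda>x. \<Sum>l\<in>{b * (2 * L) + L - 1 - i..<b * (2 * L) + L
          + j}. x l) \<in> measurable (PiM (?K b) (\<lambda>_. borel)) (borel :: (real^2) measure)"
        by (intro partial_sum_measurable) auto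
      show "(\<lambda>x. of_bool (norm (\<Sum>l\<in>{b * (2 * L) + L - 1 - i..<b * (2 * L) + L + j}. x l :: real^2)
          \<le> r) :: real) \<in> borel_measurable (PiM (?K b) (\<lambda>_. borel))"
        unfolding of_bool_def by measurable
    qed
    show "straddling r (b * (2 * L)) L w = ?f b (\<lambda>l\<in>?K b. X l w)" if "b < n" for b w
      unfolding straddling_def by (intro sum.cong refl) (subst inc_restrict, auto)
  qed
  show "\<bar>straddling r (i * (2 * L)) L w\<bar> \<le> (real L)\<^sup>2" for i w
    using straddling_bounds[of r "i * (2 * L)" L w] by simp
  show "expectation (\<lambda>w. (straddling r (i * (2 * L)) L w)\<^sup>2) \<le> (12 * (r\<^sup>2 / \<delta>) * real L)\<^sup>2" if "i < n" for i
    using bN[OF that] by (intro straddling_second_moment L r)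
qed (use l step_pos in auto)


section \<open>All close pairs, by dyadic levels\<close>

definition close_pairs :: "real \<Rightarrow> nat \<Rightarrow> nat \<Rightarrow> 'w \<Rightarrow> real" where
  "close_pairs r A h w = (\<Sum>s\<in>{A..<A+h}. \<Sum>t\<in>{A..<A+h}. of_bool (norm (inc 0 s w - inc 0 t w) \<le> r))"

lemma close_pairs_measurable [measurable]: "random_variable borel (close_pairs r A h)"
  unfolding close_pairs_def of_bool_def by measurable

lemma close_pairs_le: "close_pairs r A h w \<le> (real h)\<^sup>2"
proof -
  have "close_pairs r A h w \<le> (\<Sum>s\<in>{A..<A+h}. \<Sum>t\<in>{A..<A+h}. 1)"
    unfolding close_pairs_def by (intro sum_mono) auto
  then show ?thesis by (simp add: power2_eq_square)
qed

lemma close_pairs_double: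
  "close_pairs r A (2 * L) w = close_pairs r A L w + close_pairs r (A + L) L w + 2 * straddling r A L w"
proof -
  let ?c = "\<lambda>s t. of_bool (norm (inc 0 s w - inc 0 t w) \<le> r) :: real"
  have split: "(\<Sum>t\<in>{A..<A+2*L}. g t) = (\<Sum>t\<in>{A..<A+L}. g t) + (\<Sum>t\<in>{A+L..<A+L+L}. g t)" for g :: "nat \<Rightarrow> real"
    using sum.atLeastLessThan_concat[of A "A+L" "A+L+L" g] by (simp add: mult_2 add.assoc)
  have "(\<Sum>s\<in>{A..<A+L}. \<Sum>t\<in>{A+L..<A+L+L}. ?c s t) = (\<Sum>x<L. \<Sum>t\<in>{A+L..<A+L+L}. ?c (A + L - 1 - x) t)"
    by (rule sum.reindex_bij_witness[where i = "\<lambda>x. A + L - 1 - x" and j = "\<lambda>s. A + L - 1 - s"]) auto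
  also have "\<dots> = (\<Sum>x<L. \<Sum>y<L. ?c (A + L - 1 - x) (A + L + y))"
    by (intro sum.cong refl sum.reindex_bij_witness[where i = "\<lambda>y. A + L + y" and j
        = "\<lambda>t. t - (A + L)"]) auto
  also have "\<dots> = straddling r A L w"
    unfolding straddling_def
  proof (intro sum.cong refl)
    fix x y assume "x \<in> {..<L}" "y \<in> {..<L}"
    then have "inc 0 (A + L - 1 - x) w + inc (A + L - 1 - x) (A + L + y) w = inc 0 (A + L + y) w"
      by (intro inc_add) auto
    then have "norm (inc 0 (A + L - 1 - x) w - inc 0 (A + L + y) w) = norm (inc (A + L - 1 - x) (A + L
        + y) w)"
      by (metis add_diff_cancel_left' norm_minus_commute)
    then show "?c (A + L - 1 - x) (A + L + y) = of_bool (norm (inc (A + L - 1 - x) (A + L + y) w) \<le> r)"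
      by simp
  qed
  finally have up: "(\<Sum>s\<in>{A..<A+L}. \<Sum>t\<in>{A+L..<A+L+L}. ?c s t) = straddling r A L w" .
  have "(\<Sum>s\<in>{A+L..<A+L+L}. \<Sum>t\<in>{A..<A+L}. ?c s t) = (\<Sum>t\<in>{A..<A+L}. \<Sum>s\<in>{A+L..<A+L+L}. ?c s t)"
    by (rule sum.swap)
  also have "\<dots> = straddling r A L w" unfolding up[symmetric] by (simp only: norm_minus_commute)
  finally have low: "(\<Sum>s\<in>{A+L..<A+L+L}. \<Sum>t\<in>{A..<A+L}. ?c s t) = straddling r A L w" .
  show ?thesis
    unfolding close_pairs_def split sum.distrib using up low by simp
qed

lemma sum_even_odd: "(\<Sum>b<2 * n. f b) = (\<Sum>b<n. f (2 * b) + f (2 * b + 1))" for f :: "nat \<Rightarrow> real"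
  by (induction n) auto

text \<open>Repeated halving: level \<open>j\<close> has \<open>2^j\<close> midpoints, each close
  pair is counted at the level that separates it, in both orders, and the pairs left after
  \<open>i\<close> halvings lie in a common block of length \<open>h\<close>.\<close>

lemma close_pairs_dyadic:
  "close_pairs r 0 (2 ^ i * h) w = (\<Sum>b<2 ^ i. close_pairs r (b * h) h w) +
    2 * (\<Sum>j<i. \<Sum>b<2 ^ j. straddling r (b * (2 * (2 ^ (i - j - 1) * h))) (2 ^ (i - j - 1) * h) w)"
proof (induction i arbitrary: h)
  case (Suc i)
  have e: "2 ^ (i - j - 1) * (2 * h) = 2 ^ (Suc i - j - 1) * h" if "j < i" for j
  proof -
    have "Suc i - j - 1 = Suc (i - j - 1)" using that by simp
    then show ?thesis by simp
  qed
  have "close_pairs r 0 (2 ^ Suc i * h) w = close_pairs r 0 (2 ^ i * (2 * h)) w" by (simp add: mult_ac)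
  also have "\<dots> = (\<Sum>b<2 ^ i. close_pairs r (b * (2 * h)) (2 * h) w) +
    2 * (\<Sum>j<i. \<Sum>b<2 ^ j. straddling r (b * (2 * (2 ^ (i - j - 1) * (2 * h)))) (2 ^ (i - j - 1) * (2
        * h)) w)"
    by (rule Suc.IH)
  also have "(\<Sum>j<i. \<Sum>b<2 ^ j. straddling r (b * (2 * (2 ^ (i - j - 1) * (2 * h)))) (2 ^ (i - j - 1) * (2
      * h)) w)
     = (\<Sum>j<i. \<Sum>b<2 ^ j. straddling r (b * (2 * (2 ^ (Suc i - j - 1) * h))) (2 ^ (Suc i - j - 1) * h) w)"
    by (intro sum.cong refl) (simp only: e lessThan_iff)
  also have "(\<Sum>b<2 ^ i. close_pairs r (b * (2 * h)) (2 * h) w) =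
     (\<Sum>b<2 ^ i. close_pairs r (2 * b * h) h w + close_pairs r ((2 * b + 1) * h) h w) + 2 *
         (\<Sum>b<2 ^ i. straddling r (b * (2 * h)) h w)"
    unfolding close_pairs_double sum.distrib sum_distrib_left by (simp add: algebra_simps)
  also have "(\<Sum>b<2 ^ i. close_pairs r (2 * b * h) h w + close_pairs r ((2 * b + 1) * h) h w)
      = (\<Sum>b<2 ^ Suc i. close_pairs r (b * h) h w)"
    by (simp only: power_Suc sum_even_odd)
  finally show ?case by simp
qed simp

text \<open>Each of the \<open>2 * k\<close> levels is allowed \<open>6 * q * n\<close> plus an
  excess \<open>lam j\<close>, and the excesses sum to at most \<open>10 * k * q * n\<close>.
  Doubling \<open>12 + 10\<close> for ordered pairs and adding the pairs inside the smallest blocks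
  gives \<open>45\<close>.\<close>

lemma close_pairs_tail:
  assumes N: "N = 2 ^ m" and \<delta>: "\<delta> = 1 / 2 ^ m" and k: "0 < k" "2 * k \<le> m"
  shows "prob {w \<in> space M. 45 * real k * 4 ^ m / 4 ^ k < close_pairs (1 / 2 ^ k) 0 (2 ^ m) w}
      \<le> 100 / (real k)\<^sup>2"
proof -
  \<comment> \<open>The number of steps in time \<open>4^-k\<close>, during which the walk typically
    travels \<open>r\<close>; inside blocks of this length all pairs are counted as close.\<close>
  define h :: nat where "h = 2 ^ (m - 2 * k)"
  define i where "i = 2 * k"
  define r :: real where "r = 1 / 2 ^ k"
  define n :: real where "n = 2 ^ m"
  define q where "q = r\<^sup>2 / \<delta>"
  define L :: "nat \<Rightarrow> nat" where "L j = 2 ^ (i - j - 1) * h" for j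
  define Xl where "Xl j w = (\<Sum>b<2 ^ j. straddling r (b * (2 * L j)) (L j) w)" for j w
  \<comment> \<open>The ratio \<open>9/10\<close> lies between \<open>1 / sqrt 2\<close> and
    \<open>1\<close>. So the excesses are summable, and so are the failure probabilities, whose
    ratio is \<open>1 / (2 * (9/10)\<^sup>2) = 50/81\<close>.\<close>
  define lam where "lam j = real k * q * n * (9/10) ^ j" for j
  define Bad where "Bad j = {w \<in> space M. real (2 ^ j) * (12 * q * real (L j)) + lam j \<le> Xl j w}" for j
  have ih: "2 ^ i * h = 2 ^ m" using k by (simp add: i_def h_def flip: power_add)
  have r2: "r\<^sup>2 = 1 / 4 ^ k" by (simp add: r_def power_divide flip: power_mult power2_eq_square)
      (simp add: power_mult mult.commute[of k])
  have hq: "real h = q"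
  proof -
    have "(2::real) ^ m = 2 ^ (2 * k) * 2 ^ (m - 2 * k)" using k by (simp flip: power_add)
    then have "(2::real) ^ m = 4 ^ k * real h" by (simp add: h_def power_mult)
    then show ?thesis by (simp add: q_def r2 \<delta>)
  qed
  have q1: "1 \<le> q" unfolding hq[symmetric] h_def by simp
  have r\<delta>: "\<delta> \<le> r\<^sup>2" using q1 step_pos by (simp add: q_def field_simps)
  have n0: "0 < n" by (simp add: n_def)
  have jL: "2 ^ j * (2 * L j) = 2 ^ m" if "j < i" for j
  proof -
    have "2 ^ j * (2 * L j) = 2 ^ (j + Suc (i - j - 1)) * h" by (simp add: L_def power_add)
    also have "j + Suc (i - j - 1) = i" using that by simp
    finally show ?thesis using ih by simp
  qed
  have jLr: "2 ^ j * (2 * real (L j)) = n" if "j < i" for j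
    using arg_cong[OF jL[OF that], of real] by (simp add: n_def)
  have L0: "0 < L j" for j by (simp add: L_def h_def)
  have lam0: "0 < lam j" for j using k q1 n0 by (simp add: lam_def)
  have bad: "prob (Bad j) \<le> 36 / (real k)\<^sup>2 * (50/81) ^ j" if "j < i" for j
  proof -
    have "prob (Bad j) \<le> real (2 ^ j) * (12 * q * real (L j))\<^sup>2 / (lam j)\<^sup>2"
      unfolding Bad_def Xl_def q_def using jL[OF that] L0 lam0[of j] r\<delta> N
      by (intro straddling_level_tail) (auto simp: r_def)
    also have "real (2 ^ j) * (12 * q * real (L j))\<^sup>2 = 36 * q\<^sup>2 * n\<^sup>2 / 2 ^ j"
      unfolding jLr[OF that, symmetric] by (simp add: power2_eq_square)
    also have "36 * q\<^sup>2 * n\<^sup>2 / 2 ^ j / (lam j)\<^sup>2 = 36 / (real k)\<^sup>2 * (1 / (2 ^ j * ((9/10) ^ j)\<^sup>2))"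
      using q1 n0 k by (simp add: lam_def power_mult_distrib field_simps)
    also have "1 / (2 ^ j * ((9/10) ^ j)\<^sup>2) = (50/81 :: real) ^ j"
    proof -
      have "(2 ^ j * ((9/10) ^ j)\<^sup>2 :: real) = (2 * (9/10) * (9/10)) ^ j"
        by (simp only: power_mult_distrib power2_eq_square mult.assoc)
      also have "\<dots> = (81/50) ^ j" by simp
      finally show ?thesis by (simp add: power_divide)
    qed
    finally show ?thesis .
  qed
  have sub: "{w \<in> space M. 45 * real k * 4 ^ m / 4 ^ k < close_pairs r 0 (2 ^ m) w} \<subseteq> (\<Union>j<i. Bad j)"
  proof (rule ccontr)
    assume "\<not> ?thesis"
    then obtain w where w: "w \<in> space M" "45 * real k * 4 ^ m / 4 ^ k < close_pairs r 0 (2 ^ m) w"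
        and good: "\<And>j. j < i \<Longrightarrow> w \<notin> Bad j"
      by auto
    have qn: "4 ^ m / 4 ^ k = q * n"
    proof -
      have "(4::real) ^ m = 2 ^ m * 2 ^ m" by (simp add: power_mult_distrib[symmetric])
      then show ?thesis by (simp add: q_def r2 \<delta> n_def)
    qed
    have "(\<Sum>j<i. Xl j w) \<le> (\<Sum>j<i. 6 * q * n + lam j)"
    proof (rule sum_mono)
      fix j assume "j \<in> {..<i}"
      then have j: "j < i" by simp
      have "Xl j w < 2 ^ j * (12 * q * real (L j)) + lam j"
        using good[OF j] w(1) by (auto simp: Bad_def)
      also have "2 ^ j * (12 * q * real (L j)) = 6 * q * n" unfolding jLr[OF j, symmetric] by simp
      finally show "Xl j w \<le> 6 * q * n + lam j" by simp
    qed
    also have "\<dots> = real i * (6 * q * n) + real k * q * n * (\<Sum>j<i. (9/10) ^ j)"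
      by (simp add: sum.distrib lam_def sum_distrib_left)
    also have "\<dots> \<le> real i * (6 * q * n) + real k * q * n * 10"
    proof (intro add_left_mono mult_left_mono)
      have "(\<Sum>j<i. (9/10::real) ^ j) = (1 - (9/10) ^ i) / (1 - 9/10)" by (simp add: sum_gp_strict)
      also have "\<dots> \<le> 10" by simp
      finally show "(\<Sum>j<i. (9/10::real) ^ j) \<le> 10" .
    qed (use q1 n0 in auto)
    finally have 1: "(\<Sum>j<i. Xl j w) \<le> 22 * real k * q * n" by (simp add: i_def algebra_simps)
    have "(\<Sum>b<2 ^ i. close_pairs r (b * h) h w) \<le> (\<Sum>b<2 ^ i::nat. q * q)"
      using close_pairs_le[of r _ h w] unfolding hq power2_eq_square by (intro sum_mono) auto
    also have "\<dots> = real (2 ^ i * h) * q" by (simp add: hq)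
    also have "\<dots> = q * n" by (simp only: ih) (simp add: n_def)
    also have "\<dots> \<le> real k * (q * n)" using k q1 n0 by simp
    finally have 2: "(\<Sum>b<2 ^ i. close_pairs r (b * h) h w) \<le> real k * q * n" by simp
    have "close_pairs r 0 (2 ^ i * h) w = (\<Sum>b<2 ^ i. close_pairs r (b * h) h w) + 2 * (\<Sum>j<i. Xl j w)"
      unfolding close_pairs_dyadic Xl_def L_def ..
    also have "\<dots> \<le> 45 * (real k * q * n)" using 1 2 by linarith
    also have "\<dots> = 45 * real k * 4 ^ m / 4 ^ k" using qn
        by (simp add: mult.assoc flip: times_divide_eq_right)
    finally show False using w ih by simp
  qed
  have Badm: "Bad j \<in> events" for j unfolding Bad_def Xl_def by measurable
  have "prob {w \<in> space M. 45 * real k * 4 ^ m / 4 ^ k < close_pairs r 0 (2 ^ m) w} \<le> prob (\<Union>j<i. Bad j)"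
    using Badm by (intro finite_measure_mono sub sets.finite_UN) auto
  also have "\<dots> \<le> (\<Sum>j<i. prob (Bad j))"
    using Badm by (intro finite_measure_subadditive_finite) auto
  also have "\<dots> \<le> (\<Sum>j<i. 36 / (real k)\<^sup>2 * (50/81) ^ j)" using bad by (intro sum_mono) auto
  also have "\<dots> = 36 / (real k)\<^sup>2 * ((1 - (50/81) ^ i) / (1 - 50/81))"
    unfolding sum_distrib_left[symmetric] by (subst sum_gp_strict) simp
  also have "\<dots> \<le> 36 / (real k)\<^sup>2 * (100 / 36)"
  proof -
    have *: "(1 - t) / (1 - 50/81) \<le> 100 / 36" if "0 \<le> t" for t :: real using that by simp
    show ?thesis by (intro mult_left_mono * zero_le_power) auto
  qed
  also have "\<dots> = 100 / (real k)\<^sup>2" by simp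
  finally show ?thesis by (simp add: r_def)
qed

end

section \<open>Area of the neighbourhood of a planar Gaussian random walk\<close>

context gaussian_walk begin

text \<open>The window may start at \<open>a > 0\<close> because after a first hit only the
  remaining times count.\<close>

definition hits :: "real \<Rightarrow> nat \<Rightarrow> nat \<Rightarrow> real^2 \<Rightarrow> 'w \<Rightarrow> bool" where
  "hits r a n x w \<longleftrightarrow> (\<exists>i\<in>{a..n}. norm (inc 0 i w - x) \<le> r)"

definition first_hit :: "real \<Rightarrow> nat \<Rightarrow> nat \<Rightarrow> real^2 \<Rightarrow> 'w \<Rightarrow> bool" where
  "first_hit r a i x w \<longleftrightarrow> norm (inc 0 i w - x) \<le> r \<and> (\<forall>j\<in>{a..<i}. \<not> norm (inc 0 j w - x) \<le> r)"

definition sausage :: "real \<Rightarrow> nat \<Rightarrow> nat \<Rightarrow> 'w \<Rightarrow> ennreal" where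
  "sausage r a n w = (\<integral>\<^sup>+x. of_bool (hits r a n x w) \<partial>lborel)"

lemma hits_measurable [measurable]:
  "Measurable.pred (lborel \<Otimes>\<^sub>M M) (\<lambda>(x, w). hits r a n x w)"
  unfolding hits_def by measurable

lemma first_hit_measurable [measurable]:
  "Measurable.pred (lborel \<Otimes>\<^sub>M M) (\<lambda>(x, w). first_hit r a n x w)"
  unfolding first_hit_def by measurable

lemma of_bool_measurable: "Measurable.pred L P \<Longrightarrow> (\<lambda>z. of_bool (P z) :: ennreal) \<in> borel_measurable L"
  unfolding of_bool_def by measurable

lemma hits_of_bool_measurable [measurable]:
  "(\<lambda>(x, w). of_bool (hits r a n x w) :: ennreal) \<in> borel_measurable (lborel \<Otimes>\<^sub>M M)"
  using of_bool_measurable[OF hits_measurable] by (simp add: case_prod_unfold)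

lemma first_hit_of_bool_measurable [measurable]:
  "(\<lambda>(x, w). of_bool (first_hit r a n x w) :: ennreal) \<in> borel_measurable (lborel \<Otimes>\<^sub>M M)"
  using of_bool_measurable[OF first_hit_measurable] by (simp add: case_prod_unfold)

lemma sausage_measurable [measurable]: "random_variable borel (sausage r a n)"
  unfolding sausage_def by measurable

text \<open>First hits at different times exclude each other. This turns a hitting probability into
  a sum of events that are each independent of the later steps.\<close>

lemma sum_first_hit:
  "(\<Sum>i\<in>{a..n}. of_bool (first_hit r a i x w)) = (of_bool (hits r a n x w) :: ennreal)"
proof (cases "hits r a n x w")
  case True
  define i where "i = (LEAST i. a \<le> i \<and> norm (inc 0 i w - x) \<le> r)"
  obtain i0 where i0: "a \<le> i0" "i0 \<le> n" "norm (inc 0 i0 w - x) \<le> r" using True by (auto simp: hits_def)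
  have i: "a \<le> i" "norm (inc 0 i w - x) \<le> r" and "i \<le> i0"
    using LeastI[of "\<lambda>i. a \<le> i \<and> norm (inc 0 i w - x) \<le> r" i0] Least_le[of "\<lambda>i. a
        \<le> i \<and> norm (inc 0 i w - x) \<le> r" i0] i0
    by (auto simp: i_def)
  have before: "\<not> norm (inc 0 j w - x) \<le> r" if "a \<le> j" "j < i" for j
    using not_less_Least[of j "\<lambda>i. a \<le> i \<and> norm (inc 0 i w - x) \<le> r"] that by (auto simp: i_def)
  have fh: "first_hit r a j x w \<longleftrightarrow> j = i" if "a \<le> j" for j
    using i before that by (cases j i rule: linorder_cases) (auto simp: first_hit_def)
  have "(\<Sum>j\<in>{a..n}. of_bool (first_hit r a j x w)) = (\<Sum>j\<in>{a..n}. if j = i then 1 else (0::ennreal))"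
    by (intro sum.cong) (auto simp: fh)
  then show ?thesis using True i \<open>i \<le> i0\<close> i0 by simp
next
  case False
  then show ?thesis by (auto simp: hits_def first_hit_def intro!: sum.neutral)
qed

lemma expectation_sausage:
  "(\<integral>\<^sup>+w. sausage r a n w \<partial>M) = (\<integral>\<^sup>+x. (\<integral>\<^sup>+w. of_bool (hits r a n x w) \<partial>M) \<partial>lborel)"
proof -
  interpret lM: pair_sigma_finite lborel M ..
  show ?thesis unfolding sausage_def by (rule lM.Fubini') measurable
qed

text \<open>A first hit at time \<open>i\<close> is decided by the steps before
  \<open>i\<close>.\<close>

lemma first_hit_indep:
  assumes i: "i \<le> j" "j \<le> N" and [measurable]: "g \<in> borel_measurable (PiM {i..<j} (\<lambda>_. borel))"
  shows "(\<integral>\<^sup>+w. of_bool (first_hit r a i x w) * g (\<lambda>l\<in>{i..<j}. X l w) \<partial>M) =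
    (\<integral>\<^sup>+w. of_bool (first_hit r a i x w) \<partial>M) * (\<integral>\<^sup>+w. g (\<lambda>l\<in>{i..<j}. X l w) \<partial>M)"
proof -
  let ?S = "PiM {0..<i} (\<lambda>_. borel) :: (nat \<Rightarrow> real^2) measure"
  let ?f = "\<lambda>y. of_bool (norm ((\<Sum>l\<in>{0..<i}. y l) - x) \<le> r \<and> (\<forall>j\<in>{a..<i}. \<not> norm ((\<Sum>l\<in>{0..<j}. y l) - x)
      \<le> r)) :: ennreal"
  have ind: "indep_var ?S (\<lambda>w. \<lambda>l\<in>{0..<i}. X l w) (PiM {i..<j} (\<lambda>_. borel)) (\<lambda>w. \<lambda>l\<in>{i..<j}. X l w)"
    using i by (intro indep_var_restrict[OF indep]) auto
  have [measurable]: "(\<lambda>y. \<Sum>l\<in>{0..<k}. y l) \<in> borel_measurable ?S" if "k \<in> {a..<i}" for k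
    using that by (intro partial_sum_measurable) auto
  have [measurable]: "(\<lambda>y. \<Sum>l\<in>{0..<i}. y l) \<in> borel_measurable ?S"
    by (intro partial_sum_measurable) auto
  have f: "?f \<in> borel_measurable ?S"
    by (intro of_bool_measurable) measurable
  have eq: "of_bool (first_hit r a i x w) = ?f (\<lambda>l\<in>{0..<i}. X l w)" for w
  proof -
    have "(\<Sum>l\<in>{0..<k}. (\<lambda>l\<in>{0..<i}. X l w) l) = inc 0 k w" if "k \<le> i" for k
      using that by (intro inc_restrict) auto
    then show ?thesis by (simp add: first_hit_def del: restrict_apply)
  qed
  show ?thesis
    unfolding eq by (rule indep_var_nn_integral_mult[OF ind f]) measurable
qed

text \<open>After its first hit of \<open>x\<close> at a time \<open>i\<close> the walk is close to \<open>x\<close> whenever its later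
  increment is small, and that increment is independent of the hit.\<close>

lemma expectation_sausage_le:
  assumes N: "2 * n \<le> N" and a: "a \<le> n" and r: "0 \<le> r"
    and G: "\<And>i. i \<le> n \<Longrightarrow> ennreal G \<le> (\<Sum>l\<le>n. emeasure M {w\<in>space M. norm (inc i (i + l) w) \<le> r})"
  shows "(\<integral>\<^sup>+w. sausage r a n w \<partial>M) * ennreal G \<le> ennreal (real (2 * n + 1) * (pi * (2 * r)\<^sup>2))"
proof -
  interpret lM: pair_sigma_finite lborel M ..
  let ?F = "\<lambda>i x w. of_bool (first_hit r a i x w) :: ennreal"
  let ?C = "\<lambda>i l w. of_bool (norm (inc i (i + l) w) \<le> r) :: ennreal"
  let ?D = "\<lambda>j x w. of_bool (norm (inc 0 j w - x) \<le> 2 * r) :: ennreal"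
  have [measurable]: "random_variable borel (?F i x)" for i x
    unfolding first_hit_def of_bool_def by measurable
  have [measurable]: "random_variable borel (?C i l)" for i l
    unfolding of_bool_def by measurable
  \<comment> \<open>A first hit at \<open>i\<close> is followed, on average, by at least
    \<open>G\<close> times up to \<open>i + n\<close> at which the walk is still within
    \<open>2 * r\<close> of \<open>x\<close>. So the hitting probability times \<open>G\<close> is
    at most the expected number of visits up to time \<open>2 * n\<close>.\<close>
  have pt: "(\<integral>\<^sup>+w. of_bool (hits r a n x w) \<partial>M) * ennreal G \<le> (\<integral>\<^sup>+w. (\<Sum>j\<le>2 * n. ?D j x w) \<partial>M)" for x
  proof -
    have hit: "(\<integral>\<^sup>+w. of_bool (hits r a n x w) \<partial>M) = (\<Sum>i\<in>{a..n}. \<integral>\<^sup>+w. ?F i x w \<partial>M)"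
      unfolding sum_first_hit[symmetric] by (rule nn_integral_sum) measurable
    have "(\<integral>\<^sup>+w. of_bool (hits r a n x w) \<partial>M) * ennreal G
      \<le> (\<Sum>i\<in>{a..n}. (\<integral>\<^sup>+w. ?F i x w \<partial>M) * (\<Sum>l\<le>n. \<integral>\<^sup>+w. ?C i l w \<partial>M))"
      unfolding hit sum_distrib_right
    proof (intro sum_mono mult_left_mono)
      fix i assume "i \<in> {a..n}"
      have "(\<integral>\<^sup>+w. ?C i l w \<partial>M) = emeasure M {w\<in>space M. norm (inc i (i + l) w) \<le> r}" for l
      proof -
        have "(\<integral>\<^sup>+w. ?C i l w \<partial>M) = (\<integral>\<^sup>+w. indicator {w\<in>space M. norm (inc i (i + l) w) \<le> r} w \<partial>M)"
          by (intro nn_integral_cong) (simp add: indicator_def)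
        then show ?thesis by simp
      qed
      then show "ennreal G \<le> (\<Sum>l\<le>n. \<integral>\<^sup>+w. ?C i l w \<partial>M)"
        using G[of i] \<open>i \<in> {a..n}\<close> by simp
    qed simp
    also have "\<dots> = (\<Sum>i\<in>{a..n}. \<Sum>l\<le>n. \<integral>\<^sup>+w. ?F i x w * ?C i l w \<partial>M)"
      unfolding sum_distrib_left
    proof (intro sum.cong refl)
      fix i l assume il: "i \<in> {a..n}" "l \<in> {..n}"
      have [measurable]: "(\<lambda>y. \<Sum>l\<in>{i..<i+l}. y l) \<in> borel_measurable (PiM {i..<i+l} (\<lambda>_. borel ::
          (real^2) measure))"
        by (intro partial_sum_measurable) auto
      have "(\<integral>\<^sup>+w. ?F i x w * (\<lambda>y. of_bool (norm (\<Sum>l\<in>{i..<i+l}. y l) \<le> r)) (\<lambda>l\<in>{i..<i+l}. X l w) \<partial>M) =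
        (\<integral>\<^sup>+w. ?F i x w \<partial>M) * (\<integral>\<^sup>+w. (\<lambda>y. of_bool (norm (\<Sum>l\<in>{i..<i+l}. y l) \<le> r)) (\<lambda>l\<in>{i..<i+l}. X l w) \<partial>M)"
        using il N by (intro first_hit_indep of_bool_measurable) auto
      then show "(\<integral>\<^sup>+w. ?F i x w \<partial>M) * (\<integral>\<^sup>+w. ?C i l w \<partial>M) = (\<integral>\<^sup>+w. ?F i x w * ?C i l w \<partial>M)"
        by (simp add: inc_def)
    qed
    also have "\<dots> = (\<Sum>i\<in>{a..n}. \<integral>\<^sup>+w. (\<Sum>l\<le>n. ?F i x w * ?C i l w) \<partial>M)"
      by (intro sum.cong refl nn_integral_sum[symmetric]) measurable
    also have "\<dots> = (\<integral>\<^sup>+w. (\<Sum>i\<in>{a..n}. \<Sum>l\<le>n. ?F i x w * ?C i l w) \<partial>M)"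
      by (rule nn_integral_sum[symmetric]) measurable
    also have "\<dots> \<le> (\<integral>\<^sup>+w. (\<Sum>j\<le>2 * n. ?D j x w) \<partial>M)"
    proof (rule nn_integral_mono)
      fix w
      have "(\<Sum>l\<le>n. ?F i x w * ?C i l w) \<le> ?F i x w * (\<Sum>j\<le>2 * n. ?D j x w)" if "i \<in> {a..n}" for i
      proof (cases "first_hit r a i x w")
        case True
        have "(\<Sum>l\<le>n. ?C i l w) \<le> (\<Sum>l\<le>n. ?D (i + l) x w)"
        proof (rule sum_mono)
          fix l
          have "norm (inc 0 (i + l) w - x) \<le> norm (inc 0 i w - x) + norm (inc i (i + l) w)"
            using inc_add[of 0 i "i + l" w] norm_triangle_ineq[of "inc 0 i w - x" "inc i (i + l) w"]
            by (simp add: algebra_simps)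
          then show "?C i l w \<le> ?D (i + l) x w"
            using True by (auto simp: first_hit_def)
        qed
        also have "\<dots> = (\<Sum>j\<in>(\<lambda>l. i + l) ` {..n}. ?D j x w)"
          by (subst sum.reindex) auto
        also have "\<dots> \<le> (\<Sum>j\<le>2 * n. ?D j x w)"
          using that by (intro sum_mono2) auto
        finally show ?thesis using True by simp
      qed simp
      then have "(\<Sum>i\<in>{a..n}. \<Sum>l\<le>n. ?F i x w * ?C i l w) \<le> (\<Sum>i\<in>{a..n}. ?F i x w * (\<Sum>j\<le>2 * n. ?D j x w))"
        by (intro sum_mono)
      also have "\<dots> = of_bool (hits r a n x w) * (\<Sum>j\<le>2 * n. ?D j x w)"
        by (simp only: sum_distrib_right[symmetric] sum_first_hit)
      also have "\<dots> \<le> (\<Sum>j\<le>2 * n. ?D j x w)" by (cases "hits r a n x w") auto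
      finally show "(\<Sum>i\<in>{a..n}. \<Sum>l\<le>n. ?F i x w * ?C i l w) \<le> (\<Sum>j\<le>2 * n. ?D j x w)" .
    qed
    finally show ?thesis .
  qed
  have Dm[measurable]: "(\<lambda>(x, w). ?D j x w) \<in> borel_measurable (lborel \<Otimes>\<^sub>M M)" for j
  proof -
    have "Measurable.pred (lborel \<Otimes>\<^sub>M M) (\<lambda>(x, w). norm (inc 0 j w - x) \<le> 2 * r)" by measurable
    from of_bool_measurable[OF this] show ?thesis by (simp add: case_prod_unfold)
  qed
  have "(\<integral>\<^sup>+w. sausage r a n w \<partial>M) * ennreal G = (\<integral>\<^sup>+x. (\<integral>\<^sup>+w. of_bool (hits r a n x w) \<partial>M)
      * ennreal G \<partial>lborel)"
    unfolding expectation_sausage by (rule nn_integral_multc[symmetric]) measurable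
  also have "\<dots> \<le> (\<integral>\<^sup>+x. (\<integral>\<^sup>+w. (\<Sum>j\<le>2 * n. ?D j x w) \<partial>M) \<partial>lborel)"
    by (intro nn_integral_mono pt)
  \<comment> \<open>Integrated over \<open>x\<close>, each time contributes exactly the area of a
    disc of radius \<open>2 * r\<close>.\<close>
  also have "\<dots> = (\<integral>\<^sup>+w. (\<integral>\<^sup>+x. (\<Sum>j\<le>2 * n. ?D j x w) \<partial>lborel) \<partial>M)"
    by (rule lM.Fubini'[symmetric]) measurable
  also have "\<dots> = (\<integral>\<^sup>+w. (\<Sum>j\<le>2 * n. (\<integral>\<^sup>+x. ?D j x w \<partial>lborel)) \<partial>M)"
    by (intro nn_integral_cong nn_integral_sum) measurable
  also have "\<dots> = (\<integral>\<^sup>+w. (\<Sum>j\<le>2 * n. ennreal (pi * (2 * r)\<^sup>2)) \<partial>M)"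
  proof (intro nn_integral_cong sum.cong refl)
    fix j w
    have "(\<integral>\<^sup>+x. ?D j x w \<partial>lborel) = (\<integral>\<^sup>+x. indicator (cball (inc 0 j w) (2 * r)) x \<partial>lborel)"
      by (intro nn_integral_cong) (auto simp: indicator_def dist_norm)
    also have "\<dots> = ennreal (pi * (2 * r)\<^sup>2)"
      using r by (simp add: emeasure_cball_real2)
    finally show "(\<integral>\<^sup>+x. ?D j x w \<partial>lborel) = ennreal (pi * (2 * r)\<^sup>2)" .
  qed
  also have "\<dots> = ennreal (real (2 * n + 1) * (pi * (2 * r)\<^sup>2))"
    by (simp only: sum_constant nn_integral_const emeasure_space_1 mult_1_right card_atMost)
       (simp add: ennreal_mult ennreal_of_nat_eq_real_of_nat del: of_nat_Suc)
  finally show ?thesis .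
qed

end

text \<open>A function of the increments alone, so that it applies equally to shifted and reversed
  walks and to points of a product space, and shows on which steps an area depends.\<close>

definition neighbourhood_area :: "real \<Rightarrow> nat \<Rightarrow> (nat \<Rightarrow> real^2) \<Rightarrow> ennreal" where
  "neighbourhood_area r n y = (\<integral>\<^sup>+z. of_bool (\<exists>j\<in>{0..n}. norm ((\<Sum>l<j. y l) - z) \<le> r) \<partial>lborel)"

lemma nn_integral_lborel_translate:
  fixes f :: "real^2 \<Rightarrow> ennreal"
  assumes [measurable]: "f \<in> borel_measurable borel"
  shows "(\<integral>\<^sup>+z. f (c + z) \<partial>lborel) = (\<integral>\<^sup>+z. f z \<partial>lborel)"
  by (subst (2) lborel_distr_plus[of c, symmetric]) (simp add: nn_integral_distr)

lemma of_bool_near_measurable: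
  fixes w :: "nat \<Rightarrow> real^2"
  assumes "finite J"
  shows "(\<lambda>z. of_bool (\<exists>j\<in>J. norm (w j - z) \<le> r) :: ennreal) \<in> borel_measurable borel"
proof -
  have "Measurable.pred borel (\<lambda>z. \<exists>j\<in>J. norm (w j - z) \<le> r)"
    using assms by (intro pred_intros_finite) auto
  then show ?thesis unfolding of_bool_def by measurable
qed

text \<open>Lebesgue measure is translation invariant, so the starting point does not
  matter.\<close>

lemma neighbourhood_area_translate:
  "(\<integral>\<^sup>+z. of_bool (\<exists>j\<in>{0..n}. norm (c + (\<Sum>l<j. y l) - z) \<le> r) \<partial>lborel) = neighbourhood_area r n y"
proof -
  have "(\<integral>\<^sup>+z. of_bool (\<exists>j\<in>{0..n}. norm (c + (\<Sum>l<j. y l) - z) \<le> r) \<partial>lborel) =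
    (\<integral>\<^sup>+z. of_bool (\<exists>j\<in>{0..n}. norm (c + (\<Sum>l<j. y l) - (c + z)) \<le> r) \<partial>lborel)"
    by (rule nn_integral_lborel_translate[symmetric]) (intro of_bool_near_measurable, simp)
  then show ?thesis by (simp add: neighbourhood_area_def)
qed

lemma neighbourhood_area_cong: "(\<And>l. l < n \<Longrightarrow> y l = y' l) \<Longrightarrow> neighbourhood_area r n y
    = neighbourhood_area r n y'"
proof -
  assume "\<And>l. l < n \<Longrightarrow> y l = y' l"
  then have "(\<Sum>l<j. y l) = (\<Sum>l<j. y' l)" if "j \<in> {0..n}" for j
    using that by (intro sum.cong) auto
  then show ?thesis by (simp add: neighbourhood_area_def)
qed

lemma neighbourhood_area_le:
  assumes "0 \<le> r"
  shows "neighbourhood_area r n y \<le> ennreal (real (n + 1) * (pi * r\<^sup>2))"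
proof -
  have "neighbourhood_area r n y \<le> (\<integral>\<^sup>+z. (\<Sum>j\<in>{0..n}. indicator (cball (\<Sum>l<j. y l) r) z) \<partial>lborel)"
    unfolding neighbourhood_area_def
  proof (rule nn_integral_mono)
    fix z
    show "of_bool (\<exists>j\<in>{0..n}. norm ((\<Sum>l<j. y l) - z) \<le> r) \<le> (\<Sum>j\<in>{0..n}. indicator (cball (\<Sum>l<j. y l) r)
        z :: ennreal)"
    proof (cases "\<exists>j\<in>{0..n}. norm ((\<Sum>l<j. y l) - z) \<le> r")
      case True
      then obtain j where j: "j \<in> {0..n}" "norm ((\<Sum>l<j. y l) - z) \<le> r" by auto
      have "indicator (cball (\<Sum>l<j. y l) r) z \<le> (\<Sum>j\<in>{0..n}. indicator (cball (\<Sum>l<j. y l) r) z :: ennreal)"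
        using j by (intro member_le_sum) auto
      then show ?thesis using j True by (simp add: dist_norm)
    qed simp
  qed
  also have "\<dots> = (\<Sum>j\<in>{0..n}. emeasure lborel (cball (\<Sum>l<j. y l) r))"
    by (subst nn_integral_sum) (auto intro!: borel_measurable_indicator)
  also have "\<dots> = ennreal (real (n + 1) * (pi * r\<^sup>2))"
    using assms by (simp add: emeasure_cball_real2 ennreal_mult ennreal_of_nat_eq_real_of_nat del:
        of_nat_Suc)
  finally show ?thesis .
qed

lemma neighbourhood_area_measurable:
  assumes K: "\<And>l. l < n \<Longrightarrow> Y l \<in> borel_measurable L"
  shows "(\<lambda>x. neighbourhood_area r n (\<lambda>l. Y l x)) \<in> borel_measurable L"
proof -
  have [measurable]: "(\<lambda>x. \<Sum>l<j. Y l x) \<in> borel_measurable L" if "j \<in> {0..n}" for j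
    using that K by (intro borel_measurable_sum) auto
  have "Measurable.pred (L \<Otimes>\<^sub>M lborel) (\<lambda>(x, z). \<exists>j\<in>{0..n}. norm ((\<Sum>l<j. Y l x) - z) \<le> r)"
    unfolding case_prod_unfold by (intro pred_intros_finite) (auto intro!: measurable_compose[OF
        measurable_fst])
  then have "(\<lambda>(x, z). of_bool (\<exists>j\<in>{0..n}. norm ((\<Sum>l<j. Y l x) - z) \<le> r) :: ennreal) \<in> borel_measurable
      (L \<Otimes>\<^sub>M lborel)"
    unfolding of_bool_def case_prod_unfold by measurable
  then show ?thesis unfolding neighbourhood_area_def by (rule lborel.borel_measurable_nn_integral)
qed

context gaussian_walk begin

text \<open>The position at time \<open>i\<close> only translates the set; the area swept afterwards
  is a function of the later steps, hence independent of the past.\<close>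

lemma sausage_eq_area_from:
  assumes "i \<le> n"
  shows "sausage r i n w = neighbourhood_area r (n - i) (\<lambda>l. X (i + l) w)"
proof -
  have *: "inc 0 (i + j) w = inc 0 i w + (\<Sum>l<j. X (i + l) w)" for j
  proof -
    have "inc i (i + j) w = (\<Sum>l<j. X (i + l) w)"
      unfolding inc_def by (rule sum.reindex_bij_witness[where i = "\<lambda>l. i + l" and j = "\<lambda>l. l - i"]) auto
    then show ?thesis using inc_add[of 0 i "i + j" w] by simp
  qed
  have "hits r i n x w \<longleftrightarrow> (\<exists>j\<in>{0..n-i}. norm (inc 0 i w + (\<Sum>l<j. X (i + l) w) - x) \<le> r)" for x
  proof
    assume "hits r i n x w"
    then obtain k where "i \<le> k" "k \<le> n" "norm (inc 0 k w - x) \<le> r" by (auto simp: hits_def)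
    then show "\<exists>j\<in>{0..n-i}. norm (inc 0 i w + (\<Sum>l<j. X (i + l) w) - x) \<le> r"
      by (intro bexI[of _ "k - i"]) (auto simp flip: *)
  next
    assume "\<exists>j\<in>{0..n-i}. norm (inc 0 i w + (\<Sum>l<j. X (i + l) w) - x) \<le> r"
    then obtain j where "j \<le> n - i" "norm (inc 0 (i + j) w - x) \<le> r" by (auto simp: *)
    then show "hits r i n x w" using assms unfolding hits_def by (intro bexI[of _ "i + j"]) auto
  qed
  then show ?thesis
    unfolding sausage_def by (simp add: neighbourhood_area_translate)
qed

text \<open>Of two points, one is hit first; the area hit after that time is independent of the past.\<close>

lemma sausage_second_moment:
  assumes n: "n \<le> N" and v: "\<And>i. i \<le> n \<Longrightarrow> (\<integral>\<^sup>+w. sausage r i n w \<partial>M) \<le> v"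
  shows "(\<integral>\<^sup>+w. sausage r 0 n w * sausage r 0 n w \<partial>M) \<le> 2 * (v * v)"
proof -
  interpret lM: pair_sigma_finite lborel M ..
  let ?F = "\<lambda>i x w. of_bool (first_hit r 0 i x w) :: ennreal"
  let ?H = "\<lambda>i x w. of_bool (hits r i n x w) :: ennreal"
  have Fx[measurable]: "(\<lambda>x. ?F i x w) \<in> borel_measurable borel" for i w
    unfolding first_hit_def of_bool_def by measurable
  have Hx[measurable]: "(\<lambda>x. ?H i x w) \<in> borel_measurable borel" for i w
    unfolding hits_def of_bool_def by measurable
  have Fw[measurable]: "(\<lambda>w. ?F i x w) \<in> borel_measurable M" for i x
    unfolding first_hit_def of_bool_def by measurable
  have pt: "sausage r 0 n w * sausage r 0 n w \<le> 2 * (\<integral>\<^sup>+x. (\<Sum>i\<in>{0..n}. ?F i x w * sausage r i n w)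
      \<partial>lborel)" for w
  proof -
    let ?A = "\<lambda>x y. \<Sum>i\<in>{0..n}. ?F i x w * ?H i y w"
    have cover: "?H 0 x w * ?H 0 y w \<le> ?A x y + ?A y x" for x y
    proof (cases "hits r 0 n x w \<and> hits r 0 n y w")
      case True
      have ex: "\<exists>i\<in>{0..n}. first_hit r 0 i z w" if "hits r 0 n z w" for z
      proof (rule ccontr)
        assume "\<not> ?thesis"
        then have "(\<Sum>i\<in>{0..n}. ?F i z w) = 0" by (intro sum.neutral) auto
        then show False using that unfolding sum_first_hit by simp
      qed
      obtain i j where i: "i \<le> n" "first_hit r 0 i x w" and j: "j \<le> n" "first_hit r 0 j y w"
        using ex True by (meson atLeastAtMost_iff)
      have later: "1 \<le> ?A x y" if "i \<le> j" "i \<le> n" "first_hit r 0 i x w" "j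
          \<le> n" "first_hit r 0 j y w" for i j x y
      proof -
        have "hits r i n y w" using that by (auto simp: hits_def first_hit_def)
        then have "1 = ?F i x w * ?H i y w" using that by simp
        also have "\<dots> \<le> ?A x y" using that by (intro member_le_sum) auto
        finally show ?thesis .
      qed
      have "1 \<le> ?A x y + ?A y x"
        using later[of i j x y] later[of j i y x] i j by (cases "i
            \<le> j") (auto intro: add_increasing add_increasing2)
      then show ?thesis using True by simp
    qed auto
    have S: "(\<integral>\<^sup>+y. ?H i y w \<partial>lborel) = sausage r i n w" for i by (simp add: sausage_def)
    have "sausage r 0 n w * sausage r 0 n w = (\<integral>\<^sup>+x. (\<integral>\<^sup>+y. ?H 0 x w * ?H 0 y w \<partial>lborel) \<partial>lborel)"
      by (simp add: nn_integral_cmult nn_integral_multc S)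
    also have "\<dots> \<le> (\<integral>\<^sup>+x. (\<integral>\<^sup>+y. ?A x y + ?A y x \<partial>lborel) \<partial>lborel)"
      by (intro nn_integral_mono cover)
    also have "\<dots> = (\<integral>\<^sup>+x. (\<integral>\<^sup>+y. ?A x y \<partial>lborel) \<partial>lborel) + (\<integral>\<^sup>+x. (\<integral>\<^sup>+y. ?A y x \<partial>lborel) \<partial>lborel)"
      by (subst nn_integral_add[symmetric]; (subst nn_integral_add[symmetric])?; measurable?)
    \<comment> \<open>Exchanging the roles of the two points accounts for the factor
      \<open>2\<close>.\<close>
    also have "(\<integral>\<^sup>+x. (\<integral>\<^sup>+y. ?A y x \<partial>lborel) \<partial>lborel) = (\<integral>\<^sup>+x. (\<integral>\<^sup>+y. ?A x y \<partial>lborel) \<partial>lborel)"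
      by (rule lborel_pair.Fubini') measurable
    also have "(\<integral>\<^sup>+x. (\<integral>\<^sup>+y. ?A x y \<partial>lborel) \<partial>lborel) = (\<integral>\<^sup>+x. (\<Sum>i\<in>{0..n}. ?F i x w * sausage r i n w)
        \<partial>lborel)"
    proof (intro nn_integral_cong)
      fix x
      have "(\<integral>\<^sup>+y. ?A x y \<partial>lborel) = (\<Sum>i\<in>{0..n}. \<integral>\<^sup>+y. ?F i x w * ?H i y w \<partial>lborel)"
        by (rule nn_integral_sum) measurable
      also have "\<dots> = (\<Sum>i\<in>{0..n}. ?F i x w * sausage r i n w)"
        unfolding S[symmetric] by (intro sum.cong refl nn_integral_cmult) measurable
      finally show "(\<integral>\<^sup>+y. ?A x y \<partial>lborel) = (\<Sum>i\<in>{0..n}. ?F i x w * sausage r i n w)" .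
    qed
    finally show ?thesis by (simp only: mult_2)
  qed
  have ind: "(\<integral>\<^sup>+w. ?F i x w * sausage r i n w \<partial>M) \<le> (\<integral>\<^sup>+w. ?F i x w \<partial>M) * v" if i: "i \<le> n" for i x
  proof -
    let ?g = "\<lambda>y. neighbourhood_area r (n - i) (\<lambda>l. y (i + l))"
    have gm: "?g \<in> borel_measurable (PiM {i..<n} (\<lambda>_. borel))"
      using i by (intro neighbourhood_area_measurable measurable_component_singleton) auto
    have eq: "sausage r i n w = ?g (\<lambda>l\<in>{i..<n}. X l w)" for w
      unfolding sausage_eq_area_from[OF i] using i by (intro neighbourhood_area_cong) auto
    have "(\<integral>\<^sup>+w. ?F i x w * sausage r i n w \<partial>M) = (\<integral>\<^sup>+w. ?F i x w \<partial>M) * (\<integral>\<^sup>+w. sausage r i n w \<partial>M)"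
      unfolding eq by (rule first_hit_indep[OF i n gm])
    also have "\<dots> \<le> (\<integral>\<^sup>+w. ?F i x w \<partial>M) * v" using v[OF i] by (intro mult_left_mono) auto
    finally show ?thesis .
  qed
  have hit: "(\<Sum>i\<in>{0..n}. \<integral>\<^sup>+w. ?F i x w \<partial>M) = (\<integral>\<^sup>+w. ?H 0 x w \<partial>M)" for x
    unfolding sum_first_hit[symmetric] by (rule nn_integral_sum[symmetric]) measurable
  have "(\<integral>\<^sup>+w. sausage r 0 n w * sausage r 0 n w \<partial>M) \<le> (\<integral>\<^sup>+w. 2 * (\<integral>\<^sup>+x. (\<Sum>i\<in>{0..n}. ?F i x w
      * sausage r i n w) \<partial>lborel) \<partial>M)"
    by (intro nn_integral_mono pt)
  also have "\<dots> = 2 * (\<integral>\<^sup>+w. (\<integral>\<^sup>+x. (\<Sum>i\<in>{0..n}. ?F i x w * sausage r i n w) \<partial>lborel) \<partial>M)"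
    by (rule nn_integral_cmult) measurable
  also have "(\<integral>\<^sup>+w. (\<integral>\<^sup>+x. (\<Sum>i\<in>{0..n}. ?F i x w * sausage r i n w) \<partial>lborel) \<partial>M)
      = (\<integral>\<^sup>+x. (\<integral>\<^sup>+w. (\<Sum>i\<in>{0..n}. ?F i x w * sausage r i n w) \<partial>M) \<partial>lborel)"
    by (rule lM.Fubini') measurable
  also have "\<dots> = (\<integral>\<^sup>+x. (\<Sum>i\<in>{0..n}. (\<integral>\<^sup>+w. ?F i x w * sausage r i n w \<partial>M)) \<partial>lborel)"
    by (intro nn_integral_cong nn_integral_sum) measurable
  also have "\<dots> \<le> (\<integral>\<^sup>+x. (\<integral>\<^sup>+w. ?H 0 x w \<partial>M) * v \<partial>lborel)"
    unfolding hit[symmetric] sum_distrib_right by (intro nn_integral_mono sum_mono ind) auto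
  also have "\<dots> = (\<integral>\<^sup>+x. (\<integral>\<^sup>+w. ?H 0 x w \<partial>M) \<partial>lborel) * v"
    by (rule nn_integral_multc) measurable
  also have "\<dots> \<le> v * v"
    unfolding expectation_sausage[symmetric] by (intro mult_right_mono v) auto
  finally show ?thesis by (simp add: mult_left_mono)
qed

end

text \<open>Each doubling of the range contributes at least \<open>1/2\<close>.\<close>

lemma sum_inverse_dyadic_ge:
  assumes "0 < q"
  shows "real j / 2 \<le> (\<Sum>l\<in>{q..q * 2 ^ j}. 1 / real l)"
proof (induction j)
  case (Suc j)
  let ?a = "q * 2 ^ j"
  have a: "0 < ?a" using assms by simp
  have "1 / 2 = (\<Sum>l\<in>{?a<..2 * ?a}. 1 / real (2 * ?a))" using a by (simp add: field_simps)
  also have "\<dots> \<le> (\<Sum>l\<in>{?a<..2 * ?a}. 1 / real l)"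
  proof (intro sum_mono)
    fix l assume l: "l \<in> {?a<..2 * ?a}"
    then have "real l \<le> real (2 * ?a)" by (simp only: of_nat_le_iff greaterThanAtMost_iff)
    then show "1 / real (2 * ?a) \<le> 1 / real l" using l by (intro frac_le) auto
  qed
  finally have "real (Suc j) / 2 \<le> (\<Sum>l\<in>{q..?a}. 1 / real l) + (\<Sum>l\<in>{?a<..2 * ?a}. 1 / real l)"
    using Suc by simp
  also have "\<dots> = (\<Sum>l\<in>{q..?a} \<union> {?a<..2 * ?a}. 1 / real l)"
    by (subst sum.union_disjoint) auto
  also have "{q..?a} \<union> {?a<..2 * ?a} = {q..q * 2 ^ Suc j}"
  proof -
    have "{q..a} \<union> {a<..2 * a} = {q..2 * a}" if "q \<le> a" for a using that by auto
    from this[of ?a] show ?thesis by (simp add: mult_ac)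
  qed
  finally show ?case .
qed (auto intro!: sum_nonneg)

lemma ennreal_le_of_mult_le:
  assumes "a * ennreal g \<le> ennreal (v * g)" "0 < g" "0 \<le> v"
  shows "a \<le> ennreal v"
proof (cases a)
  case (real t)
  then have "t * g \<le> v * g"
    using assms by (simp add: ennreal_mult[symmetric])
  then have "t \<le> v" using assms(2) by (rule mult_right_le_imp_le)
  then show ?thesis using real by (simp add: ennreal_leI)
next
  case top
  then show ?thesis using assms by (simp add: ennreal_top_mult top_unique)
qed

context gaussian_walk begin

text \<open>Here \<open>q\<close> is the number of steps needed to travel \<open>r\<close>. The
  probability of being within \<open>r\<close> after \<open>l \<ge> q\<close> steps is at least
  \<open>q / (4 * l)\<close>, and the harmonic sum over \<open>j\<close> doublings supplies the
  logarithm.\<close>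

lemma green_sum_ge:
  assumes q: "0 < q" and r: "0 \<le> r" "r\<^sup>2 = \<delta> * real q" and n: "n = q * 2 ^ j" and N: "2 * n \<le> N"
      and i: "i \<le> n"
  shows "ennreal (real q * real j / 8) \<le> (\<Sum>l\<le>n. emeasure M {w\<in>space M. norm (inc i (i + l) w) \<le> r})"
proof -
  have "real q * real j / 8 = real q / 4 * (real j / 2)" by simp
  also have "\<dots> \<le> real q / 4 * (\<Sum>l\<in>{q..q * 2 ^ j}. 1 / real l)"
    by (intro mult_left_mono sum_inverse_dyadic_ge q) auto
  also have "\<dots> = (\<Sum>l\<in>{q..n}. real q / 4 * (1 / real l))" unfolding n by (rule sum_distrib_left)
  also have "\<dots> \<le> (\<Sum>l\<in>{q..n}. prob {w\<in>space M. norm (inc i (i + l) w) \<le> r})"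
  proof (rule sum_mono)
    fix l assume l: "l \<in> {q..n}"
    have "r\<^sup>2 / (4 * \<delta> * real (i + l - i)) \<le> prob {w\<in>space M. norm (\<Sum>t\<in>{i..<i+l}. X t w) \<le> r}"
      using l q i N r step_pos by (intro small_ball_ge) auto
    then show "real q / 4 * (1 / real l) \<le> prob {w\<in>space M. norm (inc i (i + l) w) \<le> r}"
      using step_pos r by (simp add: inc_def)
  qed
  also have "\<dots> \<le> (\<Sum>l\<le>n. prob {w\<in>space M. norm (inc i (i + l) w) \<le> r})"
    by (rule sum_mono2) auto
  finally have "ennreal (real q * real j / 8) \<le> ennreal (\<Sum>l\<le>n. prob {w\<in>space M. norm (inc i (i + l) w)
      \<le> r})"
    by (rule ennreal_leI)
  then show ?thesis by (simp add: emeasure_eq_measure)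
qed

text \<open>The constant in \<open>?v\<close> comes from at most \<open>3 * n\<close> discs of area
  \<open>4 * pi * r\<^sup>2\<close>, divided by the Green sum \<open>q * j / 8\<close>, with
  \<open>n = q * 2^j\<close>.\<close>

lemma half_sausage_second_moment:
  assumes q: "0 < q" and r: "0 \<le> r" "r\<^sup>2 = \<delta> * real q" and n: "n = q * 2 ^ j" and N: "2 * n \<le> N"
      and j: "0 < j"
  shows "expectation (\<lambda>w. (enn2real (neighbourhood_area r n (\<lambda>l. X l w)))\<^sup>2)
    \<le> (2 * (96 * pi * r\<^sup>2 * 2 ^ j / real j))\<^sup>2"
proof -
  let ?G = "real q * real j / 8" and ?v = "96 * pi * r\<^sup>2 * 2 ^ j / real j"
  have G: "0 < ?G" using q j by simp
  have v0: "0 \<le> ?v" by simp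
  have "0 < n" using q unfolding n by simp
  then have nq1: "1 \<le> real n" by simp
  have nq: "real n = real q * 2 ^ j" by (simp add: n)
  have v: "(\<integral>\<^sup>+w. sausage r i n w \<partial>M) \<le> ennreal ?v" if "i \<le> n" for i
  proof -
    have "(\<integral>\<^sup>+w. sausage r i n w \<partial>M) * ennreal ?G \<le> ennreal (real (2 * n + 1) * (pi * (2 * r)\<^sup>2))"
      by (rule expectation_sausage_le[OF N that r(1) green_sum_ge[OF q r n N]])
    also have "real (2 * n + 1) * (pi * (2 * r)\<^sup>2) \<le> 3 * real n * (pi * (2 * r)\<^sup>2)"
      using nq1 by (intro mult_right_mono) auto
    also have "\<dots> = ?v * ?G" using j unfolding nq by (simp add: power_mult_distrib)
    finally have "(\<integral>\<^sup>+w. sausage r i n w \<partial>M) * ennreal ?G \<le> ennreal (?v * ?G)" by (simp add: ennreal_leI)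
    then show ?thesis using G v0 by (rule ennreal_le_of_mult_le)
  qed
  have S: "sausage r 0 n w = neighbourhood_area r n (\<lambda>l. X l w)" for w
    using sausage_eq_area_from[of 0 n] by simp
  have fin: "sausage r 0 n w = ennreal (enn2real (sausage r 0 n w))" for w
    using neighbourhood_area_le[OF r(1), of n "\<lambda>l. X l w"] unfolding S
    by (intro ennreal_enn2real[symmetric]) (auto intro: le_less_trans)
  have Vm[measurable]: "random_variable borel (\<lambda>w. enn2real (sausage r 0 n w))" by measurable
  have "(\<integral>\<^sup>+w. ennreal ((enn2real (sausage r 0 n w))\<^sup>2) \<partial>M) = (\<integral>\<^sup>+w. sausage r 0 n w * sausage r 0 n w \<partial>M)"
    by (intro nn_integral_cong) (metis fin enn2real_nonneg ennreal_mult power2_eq_square)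
  also have "\<dots> \<le> 2 * (ennreal ?v * ennreal ?v)"
    using N by (intro sausage_second_moment v) auto
  also have "\<dots> = ennreal (2 * (?v * ?v))" using v0 by (simp only: ennreal_mult mult_nonneg_nonneg
      zero_le_numeral ennreal_numeral)
  also have "\<dots> \<le> ennreal ((2 * ?v)\<^sup>2)"
  proof (rule ennreal_leI)
    have "2 * (w * w) \<le> (2 * w)\<^sup>2" for w :: real by (simp add: power2_eq_square)
    then show "2 * (?v * ?v) \<le> (2 * ?v)\<^sup>2" .
  qed
  finally have "(\<integral>\<^sup>+w. ennreal ((enn2real (sausage r 0 n w))\<^sup>2) \<partial>M) \<le> ennreal ((2 * ?v)\<^sup>2)" .
  then have "expectation (\<lambda>w. (enn2real (sausage r 0 n w))\<^sup>2) \<le> (2 * ?v)\<^sup>2"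
    by (subst integral_eq_nn_integral) (auto intro!: enn2real_leI)
  then show ?thesis unfolding S .
qed

section \<open>Independent blocks and the tail of the total area\<close>

lemma gaussian_walk_shift:
  assumes "A + n \<le> N"
  shows "gaussian_walk M (\<lambda>l. X (A + l)) n \<delta>"
proof unfold_locales
  have "indep_vars (\<lambda>_. borel) (\<lambda>b w. (\<lambda>x. x (A + b)) (\<lambda>l\<in>{A + b}. X l w)) {..<n}"
    by (rule indep_vars_compose2[OF indep_vars_restrict[OF indep]]) (use assms in \<open>auto simp:
        disjoint_family_on_def\<close>)
  then show "indep_vars (\<lambda>_. borel) (\<lambda>l. X (A + l)) {..<n}" by simp
  have eq: "(\<Sum>l\<in>{i..<j}. X (A + l) w) = (\<Sum>l\<in>{A + i..<A + j}. X l w)" for i j w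
    by (rule sum.reindex_bij_witness[where i = "\<lambda>l. l - A" and j = "\<lambda>l. A + l"]) auto
  show "prob {w \<in> space M. norm ((\<Sum>l\<in>{i..<j}. X (A + l) w) + x) \<le> \<rho>} \<le> \<rho>\<^sup>2 / (2 * \<delta> * real (j - i))"
    if "i < j" "j \<le> n" "0 \<le> \<rho>" for i j \<rho> x
    using small_ball_le[of "A + i" "A + j" \<rho> x] that assms unfolding eq by simp
  show "\<rho>\<^sup>2 / (4 * \<delta> * real (j - i)) \<le> prob {w \<in> space M. norm (\<Sum>l\<in>{i..<j}. X (A + l) w) \<le> \<rho>}"
    if "i < j" "j \<le> n" "0 \<le> \<rho>" "\<rho>\<^sup>2 \<le> \<delta> * real (j - i)" for i j \<rho>
    using small_ball_ge[of "A + i" "A + j" \<rho>] that assms unfolding eq by simp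
qed (auto simp: step_pos)

text \<open>Negated steps in reverse order retrace the path from its end, so the final half of a
  block becomes the initial half of another walk.\<close>

lemma gaussian_walk_reverse: "gaussian_walk M (\<lambda>l w. - X (N - Suc l) w) N \<delta>"
proof unfold_locales
  have "indep_vars (\<lambda>_. borel) (\<lambda>b w. (\<lambda>x. - x (N - Suc b)) (\<lambda>l\<in>{N - Suc b}. X l w)) {..<N}"
    by (rule indep_vars_compose2[OF indep_vars_restrict[OF indep]]) (auto simp: disjoint_family_on_def)
  then show "indep_vars (\<lambda>_. borel) (\<lambda>l w. - X (N - Suc l) w) {..<N}" by simp
  have eq: "(\<Sum>l\<in>{i..<j}. - X (N - Suc l) w) = - (\<Sum>l\<in>{N - j..<N - i}. X l w)" if "j \<le> N" for i j w
    unfolding sum_negf neg_equal_iff_equal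
    by (rule sum.reindex_bij_witness[where i = "\<lambda>l. N - Suc l" and j = "\<lambda>l. N - Suc l"]) (use that in auto)
  show "prob {w \<in> space M. norm ((\<Sum>l\<in>{i..<j}. - X (N - Suc l) w) + x) \<le> \<rho>} \<le> \<rho>\<^sup>2 / (2 * \<delta> * real (j - i))"
    if "i < j" "j \<le> N" "0 \<le> \<rho>" for i j \<rho> x
  proof -
    have "norm ((\<Sum>l\<in>{i..<j}. - X (N - Suc l) w) + x) = norm ((\<Sum>l\<in>{N - j..<N - i}. X l w) + (- x))" for w
      unfolding eq[OF that(2)] by (metis add_uminus_conv_diff norm_minus_commute uminus_add_conv_diff)
    then show ?thesis using small_ball_le[of "N - j" "N - i" \<rho> "- x"] that by simp
  qed
  show "\<rho>\<^sup>2 / (4 * \<delta> * real (j - i)) \<le> prob {w \<in> space M. norm (\<Sum>l\<in>{i..<j}. - X (N - Suc l) w) \<le> \<rho>}"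
    if "i < j" "j \<le> N" "0 \<le> \<rho>" "\<rho>\<^sup>2 \<le> \<delta> * real (j - i)" for i j \<rho>
    using small_ball_ge[of "N - j" "N - i" \<rho>] that unfolding eq[OF that(2)] by simp
qed (auto simp: step_pos)

text \<open>The parameters \<open>e\<close> and \<open>s\<close> admit both directions of running a
  block; \<open>dep\<close> says that the \<open>b\<close>-th walk uses only steps of the
  \<open>b\<close>-th block. The factor \<open>3\<close> is \<open>2\<close> for the bound on each
  mean and \<open>1\<close> for the excess.\<close>

lemma area_blocks_tail:
  fixes s :: "nat \<Rightarrow> nat"
  assumes q: "0 < q" and r: "0 \<le> r" "r\<^sup>2 = \<delta> * real q" and n: "n = q * 2 ^ j" and N: "m * (2 * n) \<le> N"
      and j: "0 < j"
    and m: "0 < m" and rpos: "0 < r"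
    and Y: "\<And>b. b < m \<Longrightarrow> gaussian_walk M (Y b) (2 * n) \<delta>"
    and dep: "\<And>b l w. b < m \<Longrightarrow> l < n \<Longrightarrow> Y b l w = e *\<^sub>R X (b * (2 * n) + s l) w" "\<And>l. l < n \<Longrightarrow> s l < 2 * n"
  shows "prob {w \<in> space M. 3 * real m * (96 * pi * r\<^sup>2 * 2 ^ j / real j)
      \<le> (\<Sum>b<m. enn2real (neighbourhood_area r n (\<lambda>l. Y b l w)))}
    \<le> 4 / real m"
proof -
  let ?v = "96 * pi * r\<^sup>2 * 2 ^ j / real j"
  let ?K = "\<lambda>b. {b * (2 * n)..<b * (2 * n) + 2 * n}"
  let ?Z = "\<lambda>b w. enn2real (neighbourhood_area r n (\<lambda>l. Y b l w))"
  have v: "0 < ?v" using rpos j by (intro divide_pos_pos mult_pos_pos) auto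
  note bN = block_le[OF _ N]
  have "prob {w \<in> space M. real m * (2 * ?v) + real m * ?v \<le> (\<Sum>b<m. ?Z b w)}
      \<le> real m * (2 * ?v)\<^sup>2 / (real m * ?v)\<^sup>2"
  proof (rule indep_sum_tail)
    show "indep_vars (\<lambda>_. borel) ?Z {..<m}"
    proof (rule indep_vars_of_blocks)
      show "?K b \<subseteq> {..<N}" if "b < m" for b using bN[OF that] by auto
      show "disjoint_family_on ?K {..<m}" by (rule disjoint_blocks)
      show "(\<lambda>x. enn2real (neighbourhood_area r n (\<lambda>l. e *\<^sub>R x (b * (2 * n) + s l)))) \<in> borel_measurable
          (PiM (?K b) (\<lambda>_. borel))" for b
        using dep(2) by (intro borel_measurable_enn2real neighbourhood_area_measurable
            borel_measurable_scaleR borel_measurable_const measurable_component_singleton) auto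
      show "?Z b w = enn2real (neighbourhood_area r n (\<lambda>l. e *\<^sub>R (\<lambda>l\<in>?K b. X l w) (b * (2 * n)
          + s l)))" if "b < m" for b w
        using that dep by (intro arg_cong[where f = enn2real] neighbourhood_area_cong) auto
    qed
    show "\<bar>?Z b w\<bar> \<le> real (n + 1) * (pi * r\<^sup>2)" for b w
      using neighbourhood_area_le[OF r(1), of n "\<lambda>l. Y b l w"] by (auto intro!: enn2real_leI simp del:
          of_nat_Suc)
    show "expectation (\<lambda>w. (?Z b w)\<^sup>2) \<le> (2 * ?v)\<^sup>2" if "b < m" for b
      using gaussian_walk.half_sausage_second_moment[OF Y[OF that] q r n order_refl j] .
    show "0 \<le> 2 * ?v" using v by simp
    show "0 < real m * ?v" using m by (intro mult_pos_pos v) auto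
  qed
  also have "real m * (2 * ?v)\<^sup>2 / (real m * ?v)\<^sup>2 = 4 / real m"
  proof -
    have "real m * (2 * w)\<^sup>2 / (real m * w)\<^sup>2 = 4 / real m" if "0 < w" for w
      using m that by (simp add: field_simps power2_eq_square)
    from this[OF v] show ?thesis .
  qed
  finally show ?thesis by (simp add: algebra_simps)
qed


text \<open>The bound on the expected area needs as much time after the hit as before it, so the first
  half of a block is run forwards and the second half backwards.\<close>

lemma total_area_le_blocks:
  assumes n: "0 < n" and m: "0 < m" and r: "0 \<le> r"
  shows "neighbourhood_area r (m * (2 * n)) (\<lambda>l. X l w) \<le>
    (\<Sum>b<m. neighbourhood_area r n (\<lambda>l. X (b * (2 * n) + l) w)) +
    (\<Sum>b<m. neighbourhood_area r n (\<lambda>l. - X (b * (2 * n) + (2 * n - Suc l)) w))"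
proof -
  let ?A = "\<lambda>b. b * (2 * n)"
  let ?F = "\<lambda>b z. of_bool (\<exists>j\<in>{0..n}. norm (inc 0 (?A b) w + (\<Sum>l<j. X (?A b + l) w) - z) \<le> r) :: ennreal"
  let ?R = "\<lambda>b z. of_bool (\<exists>j\<in>{0..n}. norm (inc 0 (?A b + 2 * n) w + (\<Sum>l<j. - X (?A b + (2
      * n - Suc l)) w) - z) \<le> r) :: ennreal"
  have [measurable]: "?F b \<in> borel_measurable borel" "?R b \<in> borel_measurable borel" for b
    by (intro of_bool_near_measurable; simp)+
  have W: "(\<Sum>l<i. X l w) = inc 0 i w" for i by (simp add: inc_def lessThan_atLeast0)
  have cover: "of_bool (\<exists>i\<in>{0..m * (2 * n)}. norm ((\<Sum>l<i. X l w) - z) \<le> r)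
      \<le> (\<Sum>b<m. ?F b z) + (\<Sum>b<m. ?R b z)" for z
  proof (cases "\<exists>i\<in>{0..m * (2 * n)}. norm ((\<Sum>l<i. X l w) - z) \<le> r")
    case True
    then obtain i where i: "i \<le> m * (2 * n)" "norm (inc 0 i w - z) \<le> r" by (auto simp: W)
    obtain b where b: "b < m" "?A b \<le> i" "i \<le> ?A b + 2 * n"
    \<comment> \<open>Division would assign the final time to a block number \<open>m\<close>, which
      does not exist; it belongs to the last block.\<close>
    proof (cases "i = m * (2 * n)")
      case True
      have "(m - 1) * (2 * n) + 2 * n = m * (2 * n)" using m by (cases m) auto
      then show ?thesis using that[of "m - 1"] True m by auto
    next
      case False
      then have "i < m * (2 * n)" using i by simp
      then have "i div (2 * n) < m" using n by (simp add: less_mult_imp_div_less)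
      moreover have "?A (i div (2 * n)) \<le> i" by simp
      moreover have "i \<le> ?A (i div (2 * n)) + 2 * n"
        using n by (metis add_le_cancel_left div_mult_mod_eq less_imp_le mod_less_divisor mult_pos_pos
            zero_less_numeral)
      ultimately show ?thesis by (rule that)
    qed
    show ?thesis
    proof (cases "i \<le> ?A b + n")
      case True
      have "inc (?A b) i w = (\<Sum>l<i - ?A b. X (?A b + l) w)"
        unfolding inc_def by (rule sum.reindex_bij_witness[where i = "\<lambda>l. ?A b + l" and j
            = "\<lambda>l. l - ?A b"]) (use b in auto)
      then have "inc 0 (?A b) w + (\<Sum>l<i - ?A b. X (?A b + l) w) = inc 0 i w"
        using inc_add[of 0 "?A b" i w] b by simp
      then have "\<exists>j\<in>{0..n}. norm (inc 0 (?A b) w + (\<Sum>l<j. X (?A b + l) w) - z) \<le> r"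
        using i True by (intro bexI[of _ "i - ?A b"]) auto
      then have "1 = ?F b z" by simp
      also have "\<dots> \<le> (\<Sum>b<m. ?F b z)" using b by (intro member_le_sum) auto
      also have "\<dots> \<le> (\<Sum>b<m. ?F b z) + (\<Sum>b<m. ?R b z)" by simp
      finally show ?thesis by (rule order_trans[rotated]) simp
    next
      case False
      let ?j = "?A b + 2 * n - i"
      have T: "inc i (?A b + 2 * n) w = (\<Sum>l<?j. X (?A b + (2 * n - Suc l)) w)"
        unfolding inc_def by (rule sum.reindex_bij_witness[where i = "\<lambda>l. ?A b + (2 * n - Suc l)" and j
            = "\<lambda>l. ?A b + 2 * n - Suc l"])
          (use b False in auto)
      have "inc 0 i w + (\<Sum>l<?j. X (?A b + (2 * n - Suc l)) w) = inc 0 (?A b + 2 * n) w"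
        using inc_add[OF le0 b(3), of w] unfolding T .
      then have "inc 0 (?A b + 2 * n) w + (\<Sum>l<?j. - X (?A b + (2 * n - Suc l)) w) = inc 0 i w"
        unfolding sum_negf add_uminus_conv_diff diff_eq_eq by (rule sym)
      then have "\<exists>j\<in>{0..n}. norm (inc 0 (?A b + 2 * n) w + (\<Sum>l<j. - X (?A b + (2 * n - Suc l)) w) - z) \<le> r"
        using i False by (intro bexI[of _ ?j]) auto
      then have "1 = ?R b z" by simp
      also have "\<dots> \<le> (\<Sum>b<m. ?R b z)" using b by (intro member_le_sum) auto
      also have "\<dots> \<le> (\<Sum>b<m. ?F b z) + (\<Sum>b<m. ?R b z)" by simp
      finally show ?thesis by (rule order_trans[rotated]) simp
    qed
  qed simp
  have "neighbourhood_area r (m * (2 * n)) (\<lambda>l. X l w) \<le> (\<integral>\<^sup>+z. (\<Sum>b<m. ?F b z) + (\<Sum>b<m. ?R b z) \<partial>lborel)"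
    unfolding neighbourhood_area_def by (intro nn_integral_mono cover)
  also have "\<dots> = (\<integral>\<^sup>+z. (\<Sum>b<m. ?F b z) \<partial>lborel) + (\<integral>\<^sup>+z. (\<Sum>b<m. ?R b z) \<partial>lborel)"
    by (rule nn_integral_add) measurable
  also have "(\<integral>\<^sup>+z. (\<Sum>b<m. ?F b z) \<partial>lborel) = (\<Sum>b<m. \<integral>\<^sup>+z. ?F b z \<partial>lborel)"
    by (rule nn_integral_sum) measurable
  also have "(\<integral>\<^sup>+z. (\<Sum>b<m. ?R b z) \<partial>lborel) = (\<Sum>b<m. \<integral>\<^sup>+z. ?R b z \<partial>lborel)"
    by (rule nn_integral_sum) measurable
  finally show ?thesis unfolding neighbourhood_area_translate .
qed

text \<open>A block lasts \<open>2^-k\<close> and half of it has \<open>q * 2^j\<close> steps with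
  \<open>j = k - 1\<close>, so its Green sum is still of order \<open>q * k\<close>. The forward and
  backward areas of the \<open>2^k\<close> blocks add up to at most
  \<open>6 * 2^k * v = 288 * pi / (k - 1)\<close>, off a set of probability \<open>8 / 2^k\<close>;
  for \<open>k \<ge> 2\<close> this is at most \<open>576 * pi / k\<close>.\<close>

lemma total_area_tail:
  assumes N: "N = 2 ^ m" and \<delta>: "\<delta> = 1 / 2 ^ m" and k: "2 \<le> k" "2 * k \<le> m"
  shows "prob {w \<in> space M. ennreal (576 * pi / real k) \<le> neighbourhood_area (1 / 2 ^ k) (2 ^ m)
      (\<lambda>l. X l w)} \<le> 8 / 2 ^ k"
proof -
  define q :: nat where "q = 2 ^ (m - 2 * k)"
  define j where "j = k - 1"
  define n where "n = q * 2 ^ j"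
  define r :: real where "r = 1 / 2 ^ k"
  define v where "v = 96 * pi * r\<^sup>2 * 2 ^ j / real j"
  have j: "0 < j" using k by (simp add: j_def)
  have q: "0 < q" by (simp add: q_def)
  have r: "0 \<le> r" "0 < r" by (auto simp: r_def)
  have mN: "2 ^ k * (2 * n) = N"
  proof -
    have "2 ^ k * (2 * n) = 2 ^ (k + Suc (j + (m - 2 * k)))" by (simp add: n_def q_def power_add)
    also have "k + Suc (j + (m - 2 * k)) = m" using k by (simp add: j_def)
    finally show ?thesis using N by simp
  qed
  have rq: "r\<^sup>2 = \<delta> * real q"
  proof -
    have "(2::real) ^ m = 2 ^ (2 * k) * 2 ^ (m - 2 * k)" using k by (simp flip: power_add)
    then have "(2::real) ^ m = (2 ^ k)\<^sup>2 * real q" by (simp add: q_def power_mult mult.commute[of 2 k]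
        flip: power_mult)
    then show ?thesis using q by (simp add: r_def \<delta> power_divide)
  qed
  have n0: "0 < n" using q by (simp add: n_def)
  have v: "6 * real (2 ^ k) * v \<le> 576 * pi / real k"
  proof -
    have "r\<^sup>2 * 2 ^ j * 2 ^ k = 1 / 2"
    proof -
      have "(2::real) ^ k = 2 * 2 ^ j" using k by (simp add: j_def flip: power_Suc)
      then show ?thesis by (simp add: r_def power2_eq_square)
    qed
    then have "6 * real (2 ^ k) * v = 6 * 96 * pi * (1/2) / real j"
      by (simp add: v_def mult_ac)
    also have "\<dots> = 576 * pi / (2 * real j)" using j by simp
    also have "\<dots> \<le> 576 * pi / real k" using k j by (intro divide_left_mono) (auto simp: j_def)
    finally show ?thesis .
  qed
  let ?Y1 = "\<lambda>b l. X (b * (2 * n) + l)" and ?Y2 = "\<lambda>b l w. - X (b * (2 * n) + (2 * n - Suc l)) w"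
  let ?V1 = "\<lambda>w. \<Sum>b<2 ^ k. enn2real (neighbourhood_area r n (\<lambda>l. ?Y1 b l w))"
  let ?V2 = "\<lambda>w. \<Sum>b<2 ^ k. enn2real (neighbourhood_area r n (\<lambda>l. ?Y2 b l w))"
  let ?B1 = "{w \<in> space M. 3 * real (2 ^ k) * v \<le> ?V1 w}" and ?B2 = "{w \<in> space M. 3 * real (2 ^ k) * v
      \<le> ?V2 w}"
  note bN = block_le[OF _ eq_refl[OF mN]]
  have shift: "gaussian_walk M (?Y1 b) (2 * n) \<delta>" if "b < 2 ^ k" for b
    by (rule gaussian_walk_shift[OF bN[OF that]])
  have B1: "prob ?B1 \<le> 4 / real (2 ^ k)"
    unfolding v_def
  proof (rule area_blocks_tail[where s = "\<lambda>l. l" and e = 1, OF q r(1) rq n_def _ j _ r(2)])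
    show "gaussian_walk M (?Y1 b) (2 * n) \<delta>" if "b < 2 ^ k" for b by (rule shift[OF that])
  qed (use mN in auto)
  have B2: "prob ?B2 \<le> 4 / real (2 ^ k)"
    unfolding v_def
  proof (rule area_blocks_tail[where s = "\<lambda>l. 2 * n - Suc l" and e = "-1", OF q r(1) rq n_def _ j _ r(2)])
    show "gaussian_walk M (?Y2 b) (2 * n) \<delta>" if "b < 2 ^ k" for b
      by (rule gaussian_walk.gaussian_walk_reverse[OF shift[OF that]])
  qed (use mN n0 in auto)
  have Vm: "random_variable borel ?V1" "random_variable borel ?V2"
    by (intro borel_measurable_sum borel_measurable_enn2real neighbourhood_area_measurable
        borel_measurable_uminus X_rv)+
  have Bm: "?B1 \<in> events" "?B2 \<in> events"
    by (rule borel_measurable_le[OF borel_measurable_const Vm(1)], rule borel_measurable_le[OF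
        borel_measurable_const Vm(2)])
  have "prob {w \<in> space M. ennreal (576 * pi / real k) \<le> neighbourhood_area r (2 ^ m) (\<lambda>l. X l w)}
      \<le> prob (?B1 \<union> ?B2)"
  proof (rule finite_measure_mono)
    show "{w \<in> space M. ennreal (576 * pi / real k) \<le> neighbourhood_area r (2 ^ m) (\<lambda>l. X l w)} \<subseteq> ?B1 \<union> ?B2"
    proof (rule ccontr)
      assume "\<not> ?thesis"
      then obtain w where *: "w \<in> space M" "ennreal (576 * pi / real k) \<le> neighbourhood_area r (2 ^ m)
          (\<lambda>l. X l w)"
        "w \<notin> ?B1" "w \<notin> ?B2" by blast
      then have w: "ennreal (576 * pi / real k) \<le> neighbourhood_area r (2 ^ m) (\<lambda>l. X l w)"
        "?V1 w < 3 * real (2 ^ k) * v" "?V2 w < 3 * real (2 ^ k) * v"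
        by (simp_all only: mem_Collect_eq not_le simp_thms)
      have fin: "neighbourhood_area r n y = ennreal (enn2real (neighbourhood_area r n y))" for y
        using neighbourhood_area_le[OF r(1), of n y] by (intro ennreal_enn2real[symmetric])
            (auto intro: le_less_trans)
      have s: "(\<Sum>b<2 ^ k::nat. neighbourhood_area r n (Z b)) = ennreal (\<Sum>b<2 ^ k. enn2real
          (neighbourhood_area r n (Z b)))" for Z
        by (subst sum_ennreal[symmetric]) (auto simp: fin[symmetric])
      have "ennreal (576 * pi / real k) \<le> neighbourhood_area r (2 ^ k * (2 * n)) (\<lambda>l. X l w)"
        using w(1) mN N by simp
      also have "\<dots> \<le> ennreal (?V1 w) + ennreal (?V2 w)"
        unfolding s[symmetric] using n0 r by (intro total_area_le_blocks) auto
      also have "\<dots> = ennreal (?V1 w + ?V2 w)" by (intro ennreal_plus[symmetric] sum_nonneg) auto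
      also have "\<dots> < ennreal (6 * real (2 ^ k) * v)"
      proof (rule ennreal_lessI)
        have "0 \<le> ?V1 w" by (intro sum_nonneg) auto
        then show "0 < 6 * real (2 ^ k) * v" using w(2) by linarith
        show "?V1 w + ?V2 w < 6 * real (2 ^ k) * v" using w(2,3) by linarith
      qed
      also have "\<dots> \<le> ennreal (576 * pi / real k)" using v by (rule ennreal_leI)
      finally show False by simp
    qed
  qed (use Bm in blast)
  also have "\<dots> \<le> prob ?B1 + prob ?B2" by (rule measure_Un_le[OF Bm])
  also have "\<dots> \<le> 8 / 2 ^ k" using B1 B2 by simp
  finally show ?thesis by (simp add: r_def)
qed

end

section \<open>From Brownian motion to random walks\<close>

context planar_brownian_motion begin

text \<open>Zero beyond the time interval, where nothing is known about \<open>B\<close>, because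
  the locale asks every \<open>X l\<close> to be a random variable.\<close>

definition step :: "nat \<Rightarrow> nat \<Rightarrow> 'w \<Rightarrow> real^2" where
  "step m l w = (if l < 2 ^ m then B (real (Suc l) / 2 ^ m) w - B (real l / 2 ^ m) w else 0)"

lemma sum_step:
  assumes "i \<le> j" "j \<le> 2 ^ m"
  shows "(\<Sum>l\<in>{i..<j}. step m l w) = B (real j / 2 ^ m) w - B (real i / 2 ^ m) w"
proof -
  have "(\<Sum>l\<in>{i..<j}. step m l w) = (\<Sum>l\<in>{i..<j}. B (real (Suc l) / 2 ^ m) w - B (real l / 2 ^ m) w)"
    using assms by (intro sum.cong) (auto simp: step_def)
  also have "\<dots> = B (real j / 2 ^ m) w - B (real i / 2 ^ m) w"
    using sum_Suc_diff'[OF assms(1), of "\<lambda>l. B (real l / 2 ^ m) w"] .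
  finally show ?thesis .
qed

lemma planar_density_eq:
  assumes "0 < t"
  shows "(\<Prod>i\<in>UNIV. normal_density 0 (sqrt t) ((x :: real^2) $ i)) = exp (- ((norm x)\<^sup>2 / (2 * t))) / (2
      * pi * t)"
proof -
  have "(\<Prod>i\<in>UNIV. normal_density 0 (sqrt t) (x $ i)) = normal_density 0 (sqrt t) (x $ 1)
      * normal_density 0 (sqrt t) (x $ 2)"
    by (simp add: UNIV_2)
  also have "\<dots> = exp (- ((x $ 1)\<^sup>2 / (2 * t))) * exp (- ((x $ 2)\<^sup>2 / (2 * t))) / (sqrt (2 * pi * t)
      * sqrt (2 * pi * t))"
    using assms by (simp add: normal_density_def)
  also have "sqrt (2 * pi * t) * sqrt (2 * pi * t) = 2 * pi * t"
    using assms by simp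
  also have "exp (- ((x $ 1)\<^sup>2 / (2 * t))) * exp (- ((x $ 2)\<^sup>2 / (2 * t))) = exp (- ((norm x)\<^sup>2 / (2 * t)))"
    by (simp add: norm_real2_eq exp_add[symmetric] add_divide_distrib)
  finally show ?thesis .
qed

text \<open>With \<open>t - s = d\<close>, the density is at most \<open>1 / (2 * pi * d)\<close>,
  and at least half of that at points of squared norm at most \<open>d\<close>, as
  \<open>exp (-1/2) \<ge> 1/2\<close>; the disc has area \<open>pi * \<rho>\<^sup>2\<close>.\<close>

lemma increment_ball:
  assumes "0 \<le> s" "s < t" "t \<le> 1" and \<rho>: "0 \<le> \<rho>"
  shows "prob {w \<in> space M. norm (B t w - B s w + x) \<le> \<rho>} \<le> \<rho>\<^sup>2 / (2 * (t - s))"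
    and "\<rho>\<^sup>2 \<le> t - s \<Longrightarrow> \<rho>\<^sup>2 / (4 * (t - s)) \<le> prob {w \<in> space M. norm (B t w - B s w) \<le> \<rho>}"
proof -
  let ?D = "\<lambda>w. B t w - B s w" and ?t = "t - s"
  let ?p = "\<lambda>x. ennreal (\<Prod>i\<in>UNIV. normal_density 0 (sqrt ?t) ((x :: real^2) $ i))"
  have t: "0 < ?t" using assms by simp
  have dist: "distributed M lborel ?D ?p" using assms by (intro gaussian_increments)
  have em: "emeasure M {w \<in> space M. norm (?D w + x) \<le> \<rho>} = (\<integral>\<^sup>+y. ?p y * indicator (cball
      (- x) \<rho>) y \<partial>lborel)" for x
  proof -
    have "{w \<in> space M. norm (?D w + x) \<le> \<rho>} = ?D -` cball (- x) \<rho> \<inter> space M"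
      by (auto simp: dist_norm norm_minus_commute[of _ "B _ _ - B _ _"] algebra_simps)
         (metis (no_types, opaque_lifting) add.commute diff_minus_eq_add dist_commute dist_norm
             minus_diff_eq norm_minus_commute)+
    then show ?thesis using distributed_emeasure[OF dist, of "cball (- x) \<rho>"] by simp
  qed
  have area: "emeasure lborel (cball (y :: real^2) \<rho>) = ennreal (pi * \<rho>\<^sup>2)" for y
    using \<rho> by (simp add: emeasure_cball_real2)
  show "prob {w \<in> space M. norm (?D w + x) \<le> \<rho>} \<le> \<rho>\<^sup>2 / (2 * ?t)"
  proof -
    have "emeasure M {w \<in> space M. norm (?D w + x) \<le> \<rho>} \<le> (\<integral>\<^sup>+y. ennreal (1 / (2 * pi * ?t)) * indicator
        (cball (- x) \<rho>) y \<partial>lborel)"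
      unfolding em planar_density_eq[OF t]
      using t by (intro nn_integral_mono mult_right_mono ennreal_leI divide_right_mono) auto
    also have "\<dots> = ennreal (1 / (2 * pi * ?t)) * ennreal (pi * \<rho>\<^sup>2)"
      by (subst nn_integral_cmult_indicator) (auto simp: area)
    also have "\<dots> = ennreal (1 / (2 * pi * ?t) * (pi * \<rho>\<^sup>2))" using t by (intro ennreal_mult[symmetric]) auto
    also have "1 / (2 * pi * ?t) * (pi * \<rho>\<^sup>2) = \<rho>\<^sup>2 / (2 * ?t)" by simp
    finally show ?thesis using t by (simp add: emeasure_eq_measure)
  qed
  show "\<rho>\<^sup>2 / (4 * ?t) \<le> prob {w \<in> space M. norm (?D w) \<le> \<rho>}" if \<rho>t: "\<rho>\<^sup>2 \<le> ?t"
  proof -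
    have "\<rho>\<^sup>2 / (4 * ?t) = 1 / (4 * pi * ?t) * (pi * \<rho>\<^sup>2)" by simp
    then have "ennreal (\<rho>\<^sup>2 / (4 * ?t)) = ennreal (1 / (4 * pi * ?t)) * ennreal (pi * \<rho>\<^sup>2)"
      using t by (simp only:) (intro ennreal_mult, auto)
    also have "\<dots> = (\<integral>\<^sup>+y. ennreal (1 / (4 * pi * ?t)) * indicator (cball (- (0 :: real^2)) \<rho>) y \<partial>lborel)"
      by (subst nn_integral_cmult_indicator) (auto simp: area)
    also have "\<dots> \<le> emeasure M {w \<in> space M. norm (?D w + 0) \<le> \<rho>}"
      unfolding em planar_density_eq[OF t]
    proof (intro nn_integral_mono)
      fix y :: "real^2"
      show "ennreal (1 / (4 * pi * ?t)) * indicator (cball (- 0) \<rho>) y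
        \<le> ennreal (exp (- ((norm y)\<^sup>2 / (2 * ?t))) / (2 * pi * ?t)) * indicator (cball (- 0) \<rho>) y"
      proof (cases "norm y \<le> \<rho>")
        case True
        then have "(norm y)\<^sup>2 \<le> \<rho>\<^sup>2" by (intro power_mono) auto
        then have "(norm y)\<^sup>2 / (2 * ?t) \<le> 1/2" using \<rho>t t by (simp add: field_simps)
        then have "1/2 \<le> exp (- ((norm y)\<^sup>2 / (2 * ?t)))"
          using exp_ge_add_one_self[of "- ((norm y)\<^sup>2 / (2 * ?t))"] by linarith
        then have "1/2 / (2 * pi * ?t) \<le> exp (- ((norm y)\<^sup>2 / (2 * ?t))) / (2 * pi * ?t)"
          using t by (intro divide_right_mono) auto
        then have "1 / (4 * pi * ?t) \<le> exp (- ((norm y)\<^sup>2 / (2 * ?t))) / (2 * pi * ?t)" by simp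
        then show ?thesis by (intro mult_right_mono ennreal_leI) auto
      qed (auto simp: indicator_def)
    qed
    finally show ?thesis by (simp add: emeasure_eq_measure)
  qed
qed

lemma gaussian_walk_step: "gaussian_walk M (step m) (2 ^ m) (1 / 2 ^ m)"
proof unfold_locales
  let ?t = "\<lambda>i::nat. real i / 2 ^ m"
  have "indep_vars (\<lambda>_. borel) (\<lambda>i w. B (?t (Suc i)) w - B (?t i) w) {..<2 ^ m}"
  proof (rule independent_increments)
    show "?t ` {..2 ^ m} \<subseteq> {0..1}" by (auto simp: divide_le_eq_1)
    show "mono_on {..2 ^ m} ?t" by (intro mono_onI divide_right_mono) auto
  qed
  then show "indep_vars (\<lambda>_. borel) (step m) {..<2 ^ m}"
    by (subst indep_vars_cong[where Y = "\<lambda>i w. B (?t (Suc i)) w - B (?t i) w"]) (auto simp: step_def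
        fun_eq_iff)
  have B: "random_variable borel (B (?t l))" if "l \<le> 2 ^ m" for l
    using that by (intro random_variable_B) (auto simp: divide_le_eq_1)
  show "random_variable borel (step m l)" for l
    using B[of l] B[of "Suc l"] unfolding step_def[abs_def] by (cases "l < 2 ^ m") auto
  fix i j :: nat and \<rho> :: real and x :: "real^2"
  assume ij: "i < j" "j \<le> 2 ^ m" and \<rho>: "0 \<le> \<rho>"
  have t: "0 \<le> ?t i" "?t i < ?t j" "?t j \<le> 1" using ij by (auto simp: divide_strict_right_mono
      divide_le_eq_1)
  have s: "(\<Sum>l\<in>{i..<j}. step m l w) = B (?t j) w - B (?t i) w" for w
    using ij by (intro sum_step) auto
  have d: "c * (1 / 2 ^ m) * real (j - i) = c * (?t j - ?t i)" for c
    using ij by (simp add: diff_divide_distrib right_diff_distrib)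
  show "prob {w \<in> space M. norm ((\<Sum>l\<in>{i..<j}. step m l w) + x) \<le> \<rho>} \<le> \<rho>\<^sup>2 / (2 * (1 / 2 ^ m) * real
      (j - i))"
    using increment_ball(1)[OF t \<rho>] unfolding s d .
  assume "\<rho>\<^sup>2 \<le> 1 / 2 ^ m * real (j - i)"
  then have "\<rho>\<^sup>2 \<le> ?t j - ?t i" using d[of 1] by simp
  from increment_ball(2)[OF t \<rho> this]
  show "\<rho>\<^sup>2 / (4 * (1 / 2 ^ m) * real (j - i)) \<le> prob {w \<in> space M. norm (\<Sum>l\<in>{i..<j}. step m l w) \<le> \<rho>}"
    unfolding s d .
qed simp

text \<open>The failure probability \<open>100 / k\<^sup>2\<close> holds for every mesh with
  \<open>m \<ge> 2 * k\<close>; hence at all large scales there are arbitrarily fine good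
  meshes.\<close>

lemma AE_close_pairs:
  "AE w in M. eventually (\<lambda>k. \<exists>\<^sub>F m in sequentially.
     (\<Sum>s<2 ^ m. \<Sum>t<2 ^ m. of_bool (norm (B (real s / 2 ^ m) w - B (real t / 2 ^ m) w) \<le> 1 / 2 ^ k))
       \<le> 45 * real k * 4 ^ m / 4 ^ k) sequentially"
proof -
  define E where "E k m = {w \<in> space M. 45 * real k * 4 ^ m / 4 ^ k < gaussian_walk.close_pairs (step m)
      (1 / 2 ^ k) 0 (2 ^ m) w}" for k m
  have "AE w in M. eventually (\<lambda>k. \<exists>\<^sub>F m in sequentially. w \<notin> E k m) sequentially"
  proof (rule frequently_good_of_summable_bad[where start = "\<lambda>k. 2 * k" and kmin = 1])
    have [measurable]: "random_variable borel (gaussian_walk.close_pairs (step m) (1 / 2 ^ k) 0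
        (2 ^ m))" for k m
      by (rule gaussian_walk.close_pairs_measurable[OF gaussian_walk_step])
    show "E k m \<in> events" for k m unfolding E_def by measurable
    show "prob (E k m) \<le> 100 / (real k)\<^sup>2" if "2 * k \<le> m" "1 \<le> k" for k m
      unfolding E_def using that by (intro gaussian_walk.close_pairs_tail[OF gaussian_walk_step refl
          refl]) auto
    have "summable (\<lambda>k. 100 * inverse ((real k)\<^sup>2))"
      using inverse_power_summable[of 2, where 'a = real] by (intro summable_mult) simp
    then show "summable (\<lambda>k. 100 / (real k)\<^sup>2)" by (simp add: divide_inverse)
  qed
  then show ?thesis
    using AE_space
  proof eventually_elim
    case (elim w)
    have inc: "gaussian_walk.inc (step m) 0 s w = B (real s / 2 ^ m) w - B 0 w" if "s \<le> 2 ^ m" for s m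
      using sum_step[of 0 s m w] that by (simp add: gaussian_walk.inc_def[OF gaussian_walk_step])
    have cp: "gaussian_walk.close_pairs (step m) (1 / 2 ^ k) 0 (2 ^ m) w =
      (\<Sum>s<2 ^ m. \<Sum>t<2 ^ m. of_bool (norm (B (real s / 2 ^ m) w - B (real t / 2 ^ m) w)
          \<le> 1 / 2 ^ k))" for k m
      unfolding gaussian_walk.close_pairs_def[OF gaussian_walk_step] add_0 lessThan_atLeast0
      by (intro sum.cong refl) (simp add: inc)
    from elim(1) show ?case
      by eventually_elim (auto simp: E_def cp elim(2) not_less elim: frequently_elim1)
  qed
qed

lemma AE_neighbourhood_area:
  "AE w in M. eventually (\<lambda>k. \<exists>\<^sub>F m in sequentially.
     emeasure lborel (\<Union>i\<le>2 ^ m. cball (B (real (i::nat) / 2 ^ m) w) (1 / 2 ^ k))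
         \<le> ennreal (576 * pi / real k)) sequentially"
proof -
  define E where "E k m = {w \<in> space M. ennreal (576 * pi / real k) \<le> neighbourhood_area (1 / 2 ^ k)
      (2 ^ m) (\<lambda>l. step m l w)}" for k m
  have "AE w in M. eventually (\<lambda>k. \<exists>\<^sub>F m in sequentially. w \<notin> E k m) sequentially"
  proof (rule frequently_good_of_summable_bad[where start = "\<lambda>k. 2 * k" and kmin = 2])
    have [measurable]: "random_variable borel (\<lambda>w. neighbourhood_area (1 / 2 ^ k) (2 ^ m)
        (\<lambda>l. step m l w))" for k m
      by (intro neighbourhood_area_measurable gaussian_walk.X_rv[OF gaussian_walk_step])
    show "E k m \<in> events" for k m unfolding E_def by measurable
    show "prob (E k m) \<le> 8 / 2 ^ k" if "2 * k \<le> m" "2 \<le> k" for k m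
      unfolding E_def using that by (intro gaussian_walk.total_area_tail[OF gaussian_walk_step refl
          refl]) auto
    have "summable (\<lambda>k. 8 * (1/2::real) ^ k)" by (intro summable_mult summable_geometric) simp
    then show "summable (\<lambda>k. 8 / 2 ^ k :: real)" by (simp add: power_divide)
  qed
  then show ?thesis
    using AE_space
  proof eventually_elim
    case (elim w)
    have na: "emeasure lborel (\<Union>i\<le>2 ^ m. cball (B (real (i::nat) / 2 ^ m) w) r)
        = neighbourhood_area r (2 ^ m) (\<lambda>l. step m l w)" for r m
    proof -
      have s: "B 0 w + (\<Sum>l<i. step m l w) = B (real i / 2 ^ m) w" if "i \<le> 2 ^ m" for i
        using sum_step[of 0 i m w] that by (simp add: lessThan_atLeast0)
      have "emeasure lborel (\<Union>i\<le>2 ^ m. cball (B (real (i::nat) / 2 ^ m) w) r)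
          = (\<integral>\<^sup>+z. indicator (\<Union>i\<le>2 ^ m. cball (B (real (i::nat) / 2 ^ m) w) r) z \<partial>lborel)"
        by (rule nn_integral_indicator[symmetric]) auto
      also have "\<dots> = (\<integral>\<^sup>+z. of_bool (\<exists>j\<in>{0..2 ^ m}. norm (B 0 w + (\<Sum>l<j. step m l w) - z) \<le> r) \<partial>lborel)"
        by (intro nn_integral_cong) (auto simp: indicator_def dist_norm s)
      finally show ?thesis by (simp only: neighbourhood_area_translate)
    qed
    from elim(1) show ?case
      by eventually_elim (auto simp: E_def na elim(2) not_le elim!: frequently_elim1)
  qed
qed

end

section \<open>Capacities of paths\<close>

lemma dyadic_bracket:
  fixes \<rho> :: real
  assumes "0 < \<rho>" "\<rho> \<le> (1/2) ^ K"
  obtains k where "K \<le> k" "(1/2) ^ Suc k < \<rho>" "\<rho> \<le> (1/2) ^ k"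
proof -
  obtain n0 where n0: "(1/2) ^ n0 < \<rho>" using real_arch_pow_inv[OF assms(1), of "1/2"] by auto
  define n where "n = (LEAST n. (1/2) ^ n < \<rho>)"
  have n: "(1/2) ^ n < \<rho>" unfolding n_def by (rule LeastI[of "\<lambda>n. (1/2) ^ n < \<rho>", OF n0])
  have "K < n"
  proof (rule ccontr)
    assume "\<not> K < n"
    then have "(1/2::real) ^ K \<le> (1/2) ^ n" by (intro power_decreasing) auto
    then show False using n assms(2) by linarith
  qed
  then obtain k where k: "n = Suc k" "K \<le> k" by (cases n) auto
  have "\<rho> \<le> (1/2) ^ k"
    using not_less_Least[of k "\<lambda>n. (1/2) ^ n < \<rho>"] k(1) by (simp add: n_def not_less)
  then show ?thesis using that k n by blast
qed

text \<open>As a property that holds eventually in \<open>m\<close>, it combines with one that holds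
  for infinitely many \<open>m\<close> and yields a single mesh with both.\<close>

lemma fine_grid:
  fixes p :: "real \<Rightarrow> real^2"
  assumes "continuous_on {0..1} p" "0 < e"
  shows "eventually (\<lambda>m. \<forall>t\<in>{0..1}. \<forall>i\<le>2 ^ m. \<bar>t - real i / 2 ^ m\<bar> \<le> 1 / 2 ^ m \<longrightarrow> norm (p t - p
      (real i / 2 ^ m)) \<le> e) sequentially"
proof -
  have "uniformly_continuous_on {0..1} p"
    using assms(1) by (intro compact_uniformly_continuous) auto
  then obtain d where d: "0 < d" "\<And>s t. s \<in> {0..1} \<Longrightarrow> t \<in> {0..1} \<Longrightarrow> dist t s < d \<Longrightarrow> dist (p t) (p s) < e"
    unfolding uniformly_continuous_on_def using assms(2) by metis
  have "(\<lambda>m. (1/2::real) ^ m) \<longlonglongrightarrow> 0" by (intro LIMSEQ_realpow_zero) auto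
  then have "eventually (\<lambda>m. (1/2::real) ^ m < d) sequentially" using d(1) by (rule order_tendstoD)
  then show ?thesis
  proof eventually_elim
    case (elim m)
    then have m: "1 / 2 ^ m < d" by (simp add: power_divide)
    show ?case
    proof (intro ballI allI impI)
      fix t :: real and i :: nat
      assume "t \<in> {0..1}" "i \<le> 2 ^ m" "\<bar>t - real i / 2 ^ m\<bar> \<le> 1 / 2 ^ m"
      then show "norm (p t - p (real i / 2 ^ m)) \<le> e"
        using d(2)[of "real i / 2 ^ m" t] m by (auto simp: dist_norm divide_le_eq_1)
    qed
  qed
qed

lemma grid_cell:
  fixes t :: real
  assumes "t \<in> {0..1}"
  obtains i where "i < 2 ^ m" "real i / 2 ^ m \<le> t" "t \<le> real (Suc i) / 2 ^ m"
proof (cases "t = 1")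
  case True
  have "real (Suc (2 ^ m - 1)) = 2 ^ m" by (simp add: of_nat_diff)
  then show ?thesis using True by (intro that[of "2 ^ m - 1"]) (auto simp: divide_le_eq_1 of_nat_diff)
next
  case False
  define i where "i = nat \<lfloor>t * 2 ^ m\<rfloor>"
  have i: "real i \<le> t * 2 ^ m" "t * 2 ^ m < real i + 1" using assms by (auto simp: i_def)
  have "t * 2 ^ m < 1 * 2 ^ m" using assms False by (intro mult_strict_right_mono) auto
  then have "real i < 2 ^ m" using i by linarith
  then have "i < 2 ^ m" by (metis of_nat_less_iff of_nat_numeral of_nat_power)
  then show ?thesis using i by (intro that[of i]) (auto simp: field_simps)
qed

section \<open>The occupation measure of a path\<close>

definition occupation :: "(real \<Rightarrow> real^2) \<Rightarrow> (real^2) measure" where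
  "occupation p = distr (restrict_space lborel {0..1}) borel p"

lemma occupation:
  assumes "continuous_on {0..1} p"
  shows "prob_space (occupation p)" "sets (occupation p) = sets borel" "emeasure (occupation p)
      (p ` {0..1}) = 1"
proof -
  have pm: "p \<in> measurable (restrict_space lborel {0..1}) borel"
    using borel_measurable_continuous_on_restrict[OF assms]
    by (simp add: measurable_def sets_restrict_space space_restrict_space)
  interpret R: prob_space "restrict_space (lborel :: real measure) {0..1}"
    by (intro prob_spaceI) (simp add: emeasure_restrict_space space_restrict_space)
  show "prob_space (occupation p)" unfolding occupation_def by (rule R.prob_space_distr[OF pm])
  show "sets (occupation p) = sets borel" by (simp add: occupation_def)
  have "compact (p ` {0..1})" using assms by (intro compact_continuous_image) auto
  then have "p ` {0..1} \<in> sets borel" by (intro borel_closed compact_imp_closed)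
  then have "emeasure (occupation p) (p ` {0..1}) = emeasure (restrict_space lborel {0..1}) (p -`
      (p ` {0..1}) \<inter> {0..1})"
    unfolding occupation_def by (subst emeasure_distr[OF pm]) (auto simp: space_restrict_space)
  also have "p -` (p ` {0..1}) \<inter> {0..1} = {0..1}" by auto
  finally show "emeasure (occupation p) (p ` {0..1}) = 1"
    by (simp add: emeasure_restrict_space)
qed

lemma pair_integral_occupation:
  assumes p: "continuous_on {0..1} p" and [measurable]: "g \<in> borel_measurable borel"
  shows "pair_integral (occupation p) g =
    (\<integral>\<^sup>+s. (\<integral>\<^sup>+t. g (norm (p s - p t)) \<partial>restrict_space lborel {0..1}) \<partial>restrict_space lborel {0..1})"
proof -
  have pm[measurable]: "p \<in> measurable (restrict_space lborel {0..1}) borel"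
    using borel_measurable_continuous_on_restrict[OF p]
    by (simp add: measurable_def sets_restrict_space space_restrict_space)
  interpret O: prob_space "occupation p" by (rule occupation[OF p])
  note [measurable_cong] = occupation(2)[OF p]
  have "(\<lambda>x. \<integral>\<^sup>+y. g (norm (x - y)) \<partial>occupation p) \<in> borel_measurable borel"
    by (rule O.borel_measurable_nn_integral) measurable
  then have "pair_integral (occupation p) g = (\<integral>\<^sup>+s. (\<integral>\<^sup>+y. g (norm (p s - y)) \<partial>occupation p)
      \<partial>restrict_space lborel {0..1})"
    unfolding pair_integral_def by (subst occupation_def) (rule nn_integral_distr[OF pm], simp)
  also have "\<dots> = (\<integral>\<^sup>+s. (\<integral>\<^sup>+t. g (norm (p s - p t)) \<partial>restrict_space lborel {0..1}) \<partial>restrict_space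
      lborel {0..1})"
    unfolding occupation_def by (intro nn_integral_cong nn_integral_distr[OF pm]) measurable
  finally show ?thesis .
qed

text \<open>Moving both points to the grid costs \<open>2^-k / 4\<close> each, so a distance up to
  \<open>2^-k / 2\<close> becomes at most \<open>2^-k\<close>. A pair of cells has mass
  \<open>4^-m\<close>, which cancels the \<open>4^m\<close> of the count.\<close>

lemma occupation_close_le:
  assumes p: "continuous_on {0..1} p"
    and freq: "\<exists>\<^sub>F m in sequentially. (\<Sum>s<2 ^ m. \<Sum>t<2 ^ m. of_bool (norm (p (real s / 2 ^ m) - p
        (real t / 2 ^ m)) \<le> 1 / 2 ^ k))
       \<le> 45 * real k * 4 ^ m / 4 ^ k"
  shows "pair_integral (occupation p) (indicator {..(1/2) ^ Suc k}) \<le> ennreal (45 * real k / 4 ^ k)"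
proof -
  let ?e = "1 / 4 / 2 ^ k :: real"
  obtain m where count: "(\<Sum>s<2 ^ m. \<Sum>t<2 ^ m. of_bool (norm (p (real s / 2 ^ m) - p (real t / 2 ^ m))
      \<le> 1 / 2 ^ k))
       \<le> 45 * real k * 4 ^ m / 4 ^ k"
    and grid: "\<And>t i. t \<in> {0..1} \<Longrightarrow> i \<le> 2 ^ m \<Longrightarrow> \<bar>t - real i / 2 ^ m\<bar> \<le> 1 / 2 ^ m
        \<Longrightarrow> norm (p t - p (real i / 2 ^ m)) \<le> ?e"
    using frequently_ex[OF frequently_eventually_conj[OF freq fine_grid[OF p, of ?e]]] by (auto)
  let ?J = "\<lambda>i::nat. {real i / 2 ^ m..real (Suc i) / 2 ^ m}"
  let ?c = "\<lambda>i j. of_bool (norm (p (real i / 2 ^ m) - p (real j / 2 ^ m)) \<le> 1 / 2 ^ k) :: ennreal"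
  let ?R = "restrict_space lborel {0..1::real}"
  have J: "?J i \<subseteq> {0..1}" if "i < 2 ^ m" for i
  proof -
    have "real (Suc i) \<le> 2 ^ m" using that by (metis Suc_leI of_nat_le_iff of_nat_numeral of_nat_power)
    then show ?thesis by (auto simp: divide_le_eq_1 intro: order_trans)
  qed
  have len: "emeasure ?R (?J i) = ennreal (1 / 2 ^ m)" if "i < 2 ^ m" for i
  proof -
    have "emeasure ?R (?J i) = emeasure lborel (?J i)" using J[OF that]
        by (subst emeasure_restrict_space) auto
    also have "\<dots> = ennreal (1 / 2 ^ m)" by (subst emeasure_lborel_Icc) (auto simp: divide_right_mono
        diff_divide_distrib[symmetric])
    finally show ?thesis .
  qed
  have Jm: "?J i \<in> sets ?R" if "i < 2 ^ m" for i
    using J[OF that] by (subst sets_restrict_space_iff) auto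
  have ms: "(\<lambda>t. c * (d * indicator (?J j) t)) \<in> borel_measurable ?R"
    "(\<lambda>s. c * (indicator (?J j) s * d)) \<in> borel_measurable ?R" for c d :: ennreal and j
    by (intro measurable_restrict_space1; measurable)+
  \<comment> \<open>Closed cells share end points, so the double sum may count a pair more than
    once; only domination is claimed.\<close>
  have pt: "indicator {..(1/2) ^ Suc k} (norm (p s - p t)) \<le> (\<Sum>i<2 ^ m. \<Sum>j<2 ^ m. ?c i j * (indicator
      (?J i) s * indicator (?J j) t))"
    if st: "s \<in> {0..1}" "t \<in> {0..1}" for s t
  proof (cases "norm (p s - p t) \<le> (1/2) ^ Suc k")
    case True
    obtain i where i: "i < 2 ^ m" "real i / 2 ^ m \<le> s" "s \<le> real (Suc i) / 2 ^ m"
        using grid_cell[OF st(1)] .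
    obtain j where j: "j < 2 ^ m" "real j / 2 ^ m \<le> t" "t \<le> real (Suc j) / 2 ^ m"
        using grid_cell[OF st(2)] .
    have 1: "norm (p s - p (real i / 2 ^ m)) \<le> ?e"
      using i st by (intro grid) (auto simp: add_divide_distrib)
    have 2: "norm (p t - p (real j / 2 ^ m)) \<le> ?e"
      using j st by (intro grid) (auto simp: add_divide_distrib)
    have "norm (p (real i / 2 ^ m) - p (real j / 2 ^ m)) \<le> norm (p s - p (real i / 2 ^ m)) + norm
        (p s - p t) + norm (p t - p (real j / 2 ^ m))"
      using norm_triangle_ineq4[of "p s - p t" "p s - p (real i / 2 ^ m)"]
        norm_triangle_ineq[of "p (real i / 2 ^ m) - p t" "p t - p (real j / 2 ^ m)"] by simp
    also have "\<dots> \<le> ?e + (1/2) ^ Suc k + ?e" using 1 2 True by linarith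
    also have "\<dots> = 1 / 2 ^ k" by (simp add: power_divide)
    finally have c: "?c i j = 1" by simp
    have "indicator {..(1/2) ^ Suc k} (norm (p s - p t)) = ?c i j * (indicator (?J i) s * indicator
        (?J j) t)"
      using True i j c by simp
    also have "\<dots> \<le> (\<Sum>j<2 ^ m. ?c i j * (indicator (?J i) s * indicator (?J j) t))"
      using j by (intro member_le_sum[of j]) auto
    also have "\<dots> \<le> (\<Sum>i<2 ^ m. \<Sum>j<2 ^ m. ?c i j * (indicator (?J i) s * indicator (?J j) t))"
      using i by (intro member_le_sum[of i "{..<2^m}" "\<lambda>i. \<Sum>j<2 ^ m. ?c i j * (indicator (?J i) s
          * indicator (?J j) t)"]) (auto intro!: sum_nonneg)
    finally show ?thesis .
  qed auto
  have "pair_integral (occupation p) (indicator {..(1/2) ^ Suc k})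
      = (\<integral>\<^sup>+s. (\<integral>\<^sup>+t. indicator {..(1/2) ^ Suc k} (norm (p s - p t)) \<partial>?R) \<partial>?R)"
    by (rule pair_integral_occupation[OF p]) simp
  also have "\<dots> \<le> (\<integral>\<^sup>+s. (\<integral>\<^sup>+t. (\<Sum>i<2 ^ m. \<Sum>j<2 ^ m. ?c i j * (indicator (?J i) s * indicator
      (?J j) t)) \<partial>?R) \<partial>?R)"
    by (intro nn_integral_mono pt) (auto simp: space_restrict_space)
  also have "\<dots> = (\<integral>\<^sup>+s. (\<Sum>i<2 ^ m. \<Sum>j<2 ^ m. ?c i j * (indicator (?J i) s * ennreal (1 / 2 ^ m))) \<partial>?R)"
  proof (rule nn_integral_cong)
    fix s
    have "(\<integral>\<^sup>+t. (\<Sum>i<2 ^ m. \<Sum>j<2 ^ m. ?c i j * (indicator (?J i) s * indicator (?J j) t)) \<partial>?R)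
      = (\<Sum>i<2 ^ m. \<integral>\<^sup>+t. (\<Sum>j<2 ^ m. ?c i j * (indicator (?J i) s * indicator (?J j) t)) \<partial>?R)"
      by (rule nn_integral_sum) (intro borel_measurable_sum ms)
    also have "\<dots> = (\<Sum>i<2 ^ m. \<Sum>j<2 ^ m. \<integral>\<^sup>+t. ?c i j * (indicator (?J i) s * indicator (?J j) t) \<partial>?R)"
      by (intro sum.cong refl nn_integral_sum) (intro borel_measurable_sum ms)
    also have "\<dots> = (\<Sum>i<2 ^ m. \<Sum>j<2 ^ m. ?c i j * (indicator (?J i) s * ennreal (1 / 2 ^ m)))"
    proof (intro sum.cong refl)
      fix i j :: nat assume "j \<in> {..<2 ^ m}"
      then have j: "j < 2 ^ m" by simp
      show "(\<integral>\<^sup>+t. ?c i j * (indicator (?J i) s * indicator (?J j) t) \<partial>?R)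
          = ?c i j * (indicator (?J i) s * ennreal (1 / 2 ^ m))"
        unfolding mult.assoc[symmetric] using nn_integral_cmult_indicator[OF Jm[OF j]] len[OF j] by simp
    qed
    finally show "(\<integral>\<^sup>+t. (\<Sum>i<2 ^ m. \<Sum>j<2 ^ m. ?c i j * (indicator (?J i) s * indicator (?J j) t)) \<partial>?R)
        = \<dots>" .
  qed
  also have "\<dots> = (\<Sum>i<2 ^ m. \<integral>\<^sup>+s. (\<Sum>j<2 ^ m. ?c i j * (indicator (?J i) s * ennreal (1 / 2 ^ m))) \<partial>?R)"
    by (rule nn_integral_sum) (intro borel_measurable_sum ms)
  also have "\<dots> = (\<Sum>i<2 ^ m. \<Sum>j<2 ^ m. \<integral>\<^sup>+s. ?c i j * (indicator (?J i) s * ennreal (1 / 2 ^ m)) \<partial>?R)"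
    by (intro sum.cong refl nn_integral_sum) (intro borel_measurable_sum ms)
  also have "\<dots> = (\<Sum>i<2 ^ m. \<Sum>j<2 ^ m. ?c i j * (ennreal (1 / 2 ^ m) * ennreal (1 / 2 ^ m)))"
  proof (intro sum.cong refl)
    fix i j :: nat assume "i \<in> {..<2 ^ m}"
    then have i: "i < 2 ^ m" by simp
    have "(\<integral>\<^sup>+s. ?c i j * (indicator (?J i) s * ennreal (1 / 2 ^ m)) \<partial>?R) = (\<integral>\<^sup>+s. ?c i j * ennreal
        (1 / 2 ^ m) * indicator (?J i) s \<partial>?R)"
      by (simp only: mult_ac)
    also have "\<dots> = ?c i j * ennreal (1 / 2 ^ m) * ennreal (1 / 2 ^ m)"
      by (subst nn_integral_cmult_indicator[OF Jm[OF i]]) (simp only: len[OF i])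
    finally show "(\<integral>\<^sup>+s. ?c i j * (indicator (?J i) s * ennreal (1 / 2 ^ m)) \<partial>?R)
        = ?c i j * (ennreal (1 / 2 ^ m) * ennreal (1 / 2 ^ m))"
      by (simp only: mult.assoc)
  qed
  also have "\<dots> = (\<Sum>i<2 ^ m. \<Sum>j<2 ^ m. ennreal (of_bool (norm (p (real i / 2 ^ m) - p (real j / 2 ^ m))
      \<le> 1 / 2 ^ k) * (1 / 4 ^ m)))"
  proof (intro sum.cong refl)
    fix i j :: nat
    have "(1 / 2 ^ m) * (1 / 2 ^ m) = (1 / 4 ^ m :: real)" by (simp flip: power_mult_distrib)
    then have "ennreal (1 / 2 ^ m) * ennreal (1 / 2 ^ m) = ennreal (1 / 4 ^ m)"
      by (subst ennreal_mult[symmetric]) auto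
    then show "?c i j * (ennreal (1 / 2 ^ m) * ennreal (1 / 2 ^ m)) = ennreal (of_bool (norm (p
        (real i / 2 ^ m) - p (real j / 2 ^ m)) \<le> 1 / 2 ^ k) * (1 / 4 ^ m))"
      by (cases "norm (p (real i / 2 ^ m) - p (real j / 2 ^ m)) \<le> 1 / 2 ^ k") simp_all
  qed
  also have "\<dots> = ennreal ((\<Sum>i<2 ^ m. \<Sum>j<2 ^ m. of_bool (norm (p (real i / 2 ^ m) - p (real j / 2 ^ m))
      \<le> 1 / 2 ^ k)) * (1 / 4 ^ m))"
    unfolding sum_distrib_right by (subst sum_ennreal; (subst sum_ennreal)?; auto intro!: sum_nonneg)
  also have "\<dots> \<le> ennreal (45 * real k * 4 ^ m / 4 ^ k * (1 / 4 ^ m))"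
    by (intro ennreal_leI mult_right_mono count) auto
  also have "45 * real k * 4 ^ m / 4 ^ k * (1 / 4 ^ m) = 45 * real k / 4 ^ k" by simp
  finally show ?thesis .
qed

section \<open>Packing and covering numbers of the trace\<close>

lemma finite_maximal_separated:
  fixes F :: "(real^2) set"
  assumes "finite F"
  obtains P where "P \<subseteq> F" "\<And>x y. x \<in> P \<Longrightarrow> y \<in> P \<Longrightarrow> x \<noteq> y \<Longrightarrow> d < norm (x - y)"
    "\<And>x. x \<in> F \<Longrightarrow> \<exists>y\<in>P. norm (x - y) \<le> d \<or> x = y"
proof -
  define S where "S = {P. P \<subseteq> F \<and> (\<forall>x\<in>P. \<forall>y\<in>P. x \<noteq> y \<longrightarrow> d < norm (x - y))}"
  have "finite S" using assms by (auto simp: S_def)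
  moreover have "{} \<in> S" by (simp add: S_def)
  ultimately obtain P where P: "P \<in> S" "\<And>Q. Q \<in> S \<Longrightarrow> P \<subseteq> Q \<Longrightarrow> P = Q"
    using finite_has_maximal[of S] by (metis empty_iff)
  have "\<exists>y\<in>P. norm (x - y) \<le> d \<or> x = y" if x: "x \<in> F" for x
  proof (rule ccontr)
    assume far: "\<not> ?thesis"
    then have "insert x P \<in> S" using P(1) x by (auto simp: S_def norm_minus_commute not_le)
    then have "x \<in> P" using P(2) by blast
    then show False using far by auto
  qed
  then show ?thesis using P(1) by (intro that[of P]) (auto simp: S_def)
qed

text \<open>Discs of radius \<open>r = 2^-k\<close> around a maximal \<open>2 * r\<close>-separated
  set of grid points are disjoint, so the area bounds their number by \<open>576 * 4^k / k\<close>.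
  By maximality and the fine mesh the discs of radius \<open>3 * r\<close> with the same centres
  cover the trace; their diameter is \<open>6 * r\<close>.\<close>

lemma covering_from_area:
  assumes p: "continuous_on {0..1} p" and k: "0 < k"
    and freq: "\<exists>\<^sub>F m in sequentially. emeasure lborel (\<Union>i\<le>2 ^ m. cball (p (real (i::nat) / 2 ^ m))
        (1 / 2 ^ k)) \<le> ennreal (576 * pi / real k)"
    and \<nu>: "prob_space \<nu>" "sets \<nu> = sets borel" "emeasure \<nu> (p ` {0..1}) = 1"
  shows "ennreal (real k / (576 * 4 ^ k)) \<le> pair_integral \<nu> (indicator {..6 * (1/2) ^ k})"
proof -
  let ?r = "1 / 2 ^ k :: real"
  have r: "0 < ?r" by simp
  obtain m where area: "emeasure lborel (\<Union>i\<le>2 ^ m. cball (p (real (i::nat) / 2 ^ m)) ?r)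
      \<le> ennreal (576 * pi / real k)"
    and grid: "\<And>t i. t \<in> {0..1} \<Longrightarrow> i \<le> 2 ^ m \<Longrightarrow> \<bar>t - real i / 2 ^ m\<bar> \<le> 1 / 2 ^ m
        \<Longrightarrow> norm (p t - p (real i / 2 ^ m)) \<le> ?r"
    using frequently_ex[OF frequently_eventually_conj[OF freq fine_grid[OF p r]]] by auto
  define F where "F = (\<lambda>i::nat. p (real i / 2 ^ m)) ` {..2 ^ m}"
  obtain P where P: "P \<subseteq> F" and sep: "\<And>x y. x \<in> P \<Longrightarrow> y \<in> P \<Longrightarrow> x \<noteq> y \<Longrightarrow> 2 * ?r < norm (x - y)"
    and net: "\<And>x. x \<in> F \<Longrightarrow> \<exists>y\<in>P. norm (x - y) \<le> 2 * ?r \<or> x = y"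
    using finite_maximal_separated[of F "2 * ?r"] by (auto simp: F_def)
  have finP: "finite P" using P by (rule finite_subset) (simp add: F_def)
  have disj: "disjoint_family_on (\<lambda>x. cball x ?r) P"
  proof (unfold disjoint_family_on_def, intro ballI impI)
    fix x y assume xy: "x \<in> P" "y \<in> P" "x \<noteq> y"
    show "cball x ?r \<inter> cball y ?r = {}"
    proof (rule ccontr)
      assume "\<not> ?thesis"
      then obtain z where "dist x z \<le> ?r" "dist y z \<le> ?r" by auto
      then have "dist x y \<le> ?r + ?r" using dist_triangle[of x y z] by (simp add: dist_commute)
      then show False using sep[OF xy] by (simp add: dist_norm)
    qed
  qed
  have "ennreal (real (card P) * (pi * ?r\<^sup>2)) = (\<Sum>x\<in>P. emeasure lborel (cball x ?r))"
    using r by (simp add: emeasure_cball_real2 ennreal_mult ennreal_of_nat_eq_real_of_nat)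
  also have "\<dots> = emeasure lborel (\<Union>x\<in>P. cball x ?r)"
    using finP disj by (intro sum_emeasure) auto
  also have "\<dots> \<le> emeasure lborel (\<Union>i\<le>2 ^ m. cball (p (real (i::nat) / 2 ^ m)) ?r)"
    using P by (intro emeasure_mono) (auto simp: F_def)
  also note area
  finally have "real (card P) * (pi * ?r\<^sup>2) \<le> 576 * pi / real k"
    by (subst (asm) ennreal_le_iff) auto
  then have "pi * (real (card P) * ?r\<^sup>2) \<le> pi * (576 / real k)" by (simp add: mult_ac)
  then have "real (card P) * ?r\<^sup>2 \<le> 576 / real k" by (subst (asm) mult_le_cancel_left_pos) auto
  moreover have "?r\<^sup>2 = 1 / 4 ^ k" by (simp add: power_divide power2_eq_square flip: power_mult_distrib)
  ultimately have card: "real (card P) \<le> 576 * 4 ^ k / real k" by (simp add: field_simps)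
  obtain h where h: "bij_betw h {0..<card P} P" using ex_bij_betw_nat_finite[OF finP] by auto
  define E where "E i = cball (h i) (3 * ?r)" for i
  have sub: "p ` {0..1} \<subseteq> (\<Union>i<card P. E i)"
  proof
    fix x assume "x \<in> p ` {0..1}"
    then obtain t where t: "t \<in> {0..1}" "x = p t" by auto
    obtain i where i: "i < 2 ^ m" "real i / 2 ^ m \<le> t" "t \<le> real (Suc i) / 2 ^ m" using grid_cell[OF t(1)] .
    have near: "norm (p t - p (real i / 2 ^ m)) \<le> ?r" using i t
        by (intro grid) (auto simp: add_divide_distrib)
    have "p (real i / 2 ^ m) \<in> F" using i by (auto simp: F_def)
    then obtain y where y: "y \<in> P" "norm (p (real i / 2 ^ m) - y) \<le> 2 * ?r" using net r by fastforce
    then have "norm (x - y) \<le> 3 * ?r"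
      using near norm_triangle_ineq[of "p t - p (real i / 2 ^ m)" "p (real i / 2 ^ m) - y"] t by simp
    moreover obtain j where "j < card P" "h j = y" using h y(1)
        by (metis atLeastLessThan_iff bij_betw_iff_bijections)
    ultimately show "x \<in> (\<Union>i<card P. E i)" by (auto simp: E_def dist_norm norm_minus_commute)
  qed
  interpret \<nu>: prob_space \<nu> by (rule \<nu>)
  have "emeasure \<nu> (\<Union>i<card P. E i) = 1"
  proof (rule antisym)
    have "emeasure \<nu> (p ` {0..1}) \<le> emeasure \<nu> (\<Union>i<card P. E i)"
      by (rule emeasure_mono[OF sub]) (auto simp: \<nu> E_def)
    then show "1 \<le> emeasure \<nu> (\<Union>i<card P. E i)" using \<nu>(3) by simp
  qed (rule \<nu>.emeasure_le_1)
  then have N: "ennreal (1 / real (card P)) \<le> pair_integral \<nu> (indicator {..6 * (1/2) ^ k})"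
  proof (intro pair_integral_ge_inverse_covering_number[OF \<nu>(1,2), of _ E])
    show "norm (x - y) \<le> 6 * (1/2) ^ k" if "x \<in> E i" "y \<in> E i" for i x y
    proof -
      have "dist x y \<le> 3 * ?r + 3 * ?r" using that dist_triangle[of x y "h i"]
          by (auto simp: E_def dist_commute)
      then show ?thesis by (simp add: dist_norm power_divide)
    qed
  qed (auto simp: E_def)
  have "p 0 \<in> F" unfolding F_def by (rule image_eqI[of _ _ 0]) auto
  then have "P \<noteq> {}" using net[of "p 0"] by auto
  then have "0 < real (card P)" using finP by (simp add: card_gt_0_iff)
  then have "real k / (576 * 4 ^ k) \<le> 1 / real (card P)"
    using card k by (simp add: field_simps)
  then show ?thesis using N by (meson ennreal_leI order_trans)
qed

text \<open>Passes from the scales \<open>2^-k\<close> to all small radii: between consecutive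
  scales \<open>\<rho>\<^sup>2\<close> and the logarithm change only by constant factors.\<close>

lemma capacity_equivalence_of_path:
  assumes p: "continuous_on {0..1} p"
    and pairs: "eventually (\<lambda>k. \<exists>\<^sub>F m in sequentially. (\<Sum>s<2 ^ m. \<Sum>t<2 ^ m. of_bool (norm (p
        (real s / 2 ^ m) - p (real t / 2 ^ m)) \<le> 1 / 2 ^ k))
       \<le> 45 * real k * 4 ^ m / 4 ^ k) sequentially"
    and area: "eventually (\<lambda>k. \<exists>\<^sub>F m in sequentially. emeasure lborel (\<Union>i\<le>2 ^ m. cball (p (real
        (i::nat) / 2 ^ m)) (1 / 2 ^ k)) \<le> ennreal (576 * pi / real k)) sequentially"
  shows "\<exists>C1 C2 :: real. 0 < C1 \<and> 0 < C2 \<and>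
    (\<forall>f. energy_kernel f \<longrightarrow>
      ereal C1 * capacity (log_kernel f) (cbox 0 1) \<le> capacity (\<lambda>r. enn2ereal (f r)) (p ` {0..1}) \<and>
      capacity (\<lambda>r. enn2ereal (f r)) (p ` {0..1}) \<le> ereal C2 * capacity (log_kernel f) (cbox 0 1))"
proof -
  obtain K where K: "1 \<le> K"
    "\<And>k. K \<le> k \<Longrightarrow> pair_integral (occupation p) (indicator {..(1/2) ^ Suc k}) \<le> ennreal (45 * real k / 4 ^ k)"
    "\<And>k \<nu>. K \<le> k \<Longrightarrow> prob_space \<nu> \<Longrightarrow> sets \<nu> = sets borel \<Longrightarrow> emeasure \<nu> (p ` {0..1}) = 1 \<Longrightarrow>
      ennreal (real k / (576 * 4 ^ k)) \<le> pair_integral \<nu> (indicator {..6 * (1/2) ^ k})"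
  proof -
    obtain K1 K2 where 1: "\<And>k. K1 \<le> k \<Longrightarrow> \<exists>\<^sub>F m in sequentially. (\<Sum>s<2 ^ m. \<Sum>t<2 ^ m. of_bool (norm (p
        (real s / 2 ^ m) - p (real t / 2 ^ m)) \<le> 1 / 2 ^ k))
       \<le> 45 * real k * 4 ^ m / 4 ^ k"
      and 2: "\<And>k. K2 \<le> k \<Longrightarrow> \<exists>\<^sub>F m in sequentially. emeasure lborel (\<Union>i\<le>2 ^ m. cball (p (real
          (i::nat) / 2 ^ m)) (1 / 2 ^ k)) \<le> ennreal (576 * pi / real k)"
      using pairs area unfolding eventually_sequentially by blast
    show ?thesis
    proof (rule that[of "max 1 (max K1 K2)"])
      fix k assume "max 1 (max K1 K2) \<le> k"
      then have k: "0 < k" "K1 \<le> k" "K2 \<le> k" by auto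
      show "pair_integral (occupation p) (indicator {..(1/2) ^ Suc k}) \<le> ennreal (45 * real k / 4 ^ k)"
        by (rule occupation_close_le[OF p 1[OF k(2)]])
      show "ennreal (real k / (576 * 4 ^ k)) \<le> pair_integral \<nu> (indicator {..6 * (1/2) ^ k})"
        if "prob_space \<nu>" "sets \<nu> = sets borel" "emeasure \<nu> (p ` {0..1}) = 1" for \<nu>
        by (rule covering_from_area[OF p k(1) 2[OF k(3)] that])
    qed simp
  qed
  define \<rho>0 :: real where "\<rho>0 = (1/2) ^ Suc (Suc K)"
  have \<rho>0: "0 < \<rho>0" "\<rho>0 < 1"
    unfolding \<rho>0_def by (simp, rule power_Suc_less_one) auto
  have ln2: "1/2 \<le> ln (2::real)" "ln (2::real) \<le> 1"
    using ln_le_minus_one[of "1/2::real"] ln_le_minus_one[of "2::real"] by (auto simp: ln_div)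
  show ?thesis
  \<comment> \<open>The constant \<open>1440\<close> is \<open>45 * 2 * 16\<close>, from
    \<open>k \<le> 2 * ln (1 / \<rho>)\<close> and \<open>4^-k \<le> 16 * \<rho>\<^sup>2\<close>. In
    \<open>c\<close>, \<open>576\<close> comes from the area and \<open>144 = 12\<^sup>2\<close>
    from choosing a scale of at least \<open>\<rho> / 12\<close>.\<close>
  proof (rule capacity_comparison[OF \<rho>0, where c = "1 / (576 * 144)" and C = 1440 and \<mu> = "occupation p"])
    fix \<nu> \<rho> assume \<nu>: "prob_space \<nu>" "sets \<nu> = sets borel" "emeasure \<nu> (p ` {0..1}) = 1"
        and \<rho>: "0 < \<rho>" "\<rho> \<le> \<rho>0"
    have "(1/2::real) ^ Suc (Suc K) \<le> (1/2) ^ K" by (intro power_decreasing) auto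
    then have small: "\<rho> / 6 \<le> (1/2) ^ K" using \<rho> by (simp add: \<rho>0_def)
    have pos: "0 < \<rho> / 6" using \<rho> by simp
    obtain k where k: "K \<le> k" "(1/2) ^ Suc k < \<rho> / 6" "\<rho> / 6 \<le> (1/2) ^ k"
      by (rule dyadic_bracket[OF pos small])
    \<comment> \<open>At the next scale the covering diameter \<open>6 * (1/2) ^ ?k\<close> is
      strictly below \<open>\<rho>\<close>, as the open cut-off demands.\<close>
    let ?k = "Suc k"
    have "\<rho> / 12 \<le> (1/2) ^ ?k" using k(3) by simp
    then have "(\<rho> / 12)\<^sup>2 \<le> ((1/2) ^ ?k)\<^sup>2" using \<rho> by (intro power_mono) auto
    also have "((1/2) ^ ?k)\<^sup>2 = (1 / 4 ^ ?k :: real)" by (simp add: power_divide power2_eq_square flip: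
        power_mult_distrib)
    finally have sq: "\<rho>\<^sup>2 / 144 \<le> 1 / 4 ^ ?k" by (simp add: power_divide)
    have "(1/2) ^ ?k < \<rho>" using k(2) \<rho> by simp
    then have "1 / \<rho> < 2 ^ ?k" using \<rho> by (simp add: power_divide field_simps)
    then have "ln (1 / \<rho>) \<le> ln (2 ^ ?k)" using \<rho> by (subst ln_le_cancel_iff) auto
    also have "\<dots> = real ?k * ln 2" by (rule ln_realpow)
    also have "\<dots> \<le> real ?k" using ln2 by (simp add: mult_left_le)
    finally have lk: "ln (1 / \<rho>) \<le> real ?k" .
    have "1 / (576 * 144) * (\<rho>\<^sup>2 * ln (1 / \<rho>)) = 1 / 576 * (\<rho>\<^sup>2 / 144 * ln (1 / \<rho>))" by simp
    also have "\<dots> \<le> 1 / 576 * (1 / 4 ^ ?k * real ?k)"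
      using sq lk \<rho> \<rho>0 by (intro mult_left_mono mult_mono) auto
    also have "\<dots> = real ?k / (576 * 4 ^ ?k)" by simp
    finally have "ennreal (1 / (576 * 144) * (\<rho>\<^sup>2 * ln (1 / \<rho>))) \<le> ennreal (real ?k / (576 * 4 ^ ?k))"
        by (rule ennreal_leI)
    also have "\<dots> \<le> pair_integral \<nu> (indicator {..6 * (1/2) ^ ?k})" using k by (intro K(3) \<nu>) auto
    also have "\<dots> \<le> pair_integral \<nu> (indicator {..<\<rho>})"
      using k(2) by (intro pair_integral_mono) (auto simp: indicator_def)
    finally show "ennreal (1 / (576 * 144) * (\<rho>\<^sup>2 * ln (1 / \<rho>))) \<le> pair_integral \<nu> (indicator {..<\<rho>})" .
  next
    fix \<rho> assume \<rho>: "0 < \<rho>" "\<rho> \<le> \<rho>0"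
    then have "\<rho> \<le> (1/2) ^ Suc K" by (simp add: \<rho>0_def)
    then obtain k' where k': "Suc K \<le> k'" "(1/2) ^ Suc k' < \<rho>" "\<rho> \<le> (1/2) ^ k'"
        by (rule dyadic_bracket[OF \<rho>(1)])
    then obtain k where k: "K \<le> k" "(1/2) ^ Suc (Suc k) < \<rho>" "\<rho> \<le> (1/2) ^ Suc k" by (cases k') auto
    have "(1/2) ^ k < 4 * \<rho>" using k(2) by simp
    then have "((1/2) ^ k)\<^sup>2 \<le> (4 * \<rho>)\<^sup>2" by (intro power_mono) auto
    also have "((1/2) ^ k)\<^sup>2 = (1 / 4 ^ k :: real)" by (simp add: power_divide power2_eq_square flip:
        power_mult_distrib)
    finally have sq: "1 / 4 ^ k \<le> 16 * \<rho>\<^sup>2" by (simp add: power_mult_distrib)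
    have "(1/2::real) ^ Suc k \<le> (1/2) ^ k" by (intro power_decreasing) auto
    then have "\<rho> \<le> (1/2) ^ k" using k(3) by linarith
    then have "2 ^ k \<le> 1 / \<rho>" using \<rho> by (simp add: power_divide field_simps)
    then have "ln (2 ^ k) \<le> ln (1 / \<rho>)" using \<rho> by (subst ln_le_cancel_iff) auto
    then have "real k * ln 2 \<le> ln (1 / \<rho>)" by (simp add: ln_realpow)
    moreover have "real k * (1/2) \<le> real k * ln 2" using ln2 by (intro mult_left_mono) auto
    ultimately have lk: "real k \<le> 2 * ln (1 / \<rho>)" by linarith
    have "pair_integral (occupation p) (indicator {..\<rho>}) \<le> pair_integral (occupation p)
        (indicator {..(1/2) ^ Suc k})"
      using k(3) by (intro pair_integral_mono) (auto simp: indicator_def)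
    also have "\<dots> \<le> ennreal (45 * real k / 4 ^ k)" by (rule K(2)[OF k(1)])
    also have "\<dots> \<le> ennreal (1440 * (\<rho>\<^sup>2 * ln (1 / \<rho>)))"
    proof (rule ennreal_leI)
      have "45 * real k / 4 ^ k = 45 * (real k * (1 / 4 ^ k))" by simp
      also have "\<dots> \<le> 45 * ((2 * ln (1 / \<rho>)) * (16 * \<rho>\<^sup>2))"
        using lk sq \<rho> \<rho>0 by (intro mult_left_mono mult_mono) auto
      finally show "45 * real k / 4 ^ k \<le> 1440 * (\<rho>\<^sup>2 * ln (1 / \<rho>))" by (simp add: mult_ac)
    qed
    finally show "pair_integral (occupation p) (indicator {..\<rho>}) \<le> ennreal (1440 * (\<rho>\<^sup>2 * ln (1 / \<rho>)))" .
  qed (auto simp: occupation[OF p])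
qed

theorem theorem1p2:
  fixes M :: "'w measure" and B :: "real \<Rightarrow> 'w \<Rightarrow> real ^ 2"
  assumes "planar_brownian_motion M B"
  shows "AE \<omega> in M. \<exists>C\<^sub>1 C\<^sub>2 :: real. 0 < C\<^sub>1 \<and> 0 < C\<^sub>2 \<and>
    (\<forall>f. energy_kernel f \<longrightarrow>
      ereal C\<^sub>1 * capacity (log_kernel f) (cbox 0 1)
        \<le> capacity (\<lambda>r. enn2ereal (f r)) ((\<lambda>t. B t \<omega>) ` {0..1}) \<and>
      capacity (\<lambda>r. enn2ereal (f r)) ((\<lambda>t. B t \<omega>) ` {0..1})
        \<le> ereal C\<^sub>2 * capacity (log_kernel f) (cbox 0 1))"
proof -
  interpret planar_brownian_motion M B by fact
  \<comment> \<open>None of the three almost sure events mentions a kernel, so the constants are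
    fixed by the path before \<open>f\<close> is given.\<close>
  show ?thesis
    using continuous_paths AE_close_pairs AE_neighbourhood_area
    by eventually_elim (rule capacity_equivalence_of_path)
qed

end
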